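(* In the operator setting, if $A\in\mathcal{B}(L(\mathcal{X},\mathcal{Y}))$ is invertible with inverse $B\in L(\mathcal{Y},\mathcal{X})$, then $B\in\mathcal{B}(L(\mathcal{Y},\mathcal{X}))$.
   Context: $|k|_\infty=\max_j|k_j|$. Fourier transform $\hat f(\lambda)=\int f(t)e^{-it\cdot\lambda}dt$. A Banach $L^1(\mathbb{R}^d)$-module structure on a Banach space $\mathcal{M}$ associated with a representation $\mathcal{T}:\mathbb{R}^d\to B(\mathcal{M})$ by invertible isometries is a bilinear map $(f,x)\mapsto fx$ with $(f*g)x=f(gx)$, $\|fx\|\le\|f\|_1\|x\|$, $\mathcal{T}(t)(fx)=(f(\cdot+t))x=f(\mathcal{T}(t)x)$, non-degenerate; for $\mathcal{T}$-continuous $x$, $fx=\int f(t)\mathcal{T}(-t)x\,dt$. Operator setting: $\mathcal{X},\mathcal{Y}$ complex Banach spaces; each of $L(\mathcal{X},\mathcal{Y}),L(\mathcal{Y},\mathcal{X}),B(\mathcal{X}),B(\mathcal{Y})$ carries such a module structure with representations $\mathcal{T}_{\mathcal{U}\mathcal{V}}$ satisfying $\mathcal{T}_{\mathcal{U}\mathcal{W}}(t)(BA)=(\mathcal{T}_{\mathcal{V}\mathcal{W}}(t)B)(\mathcal{T}_{\mathcal{U}\mathcal{V}}(t)A)$, and coupled: $A,B$ mutually inverse iff $\mathcal{T}_{\mathcal{X}\mathcal{Y}}(t)A$, $\mathcal{T}_{\mathcal{Y}\mathcal{X}}(t)B$ are, for all $t$. $\hat\phi(\lambda)=\max(1-|\lambda|,0)$;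 $\phi^d_{N,a}\in L^1(\mathbb{R}^d)$ has $\hat\phi^d_{N,a}(\lambda)=\prod_k\hat\phi((\lambda_k-Na_k)/N)$. Beurling class: $\|A\|_{\mathcal{B}}=\sum_{k\in\mathbb{Z}^d}\sup_{n\in\mathbb{Z}^d,\,|n|_\infty\ge|k|_\infty}\|\phi^d_{1,n}A\|$, $\mathcal{B}(L(\mathcal{U},\mathcal{V}))=\{A:\|A\|_{\mathcal{B}}<\infty\}$. *)

theory Defs
  imports "HOL-Analysis.Analysis"
begin

definition L1 :: "(real^'d \<Rightarrow> complex) set" where
  "L1 = {f. integrable lborel f}"

definition l1norm :: "(real^'d \<Rightarrow> complex) \<Rightarrow> real" where
  "l1norm f = (\<integral>t. norm (f t) \<partial>lborel)"

definition conv :: "(real^'d \<Rightarrow> complex) \<Rightarrow> (real^'d \<Rightarrow> complex) \<Rightarrow> real^'d \<Rightarrow> complex" where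
  "conv f g = (\<lambda>t. \<integral>s. f s * g (t - s) \<partial>lborel)"

text \<open>The module M is a set (closed under the vector operations) inside a real normed
  vector type; complex scalar multiplication on M is given by sc.
  act f x is the module product fx.\<close>

definition L1_module ::
  "'m::real_normed_vector set \<Rightarrow> (complex \<Rightarrow> 'm \<Rightarrow> 'm)
   \<Rightarrow> ((real^'d \<Rightarrow> complex) \<Rightarrow> 'm \<Rightarrow> 'm) \<Rightarrow> (real^'d \<Rightarrow> 'm \<Rightarrow> 'm) \<Rightarrow> bool" where
  "L1_module M sc act T \<longleftrightarrow>
     \<comment> \<open>T is a representation of R^d by invertible (complex-linear) isometries of M\<close>
     (\<forall>t. bij_betw (T t) M M) \<and>
     (\<forall>t. \<forall>x\<in>M. \<forall>y\<in>M. T t (x + y) = T t x + T t y) \<and>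
     (\<forall>t c. \<forall>x\<in>M. T t (sc c x) = sc c (T t x)) \<and>
     (\<forall>t. \<forall>x\<in>M. norm (T t x) = norm x) \<and>
     (\<forall>x\<in>M. T 0 x = x) \<and>
     (\<forall>s t. \<forall>x\<in>M. T (s + t) x = T s (T t x)) \<and>
     \<comment> \<open>bilinear map L^1 x M -> M\<close>
     (\<forall>f\<in>L1. \<forall>x\<in>M. act f x \<in> M) \<and>
     (\<forall>f\<in>L1. \<forall>g\<in>L1. \<forall>x\<in>M. act (\<lambda>s. f s + g s) x = act f x + act g x) \<and>
     (\<forall>f\<in>L1. \<forall>c. \<forall>x\<in>M. act (\<lambda>s. c * f s) x = sc c (act f x)) \<and>
     (\<forall>f\<in>L1. \<forall>x\<in>M. \<forall>y\<in>M. act f (x + y) = act f x + act f y) \<and>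
     (\<forall>f\<in>L1. \<forall>c. \<forall>x\<in>M. act f (sc c x) = sc c (act f x)) \<and>
     \<comment> \<open>(f*g)x = f(gx)\<close>
     (\<forall>f\<in>L1. \<forall>g\<in>L1. \<forall>x\<in>M. act (conv f g) x = act f (act g x)) \<and>
     \<comment> \<open>norm estimate\<close>
     (\<forall>f\<in>L1. \<forall>x\<in>M. norm (act f x) \<le> l1norm f * norm x) \<and>
     \<comment> \<open>T(t)(fx) = (f(.+t))x = f(T(t)x)\<close>
     (\<forall>f\<in>L1. \<forall>t. \<forall>x\<in>M. T t (act f x) = act (\<lambda>s. f (s + t)) x
                          \<and> act (\<lambda>s. f (s + t)) x = act f (T t x)) \<and>
     \<comment> \<open>non-degeneracy\<close>
     (\<forall>x\<in>M. (\<forall>f\<in>L1. act f x = 0) \<longrightarrow> x = 0) \<and>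
     \<comment> \<open>for T-continuous x: fx = integral of f(t) T(-t)x dt\<close>
     (\<forall>x\<in>M. continuous_on UNIV (\<lambda>t. T t x) \<longrightarrow>
        (\<forall>f\<in>L1. ((\<lambda>t. sc (f t) (T (- t) x)) has_integral act f x) UNIV))"

class complex_normed_vector = real_normed_vector +
  fixes scaleC :: "complex \<Rightarrow> 'a \<Rightarrow> 'a" (infixr \<open>*\<^sub>C\<close> 75)
  assumes scaleR_scaleC: "scaleR r x = scaleC (complex_of_real r) x"
    and scaleC_add_right: "scaleC a (x + y) = scaleC a x + scaleC a y"
    and scaleC_add_left: "scaleC (a + b) x = scaleC a x + scaleC b x"
    and scaleC_scaleC: "scaleC a (scaleC b x) = scaleC (a * b) x"
    and scaleC_one: "scaleC 1 x = x"
    and norm_scaleC: "norm (scaleC a x) = cmod a * norm x"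

definition CL :: "('u::complex_normed_vector \<Rightarrow>\<^sub>L 'v::complex_normed_vector) set" where
  "CL = {A. \<forall>c v. blinfun_apply A (c *\<^sub>C v) = c *\<^sub>C blinfun_apply A v}"

definition csc :: "complex \<Rightarrow> ('u::complex_normed_vector \<Rightarrow>\<^sub>L 'v::complex_normed_vector)
                    \<Rightarrow> ('u \<Rightarrow>\<^sub>L 'v)" where
  "csc c A = Blinfun (\<lambda>v. c *\<^sub>C blinfun_apply A v)"

definition mutually_inverse :: "('x::real_normed_vector \<Rightarrow>\<^sub>L 'y::real_normed_vector) \<Rightarrow> ('y \<Rightarrow>\<^sub>L 'x) \<Rightarrow> bool" where
  "mutually_inverse A B \<longleftrightarrow> B o\<^sub>L A = id_blinfun \<and> A o\<^sub>L B = id_blinfun"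

definition operator_setting ::
  "((real^'d \<Rightarrow> complex) \<Rightarrow> ('x::{complex_normed_vector,banach} \<Rightarrow>\<^sub>L 'y::{complex_normed_vector,banach}) \<Rightarrow> ('x \<Rightarrow>\<^sub>L 'y))
   \<Rightarrow> (real^'d \<Rightarrow> ('x \<Rightarrow>\<^sub>L 'y) \<Rightarrow> ('x \<Rightarrow>\<^sub>L 'y))
   \<Rightarrow> ((real^'d \<Rightarrow> complex) \<Rightarrow> ('y \<Rightarrow>\<^sub>L 'x) \<Rightarrow> ('y \<Rightarrow>\<^sub>L 'x))
   \<Rightarrow> (real^'d \<Rightarrow> ('y \<Rightarrow>\<^sub>L 'x) \<Rightarrow> ('y \<Rightarrow>\<^sub>L 'x))
   \<Rightarrow> ((real^'d \<Rightarrow> complex) \<Rightarrow> ('x \<Rightarrow>\<^sub>L 'x) \<Rightarrow> ('x \<Rightarrow>\<^sub>L 'x))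
   \<Rightarrow> (real^'d \<Rightarrow> ('x \<Rightarrow>\<^sub>L 'x) \<Rightarrow> ('x \<Rightarrow>\<^sub>L 'x))
   \<Rightarrow> ((real^'d \<Rightarrow> complex) \<Rightarrow> ('y \<Rightarrow>\<^sub>L 'y) \<Rightarrow> ('y \<Rightarrow>\<^sub>L 'y))
   \<Rightarrow> (real^'d \<Rightarrow> ('y \<Rightarrow>\<^sub>L 'y) \<Rightarrow> ('y \<Rightarrow>\<^sub>L 'y)) \<Rightarrow> bool" where
  "operator_setting aXY TXY aYX TYX aXX TXX aYY TYY \<longleftrightarrow>
     L1_module CL csc aXY TXY \<and> L1_module CL csc aYX TYX \<and>
     L1_module CL csc aXX TXX \<and> L1_module CL csc aYY TYY \<and>
     \<comment> \<open>T_UW(t)(BA) = (T_VW(t)B)(T_UV(t)A) for all U,V,W in {X,Y}\<close>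
     (\<forall>t. \<forall>A\<in>CL. \<forall>B\<in>CL. TXX t (B o\<^sub>L A) = TXX t B o\<^sub>L TXX t A) \<and>
     (\<forall>t. \<forall>A\<in>CL. \<forall>B\<in>CL. TXY t (B o\<^sub>L A) = TXY t B o\<^sub>L TXX t A) \<and>
     (\<forall>t. \<forall>A\<in>CL. \<forall>B\<in>CL. TXX t (B o\<^sub>L A) = TYX t B o\<^sub>L TXY t A) \<and>
     (\<forall>t. \<forall>A\<in>CL. \<forall>B\<in>CL. TXY t (B o\<^sub>L A) = TYY t B o\<^sub>L TXY t A) \<and>
     (\<forall>t. \<forall>A\<in>CL. \<forall>B\<in>CL. TYX t (B o\<^sub>L A) = TXX t B o\<^sub>L TYX t A) \<and>
     (\<forall>t. \<forall>A\<in>CL. \<forall>B\<in>CL. TYY t (B o\<^sub>L A) = TXY t B o\<^sub>L TYX t A) \<and>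
     (\<forall>t. \<forall>A\<in>CL. \<forall>B\<in>CL. TYX t (B o\<^sub>L A) = TYX t B o\<^sub>L TYY t A) \<and>
     (\<forall>t. \<forall>A\<in>CL. \<forall>B\<in>CL. TYY t (B o\<^sub>L A) = TYY t B o\<^sub>L TYY t A) \<and>
     \<comment> \<open>coupling\<close>
     (\<forall>A\<in>CL. \<forall>B\<in>CL. mutually_inverse A B \<longleftrightarrow>
                      (\<forall>t. mutually_inverse (TXY t A) (TYX t B)))"

definition tri :: "real \<Rightarrow> real" where "tri l = max (1 - \<bar>l\<bar>) 0"

text \<open>phi^d_{N,a} is the L^1 function whose Fourier transform (convention
  f^(l) = int f(t) e^{-i t.l} dt) is prod_k tri((l_k - N a_k)/N); it is given by
  Fourier inversion.\<close>

definition phi :: "real \<Rightarrow> real^'d \<Rightarrow> real^'d \<Rightarrow> complex" where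
  "phi N a t = (1 / (2 * pi) ^ CARD('d)) *
     (\<integral>l. (\<Prod>k\<in>UNIV. complex_of_real (tri ((l $ k - N * a $ k) / N)))
            * exp (\<i> * complex_of_real (t \<bullet> l)) \<partial>lborel)"

definition supnorm :: "int^'d \<Rightarrow> int" where
  "supnorm k = Max (range (\<lambda>j. \<bar>k $ j\<bar>))"

definition beurling_norm :: "((real^'d \<Rightarrow> complex) \<Rightarrow> 'm::real_normed_vector \<Rightarrow> 'm) \<Rightarrow> 'm \<Rightarrow> ennreal" where
  "beurling_norm act A =
     (\<Sum>\<^sub>\<infinity>k\<in>(UNIV :: (int^'d) set).
        (SUP n\<in>{n. supnorm k \<le> supnorm n}.
           ennreal (norm (act (phi 1 (\<chi> j. real_of_int (n $ j))) A))))"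

definition beurling_class :: "'m set \<Rightarrow> ((real^'d \<Rightarrow> complex) \<Rightarrow> 'm::real_normed_vector \<Rightarrow> 'm) \<Rightarrow> 'm set" where
  "beurling_class M act = {A\<in>M. beurling_norm act A < \<infinity>}"

end

theory Submission
  imports Defs "HOL-Probability.Sinc_Integral" "HOL-Probability.Characteristic_Functions"
    "HOL-Real_Asymp.Real_Asymp"
begin

text \<open>
  The inverse is expanded around a band-limited approximation, in the spirit of Newman's proof of
  Wiener's lemma. Write \<open>A = A' + R\<close>, where \<open>A'\<close> collects the components of \<open>A\<close> of frequency at most
  \<open>N\<close> and the scalar sequence \<open>r\<close> of the norms of the components \<open>R\<^sub>\<nu>\<close> of \<open>R\<close> has a small
  Beurling norm. Then \<open>B = \<Sum>\<^sub>k (-1)\<^sup>k (B' R)\<^sup>k B'\<close> with \<open>B'\<close> the inverse of \<open>A'\<close>, and each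
  term splits into products \<open>B' R\<^sub>\<nu>\<^sub>1 B' \<dots> R\<^sub>\<nu>\<^sub>k B'\<close>. Up to the modulation by the frequency
  \<open>\<nu>\<^sub>1 + \<dots> + \<nu>\<^sub>k\<close> such a product depends smoothly on translation, with difference quotients
  controlled by the product of the norms: the Leibniz rule is submultiplicative, and the
  smoothness of \<open>B'\<close> is inherited from that of \<open>A'\<close> at a small enough scale. Hence its frequency
  components decay polynomially away from \<open>\<nu>\<^sub>1 + \<dots> + \<nu>\<^sub>k\<close>, and the components of \<open>B\<close> are dominated by
  the scalar series \<open>\<Sum>\<^sub>k c\<^sup>k r * \<dots> * r * e\<close> with a polynomially decaying sequence \<open>e\<close>. It converges in the
  scalar Beurling class, which is a convolution algebra.
\<close>

section \<open>Scalar Beurling sequences\<close>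

text \<open>The order in which the constants are chosen carries the proof. Smoothness of
  \<open>A'\<close> costs constants that grow with the cutoff \<open>N\<close>, while the
  convolution series converges only if \<open>r\<close> is small against a bound that must be fixed
  before \<open>N\<close>. Two facts resolve this. The inverse \<open>B'\<close> has norm at most
  \<open>2 * norm B\<close> as soon as the remainder is small, and at a fine enough scale \<delta>
  its smooth norm is at most twice its norm, hence at most \<open>4 * norm B\<close>. The smooth
  norm of a single component is at most a constant times its norm, the same constant for every
  \<delta> up to 1. So \<delta>, which depends on \<open>N\<close>, does not enter the smallness of
  \<open>r\<close>; it enters only \<open>e\<close>, which occurs once in each term and need only
  have finite norm. Smoothness is measured by finite differences in all small steps at once rather
  than by derivatives: decay at distance L from the centre frequency is read off from a step of size
  \<pi>/L. A phase factor in the translation moves the centre to 0; phases of products multiply, so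
  centres add, as in a convolution.\<close>

lemma nn_integral_count_space_SUP_finite:
  fixes f :: "'a::countable \<Rightarrow> ennreal"
  shows "(\<integral>\<^sup>+x. f x \<partial>count_space UNIV) = (SUP F\<in>{F. finite F}. sum f F)"
proof (rule antisym)
  \<comment> \<open>The indicator discards the numbers that are not codes, so finite index types are
    covered along with infinite ones.\<close>
  define g where "g i = f (from_nat i) * indicator (range (to_nat :: 'a \<Rightarrow> nat)) i" for i
  have "(\<integral>\<^sup>+x. f x \<partial>count_space UNIV) = (\<integral>\<^sup>+x. f (from_nat (to_nat x)) \<partial>count_space (UNIV::'a set))"
    by simp
  also have "\<dots> = (\<integral>\<^sup>+i. f (from_nat i) \<partial>count_space (range (to_nat :: 'a \<Rightarrow> nat)))"
    by (rule nn_integral_bij_count_space) (simp add: bij_betw_def)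
  also have "\<dots> = (\<integral>\<^sup>+i. g i \<partial>count_space UNIV)"
    unfolding g_def by (cases "range (to_nat :: 'a \<Rightarrow> nat) = UNIV")
      (simp_all add: nn_integral_count_space_indicator)
  also have "\<dots> = (\<Sum>i. g i)"
    by (rule nn_integral_count_space_nat)
  also have "\<dots> = (SUP n. sum g {..<n})"
    by (rule suminf_eq_SUP)
  also have "\<dots> \<le> (SUP F\<in>{F. finite F}. sum f F)"
  proof (rule SUP_least)
    fix n
    have "sum g {..<n} = sum g ({..<n} \<inter> range (to_nat :: 'a \<Rightarrow> nat))"
      by (rule sum.mono_neutral_right) (auto simp: g_def)
    also have "\<dots> = sum f (from_nat ` ({..<n} \<inter> range (to_nat :: 'a \<Rightarrow> nat)))"
      by (subst sum.reindex) (auto simp: inj_on_def g_def intro!: sum.cong)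
    also have "\<dots> \<le> (SUP F\<in>{F. finite F}. sum f F)"
      by (rule SUP_upper) auto
    finally show "sum g {..<n} \<le> (SUP F\<in>{F. finite F}. sum f F)" .
  qed
  finally show "(\<integral>\<^sup>+x. f x \<partial>count_space UNIV) \<le> (SUP F\<in>{F. finite F}. sum f F)" .
next
  show "(SUP F\<in>{F. finite F}. sum f F) \<le> (\<integral>\<^sup>+x. f x \<partial>count_space UNIV)"
  proof (rule SUP_least)
    fix F :: "'a set" assume "F \<in> {F. finite F}"
    then have "sum f F = (\<integral>\<^sup>+x. f x * indicator F x \<partial>count_space UNIV)"
      by (subst nn_integral_count_space'[where A=F]) (auto intro!: sum.cong)
    also have "\<dots> \<le> (\<integral>\<^sup>+x. f x \<partial>count_space UNIV)"
      by (rule nn_integral_mono) (auto split: split_indicator)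
    finally show "sum f F \<le> (\<integral>\<^sup>+x. f x \<partial>count_space UNIV)" .
  qed
qed

text \<open>The Beurling norm is stated with \<open>infsum\<close>; as an integral over the counting
  measure it inherits Fubini, monotone convergence and additivity without summability
  conditions.\<close>

lemma infsum_ennreal_eq_nn_integral:
  fixes f :: "'a::countable \<Rightarrow> ennreal"
  shows "infsum f UNIV = (\<integral>\<^sup>+x. f x \<partial>count_space UNIV)"
  by (simp add: nonneg_infsum_complete nn_integral_count_space_SUP_finite)

text \<open>The triangle inequality for finite sums passes to the limit. Absolute convergence is not
  asked for: the right-hand side may be infinite.\<close>

lemma norm_has_sum_le_nn_integral:
  fixes g :: "'a::countable \<Rightarrow> 'b::real_normed_vector"
  assumes "(g has_sum x) UNIV"
  shows "ennreal (norm x) \<le> (\<integral>\<^sup>+\<nu>. ennreal (norm (g \<nu>)) \<partial>count_space UNIV)"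
proof -
  have "((\<lambda>F. ennreal (norm (sum g F))) \<longlongrightarrow> ennreal (norm x)) (finite_subsets_at_top UNIV)"
    using assms by (intro tendsto_ennrealI tendsto_norm) (simp add: has_sum_def)
  then show ?thesis
  proof (rule tendsto_upperbound)
    have "ennreal (norm (sum g F)) \<le> (\<integral>\<^sup>+\<nu>. ennreal (norm (g \<nu>)) \<partial>count_space UNIV)" if "finite F" for F
    proof -
      have "ennreal (norm (sum g F)) \<le> ennreal (\<Sum>\<nu>\<in>F. norm (g \<nu>))"
        by (intro ennreal_leI norm_sum)
      also have "\<dots> = (\<Sum>\<nu>\<in>F. ennreal (norm (g \<nu>)))" by simp
      also have "\<dots> \<le> (\<integral>\<^sup>+\<nu>. ennreal (norm (g \<nu>)) \<partial>count_space UNIV)"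
        unfolding nn_integral_count_space_SUP_finite using that by (intro SUP_upper) auto
      finally show ?thesis .
    qed
    then show "\<forall>\<^sub>F F in finite_subsets_at_top UNIV. ennreal (norm (sum g F)) \<le> (\<integral>\<^sup>+\<nu>. ennreal (norm (g \<nu>)) \<partial>count_space UNIV)"
      by (intro eventually_finite_subsets_at_top_weakI) auto
  qed simp
qed

section \<open>The maximum norm on the integer lattice\<close>

lemma supnorm_ge: "\<bar>k $ j\<bar> \<le> supnorm k"
  unfolding supnorm_def by (intro Max_ge) auto

lemma supnorm_le_iff: "supnorm k \<le> m \<longleftrightarrow> (\<forall>j. \<bar>k $ j\<bar> \<le> m)"
  unfolding supnorm_def by (subst Max_le_iff) auto

lemma supnorm_attained: "\<exists>j. supnorm k = \<bar>k $ j\<bar>"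
proof -
  have "supnorm k \<in> range (\<lambda>j. \<bar>k $ j\<bar>)"
    unfolding supnorm_def by (intro Max_in) auto
  then show ?thesis by auto
qed

lemma supnorm_nonneg: "0 \<le> supnorm k"
  using supnorm_attained[of k] by auto

lemma supnorm_triangle: "supnorm (a + b) \<le> supnorm a + supnorm b"
  unfolding supnorm_le_iff
proof
  fix j show "\<bar>(a + b) $ j\<bar> \<le> supnorm a + supnorm b"
    using supnorm_ge[of a j] supnorm_ge[of b j] by simp
qed

lemma finite_supnorm_le: "finite {k :: int^'d::finite. supnorm k \<le> m}"
proof -
  have "{k :: int^'d. supnorm k \<le> m} \<subseteq> vec_lambda ` (PiE UNIV (\<lambda>_. {-m..m}))"
  proof
    fix k :: "int^'d" assume "k \<in> {k. supnorm k \<le> m}"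
    then have "vec_nth k \<in> PiE UNIV (\<lambda>_. {-m..m})"
      by (auto simp: supnorm_le_iff abs_le_iff) (metis minus_le_iff)
    then show "k \<in> vec_lambda ` (PiE UNIV (\<lambda>_. {-m..m}))"
      by (metis image_eqI vec_nth_inverse)
  qed
  then show ?thesis by (rule finite_subset) (auto intro!: finite_PiE)
qed

lemma finite_supnorm_diff_le: "finite {n :: int^'d::finite. supnorm (n - m) \<le> L}"
proof -
  have "{n. supnorm (n - m) \<le> L} = (\<lambda>k. k + m) ` {k. supnorm k \<le> L}"
    by (auto simp: image_iff intro!: exI[where x="_ - m"])
  then show ?thesis using finite_supnorm_le by (metis finite_imageI)
qed

section \<open>Radial majorants and the scalar Beurling norm\<close>

definition tail_sup :: "(int^'d \<Rightarrow> ennreal) \<Rightarrow> int \<Rightarrow> ennreal" where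
  "tail_sup f m = (SUP n\<in>{n. m \<le> supnorm n}. f n)"

text \<open>\<open>tail_sup f (supnorm k)\<close> is the least radially nonincreasing majorant of
  \<open>f\<close>, and this norm is its sum over the lattice. Values in \<open>ennreal\<close>
  allow estimates before finiteness is known.\<close>

definition bnorm :: "(int^'d \<Rightarrow> ennreal) \<Rightarrow> ennreal" where
  "bnorm f = (\<integral>\<^sup>+k. tail_sup f (supnorm k) \<partial>count_space (UNIV :: (int^'d) set))"

lemma beurling_norm_eq_bnorm:
  "beurling_norm act A = bnorm (\<lambda>n. ennreal (norm (act (phi 1 (\<chi> j. real_of_int (n $ j))) A)))"
  unfolding beurling_norm_def bnorm_def tail_sup_def by (rule infsum_ennreal_eq_nn_integral)

lemma tail_sup_upper: "m \<le> supnorm n \<Longrightarrow> f n \<le> tail_sup f m"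
  unfolding tail_sup_def by (intro SUP_upper) auto

lemma tail_sup_antimono: "m \<le> m' \<Longrightarrow> tail_sup f m' \<le> tail_sup f m"
  unfolding tail_sup_def by (intro SUP_subset_mono) auto

lemma bnorm_mono: "(\<And>n. f n \<le> g n) \<Longrightarrow> bnorm f \<le> bnorm g"
  unfolding bnorm_def tail_sup_def by (intro nn_integral_mono SUP_mono) auto

lemma nn_integral_le_bnorm: "(\<integral>\<^sup>+k. f k \<partial>count_space UNIV) \<le> bnorm f"
  unfolding bnorm_def by (intro nn_integral_mono tail_sup_upper) auto

lemma bnorm_cmult: "bnorm (\<lambda>n. c * f n) = c * bnorm f"
proof -
  have "tail_sup (\<lambda>n. c * f n) m = c * tail_sup f m" for m
    unfolding tail_sup_def by (simp add: SUP_mult_left_ennreal)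
  then show ?thesis unfolding bnorm_def by (simp add: nn_integral_cmult)
qed

lemma bnorm_suminf_le:
  fixes f :: "nat \<Rightarrow> int^'d::finite \<Rightarrow> ennreal"
  shows "bnorm (\<lambda>n. \<Sum>k. f k n) \<le> (\<Sum>k. bnorm (f k))"
proof -
  have "tail_sup (\<lambda>n. \<Sum>k. f k n) m \<le> (\<Sum>k. tail_sup (f k) m)" for m
    unfolding tail_sup_def[of "\<lambda>n. \<Sum>k. f k n"]
    by (intro SUP_least suminf_le tail_sup_upper) auto
  then have "bnorm (\<lambda>n. \<Sum>k. f k n) \<le> (\<integral>\<^sup>+m. (\<Sum>k. tail_sup (f k) (supnorm m)) \<partial>count_space (UNIV :: (int^'d) set))"
    unfolding bnorm_def by (intro nn_integral_mono)
  also have "\<dots> = (\<Sum>k. bnorm (f k))"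
    unfolding bnorm_def by (rule nn_integral_suminf) simp
  finally show ?thesis .
qed

text \<open>Rounding down makes every lattice point the half of exactly 2^d points. The price is the
  \<open>+ 1\<close> in \<open>supnorm_half\<close>, attained at negative odd coordinates.\<close>

definition half :: "int^'d \<Rightarrow> int^'d" where "half k = (\<chi> j. k $ j div 2)"

lemma supnorm_half: "2 * supnorm (half k) \<le> supnorm k + 1"
proof -
  obtain j where "supnorm (half k) = \<bar>half k $ j\<bar>" using supnorm_attained by blast
  moreover have "2 * \<bar>half k $ j\<bar> \<le> \<bar>k $ j\<bar> + 1" by (simp add: half_def)
  ultimately show ?thesis using supnorm_ge[of k j] by linarith
qed

text \<open>A lattice point is determined by its half and the parities of its coordinates;
  forgetting the parity vector costs the number of such vectors.\<close>

lemma nn_integral_half_le: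
  fixes F :: "int^'d::finite \<Rightarrow> ennreal"
  shows "(\<integral>\<^sup>+k. F (half k) \<partial>count_space UNIV) \<le> 2 ^ CARD('d) * (\<integral>\<^sup>+k. F k \<partial>count_space UNIV)"
proof -
  define e :: "int^'d \<Rightarrow> (int^'d) \<times> (bool^'d)" where "e k = (half k, \<chi> j. odd (k $ j))" for k
  have "inj e"
  proof (rule injI)
    fix k k' assume eq: "e k = e k'"
    have "k $ j = k' $ j" for j
    proof -
      have "k $ j div 2 = k' $ j div 2" "odd (k $ j) = odd (k' $ j)"
        using eq by (auto simp: e_def half_def vec_eq_iff)
      then show ?thesis by presburger
    qed
    then show "k = k'" by (simp add: vec_eq_iff)
  qed
  have "(\<integral>\<^sup>+k. F (half k) \<partial>count_space UNIV) = (\<integral>\<^sup>+k. F (fst (e k)) \<partial>count_space UNIV)"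
    by (simp add: e_def)
  also have "\<dots> = (\<integral>\<^sup>+p. F (fst p) \<partial>count_space (range e))"
    by (rule nn_integral_bij_count_space) (use \<open>inj e\<close> in \<open>simp add: bij_betw_def\<close>)
  also have "\<dots> \<le> (\<integral>\<^sup>+p. F (fst p) \<partial>count_space (UNIV :: ((int^'d) \<times> (bool^'d)) set))"
  proof (cases "range e = UNIV")
    case False
    then show ?thesis
      by (simp add: nn_integral_count_space_indicator)
        (intro nn_integral_mono, auto split: split_indicator)
  qed simp
  also have "\<dots> = (\<integral>\<^sup>+k. (\<integral>\<^sup>+q. F k \<partial>count_space (UNIV :: (bool^'d) set)) \<partial>count_space UNIV)"
    by (subst nn_integral_fst_count_space[symmetric]) simp
  also have "\<dots> = (\<integral>\<^sup>+k. 2 ^ CARD('d) * F k \<partial>count_space UNIV)"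
    by (simp add: nn_integral_count_space_finite mult.commute)
  also have "\<dots> = 2 ^ CARD('d) * (\<integral>\<^sup>+k. F k \<partial>count_space UNIV)"
    by (simp add: nn_integral_cmult)
  finally show ?thesis .
qed

definition lconv :: "(int^'d \<Rightarrow> ennreal) \<Rightarrow> (int^'d \<Rightarrow> ennreal) \<Rightarrow> int^'d \<Rightarrow> ennreal" where
  "lconv r e n = (\<integral>\<^sup>+\<nu>. r \<nu> * e (n - \<nu>) \<partial>count_space UNIV)"

text \<open>Of the two summands \<nu> and n - \<nu> of a point with norm at least that of
  \<open>k\<close>, one is at least as large as \<open>half k\<close>. The corresponding factor is
  replaced by its tail supremum there, and the other one is summed.\<close>

lemma tail_sup_lconv:
  fixes r e :: "int^'d::finite \<Rightarrow> ennreal"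
  shows "tail_sup (lconv r e) (supnorm k)
    \<le> bnorm e * tail_sup r (supnorm (half k)) + bnorm r * tail_sup e (supnorm (half k))"
  unfolding tail_sup_def[of "lconv r e"]
proof (rule SUP_least)
  fix n :: "int^'d" assume "n \<in> {n. supnorm k \<le> supnorm n}"
  then have n: "supnorm k \<le> supnorm n" by simp
  let ?m = "supnorm (half k)"
  have "r \<nu> * e (n - \<nu>) \<le> tail_sup r ?m * e (n - \<nu>) + r \<nu> * tail_sup e ?m" for \<nu>
  proof (cases "?m \<le> supnorm \<nu>")
    case True
    then have "r \<nu> \<le> tail_sup r ?m" by (rule tail_sup_upper)
    then show ?thesis by (meson add_increasing2 mult_right_mono zero_le)
  next
    case False
    \<comment> \<open>Integrality matters: the norm of \<nu> is at most \<open>?m - 1\<close>, which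
      makes up for the \<open>+ 1\<close> lost in \<open>supnorm_half\<close>.\<close>
    then have "?m \<le> supnorm (n - \<nu>)"
      using n supnorm_half[of k] supnorm_triangle[of \<nu> "n - \<nu>"] by simp
    then have "e (n - \<nu>) \<le> tail_sup e ?m" by (rule tail_sup_upper)
    then show ?thesis by (meson add_increasing mult_left_mono zero_le)
  qed
  then have "lconv r e n \<le> (\<integral>\<^sup>+\<nu>. tail_sup r ?m * e (n - \<nu>) + r \<nu> * tail_sup e ?m \<partial>count_space UNIV)"
    unfolding lconv_def by (intro nn_integral_mono)
  also have "\<dots> = tail_sup r ?m * (\<integral>\<^sup>+\<nu>. e (n - \<nu>) \<partial>count_space UNIV)
      + (\<integral>\<^sup>+\<nu>. r \<nu> \<partial>count_space UNIV) * tail_sup e ?m"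
    by (simp add: nn_integral_add nn_integral_cmult nn_integral_multc)
  also have "(\<integral>\<^sup>+\<nu>. e (n - \<nu>) \<partial>count_space UNIV) = (\<integral>\<^sup>+\<nu>. e \<nu> \<partial>count_space UNIV)"
    by (rule nn_integral_bij_count_space) (rule bij_betwI[where g="\<lambda>\<nu>. n - \<nu>"], auto)
  also have "tail_sup r ?m * (\<integral>\<^sup>+\<nu>. e \<nu> \<partial>count_space UNIV)
      + (\<integral>\<^sup>+\<nu>. r \<nu> \<partial>count_space UNIV) * tail_sup e ?m
    \<le> tail_sup r ?m * bnorm e + bnorm r * tail_sup e ?m"
    by (intro add_mono mult_left_mono mult_right_mono nn_integral_le_bnorm) auto
  finally show "lconv r e n \<le> bnorm e * tail_sup r ?m + bnorm r * tail_sup e ?m"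
    by (simp add: mult.commute)
qed

text \<open>This is the algebra property: each of the two terms of \<open>tail_sup_lconv\<close>
  loses 2^d through the halving of the argument.\<close>

lemma bnorm_lconv:
  fixes r e :: "int^'d::finite \<Rightarrow> ennreal"
  shows "bnorm (lconv r e) \<le> 2 ^ Suc CARD('d) * bnorm r * bnorm e"
proof -
  have "bnorm (lconv r e) \<le> (\<integral>\<^sup>+k. bnorm e * tail_sup r (supnorm (half k))
      + bnorm r * tail_sup e (supnorm (half k)) \<partial>count_space (UNIV :: (int^'d) set))"
    unfolding bnorm_def[of "lconv r e"] by (intro nn_integral_mono tail_sup_lconv)
  also have "\<dots> = bnorm e * (\<integral>\<^sup>+k. tail_sup r (supnorm (half k)) \<partial>count_space (UNIV :: (int^'d) set))
      + bnorm r * (\<integral>\<^sup>+k. tail_sup e (supnorm (half k)) \<partial>count_space (UNIV :: (int^'d) set))"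
    by (simp add: nn_integral_add nn_integral_cmult)
  also have "\<dots> \<le> bnorm e * (2 ^ CARD('d) * bnorm r) + bnorm r * (2 ^ CARD('d) * bnorm e)"
    unfolding bnorm_def[of r] bnorm_def[of e]
    by (intro add_mono mult_left_mono nn_integral_half_le[where F="\<lambda>k. tail_sup _ (supnorm k)"]) auto
  also have "\<dots> = 2 ^ Suc CARD('d) * bnorm r * bnorm e"
    by (simp add: mult_2 distrib_right distrib_left mult_ac)
  finally show ?thesis .
qed

lemma tail_sup_truncate_le:
  "tail_sup (\<lambda>n. if supnorm n \<le> N then 0 else f n) m \<le> tail_sup f (max m (N + 1))"
  unfolding tail_sup_def[of "\<lambda>n. if supnorm n \<le> N then 0 else f n"]
  by (rule SUP_least) (auto intro!: tail_sup_upper)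

text \<open>Otherwise a positive constant would lie below every summand of \<open>bnorm f\<close>,
  and the lattice is infinite.\<close>

lemma tail_sup_tendsto_zero:
  fixes f :: "int^'d::finite \<Rightarrow> ennreal"
  assumes fin: "bnorm f < \<infinity>"
  shows "(INF N::nat. tail_sup f (int N)) = 0"
proof (rule ccontr)
  assume "(INF N::nat. tail_sup f (int N)) \<noteq> 0"
  then obtain c where c: "c = (INF N::nat. tail_sup f (int N))" "c > 0"
    by (simp add: zero_less_iff_neq_zero)
  have "c \<le> tail_sup f (supnorm k)" for k :: "int^'d"
    unfolding c(1) by (rule INF_lower2[of "nat (supnorm k)"]) (auto simp: supnorm_nonneg)
  then have "(\<integral>\<^sup>+k. c \<partial>count_space (UNIV :: (int^'d) set)) \<le> bnorm f"
    unfolding bnorm_def by (intro nn_integral_mono)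
  moreover have "infinite (UNIV :: (int^'d) set)"
  proof
    assume "finite (UNIV :: (int^'d) set)"
    then have "finite (range (\<lambda>x::int. (\<chi> j. x) :: int^'d))" by (rule finite_subset[rotated]) auto
    moreover have "inj (\<lambda>x::int. (\<chi> j. x) :: int^'d)" by (auto simp: inj_def vec_eq_iff)
    ultimately show False using finite_imageD infinite_UNIV_int by blast
  qed
  then have "(\<integral>\<^sup>+k. c \<partial>count_space (UNIV :: (int^'d) set)) = \<infinity>"
    using c(2) by (simp add: ennreal_mult_top)
  ultimately show False using fin by (simp add: top_unique)
qed

text \<open>Removing the points up to N lowers the radial majorant everywhere, inside the ball to
  the constant \<open>tail_sup f (N + 1)\<close>. The new majorants therefore decrease to 0 at every
  point, and monotone convergence from above applies because the norm is finite.\<close>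

lemma bnorm_truncate_small:
  fixes f :: "int^'d::finite \<Rightarrow> ennreal"
  assumes fin: "bnorm f < \<infinity>" and eps: "0 < \<epsilon>"
  shows "\<exists>N::nat. bnorm (\<lambda>n. if supnorm n \<le> int N then 0 else f n) < \<epsilon>"
proof -
  define F where "F N k = tail_sup f (max (supnorm k) (int N + 1))" for N :: nat and k :: "int^'d"
  have F0: "(\<integral>\<^sup>+k. F 0 k \<partial>count_space UNIV) < \<infinity>"
  proof (rule le_less_trans[OF _ fin])
    show "(\<integral>\<^sup>+k. F 0 k \<partial>count_space UNIV) \<le> bnorm f"
      unfolding bnorm_def F_def by (intro nn_integral_mono tail_sup_antimono) auto
  qed
  have "decseq F"
    by (auto simp: F_def le_fun_def monotone_on_def intro!: tail_sup_antimono)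
  then have "(\<integral>\<^sup>+k. (INF N. F N k) \<partial>count_space UNIV) = (INF N. \<integral>\<^sup>+k. F N k \<partial>count_space UNIV)"
    by (rule nn_integral_monotone_convergence_INF_decseq) (use F0 in auto)
  moreover have "(INF N. F N k) = 0" for k
  proof -
    have "(INF N. F N k) \<le> (INF N::nat. tail_sup f (int N))"
      by (rule INF_mono, rule_tac x=m in bexI) (auto simp: F_def intro!: tail_sup_antimono)
    then show ?thesis using tail_sup_tendsto_zero[OF fin] by simp
  qed
  ultimately have "(INF N. \<integral>\<^sup>+k. F N k \<partial>count_space UNIV) < \<epsilon>" using eps by simp
  then obtain N where "(\<integral>\<^sup>+k. F N k \<partial>count_space UNIV) < \<epsilon>" by (auto simp: INF_less_iff)
  moreover have "bnorm (\<lambda>n. if supnorm n \<le> int N then 0 else f n) \<le> (\<integral>\<^sup>+k. F N k \<partial>count_space UNIV)"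
    unfolding bnorm_def F_def by (intro nn_integral_mono tail_sup_truncate_le)
  ultimately show ?thesis by (meson le_less_trans)
qed

section \<open>A polynomially decaying sequence of finite Beurling norm\<close>

lemma inverse_squares_int_sum_bounded: "\<exists>C. \<forall>m::nat. (\<Sum>a=-int m..int m. 1 / (1 + real_of_int \<bar>a\<bar>) ^ 2) \<le> C"
proof -
  define S where "S = (\<Sum>n. 1 / real (Suc n) ^ 2)"
  have summ: "summable (\<lambda>n. 1 / real (Suc n) ^ 2)"
    using inverse_power_summable[of 2, where 'a=real]
    by (subst summable_Suc_iff) (simp add: inverse_eq_divide power_one_over)
  have *: "(\<Sum>n\<le>m. 1 / real (Suc n) ^ 2) \<le> S" for m
    unfolding S_def by (rule sum_le_suminf[OF summ]) auto
  have "(\<Sum>a=-int m..int m. 1 / (1 + real_of_int \<bar>a\<bar>) ^ 2) \<le> 2 * S" for m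
  proof -
    have "(\<Sum>a=-int m..int m. 1 / (1 + real_of_int \<bar>a\<bar>) ^ 2)
      \<le> (\<Sum>a\<in>int ` {..m} \<union> (\<lambda>n. - int n) ` {..m}. 1 / (1 + real_of_int \<bar>a\<bar>) ^ 2)"
    proof (rule sum_mono2)
      show "{- int m..int m} \<subseteq> int ` {..m} \<union> (\<lambda>n. - int n) ` {..m}"
      proof
        fix a assume "a \<in> {- int m..int m}"
        then have "(a = int (nat a) \<and> nat a \<le> m) \<or> (a = - int (nat (-a)) \<and> nat (-a) \<le> m)" by auto
        then show "a \<in> int ` {..m} \<union> (\<lambda>n. - int n) ` {..m}" by blast
      qed
    qed auto
    also have "\<dots> \<le> (\<Sum>a\<in>int ` {..m}. 1 / (1 + real_of_int \<bar>a\<bar>) ^ 2)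
        + (\<Sum>a\<in>(\<lambda>n. - int n) ` {..m}. 1 / (1 + real_of_int \<bar>a\<bar>) ^ 2)"
      by (subst sum_Un) (auto intro!: sum_nonneg)
    also have "\<dots> = 2 * (\<Sum>n\<le>m. 1 / real (Suc n) ^ 2)"
      by (subst sum.reindex, force simp: inj_on_def)+ (simp add: add.commute)
    also have "\<dots> \<le> 2 * S" using * by simp
    finally show ?thesis .
  qed
  then show ?thesis by blast
qed

text \<open>The exponent is chosen so that \<open>(1 + |k|\<^sub>\<infinity>)\<^bsup>2d\<^esup>\<close> dominates a product of squares, one per coordinate.\<close>

lemma bnorm_polynomial_decay:
  "bnorm (\<lambda>k::int^'d::finite. ennreal (1 / (1 + real_of_int (supnorm k)) ^ (2 * CARD('d)))) < \<infinity>"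
proof -
  let ?E = "\<lambda>k::int^'d. ennreal (1 / (1 + real_of_int (supnorm k)) ^ (2 * CARD('d)))"
  obtain C where C: "\<And>m::nat. (\<Sum>a=-int m..int m. 1 / (1 + real_of_int \<bar>a\<bar>) ^ 2) \<le> C"
    using inverse_squares_int_sum_bounded by blast
  have "tail_sup ?E (supnorm k) \<le> ?E k" for k
    unfolding tail_sup_def
    by (rule SUP_least) (auto intro!: ennreal_leI divide_left_mono power_mono mult_pos_pos
          simp: supnorm_nonneg add_pos_nonneg)
  then have "bnorm ?E \<le> (\<integral>\<^sup>+k. ?E k \<partial>count_space UNIV)"
    unfolding bnorm_def by (intro nn_integral_mono)
  also have "\<dots> \<le> ennreal (C ^ CARD('d))"
    unfolding nn_integral_count_space_SUP_finite
  proof (rule SUP_least)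
    fix F :: "(int^'d) set" assume "F \<in> {F. finite F}"
    then have F: "finite F" by simp
    define m where "m = nat (Max (insert 0 (supnorm ` F)))"
    have m: "supnorm k \<le> int m" if "k \<in> F" for k
    proof -
      have "supnorm k \<le> Max (insert 0 (supnorm ` F))" using that F by (intro Max_ge) auto
      then show ?thesis unfolding m_def by simp
    qed
    have "(\<Sum>k\<in>F. 1 / (1 + real_of_int (supnorm k)) ^ (2 * CARD('d)))
      \<le> (\<Sum>k\<in>F. \<Prod>j\<in>UNIV. 1 / (1 + real_of_int \<bar>k $ j\<bar>) ^ 2)"
    proof (rule sum_mono)
      fix k :: "int^'d"
      have "1 / (1 + real_of_int (supnorm k)) ^ (2 * CARD('d)) = (\<Prod>j\<in>(UNIV::'d set). 1 / (1 + real_of_int (supnorm k)) ^ 2)"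
        by (simp add: power_mult power_divide)
      also have "\<dots> \<le> (\<Prod>j\<in>UNIV. 1 / (1 + real_of_int \<bar>k $ j\<bar>) ^ 2)"
        using supnorm_ge[of k]
        by (intro prod_mono conjI divide_left_mono power_mono mult_pos_pos zero_less_power)
          (auto simp: supnorm_nonneg add_pos_nonneg simp flip: of_int_abs)
      finally show "1 / (1 + real_of_int (supnorm k)) ^ (2 * CARD('d)) \<le> (\<Prod>j\<in>UNIV. 1 / (1 + real_of_int \<bar>k $ j\<bar>) ^ 2)" .
    qed
    also have "\<dots> = (\<Sum>g\<in>vec_nth ` F. \<Prod>j\<in>UNIV. 1 / (1 + real_of_int \<bar>g j\<bar>) ^ 2)"
      by (subst sum.reindex) (auto simp: inj_on_def vec_eq_iff)
    also have "\<dots> \<le> (\<Sum>g\<in>PiE UNIV (\<lambda>_::'d. {-int m..int m}). \<Prod>j\<in>UNIV. 1 / (1 + real_of_int \<bar>g j\<bar>) ^ 2)"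
    proof (rule sum_mono2)
      show "vec_nth ` F \<subseteq> PiE UNIV (\<lambda>_::'d. {-int m..int m})"
      proof clarify
        fix k assume "k \<in> F"
        then have "\<bar>k $ j\<bar> \<le> int m" for j using m supnorm_ge order_trans by blast
        then show "vec_nth k \<in> PiE UNIV (\<lambda>_::'d. {-int m..int m})" by (auto simp: abs_le_iff) (metis minus_le_iff)
      qed
    qed (auto intro!: finite_PiE prod_nonneg)
    also have "\<dots> = (\<Prod>j\<in>(UNIV::'d set). \<Sum>a=-int m..int m. 1 / (1 + real_of_int \<bar>a\<bar>) ^ 2)"
      by (rule prod_sum_PiE[symmetric]) auto
    also have "\<dots> \<le> C ^ CARD('d)"
      using C[of m] by (simp add: power_mono sum_nonneg)
    finally show "sum ?E F \<le> ennreal (C ^ CARD('d))"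
      by (subst sum_ennreal) (auto intro!: ennreal_leI simp: supnorm_nonneg)
  qed
  finally show ?thesis by (auto simp: less_top[symmetric] top_unique)
qed

section \<open>The Fejer kernel on the line\<close>

abbreviation niexp :: "real \<Rightarrow> complex" where
  "niexp \<equiv> (\<lambda>x. exp (- (\<i> * complex_of_real x)))"

text \<open>The inverse Fourier transform of \<open>tri\<close>, which is the one-dimensional factor
  of \<open>phi 1 0\<close>; the value at 0 is the limit there.\<close>

definition fejer :: "real \<Rightarrow> real" where
  "fejer t = (if t = 0 then 1 / (2 * pi) else (1 - cos t) / (pi * t\<^sup>2))"

lemma fejer_minus [simp]: "fejer (- t) = fejer t"
  by (simp add: fejer_def)

lemma fejer_nonneg: "0 \<le> fejer t"
  by (simp add: fejer_def)

lemma fejer_measurable [measurable]: "fejer \<in> borel_measurable borel"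
  unfolding fejer_def by measurable

lemma one_minus_cos_le: "1 - cos (t::real) \<le> t\<^sup>2 / 2"
proof -
  have "1 - cos t = 2 * (sin (t / 2))\<^sup>2"
    using cos_double_sin[of "t/2"] by simp
  also have "\<dots> \<le> 2 * (t / 2)\<^sup>2"
    using abs_sin_x_le_abs_x[of "t/2"] by (intro mult_left_mono abs_le_square_iff[THEN iffD1]) auto
  finally show ?thesis by (simp add: power2_eq_square)
qed

text \<open>In (1 - cos t)(1 + t^2) the first summand is at most t^2 / 2 and the second at most 2
  t^2; together they stay below \<pi> t^2.\<close>

lemma fejer_le: "fejer t \<le> 1 / (1 + t\<^sup>2)"
proof (cases "t = 0")
  case True
  then show ?thesis using pi_ge_two by (simp add: fejer_def)
next
  case False
  have "(1 - cos t) * (1 + t\<^sup>2) = (1 - cos t) + (1 - cos t) * t\<^sup>2" by (simp add: algebra_simps)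
  also have "\<dots> \<le> t\<^sup>2 / 2 + 2 * t\<^sup>2"
    using one_minus_cos_le[of t] cos_ge_minus_one[of t]
    by (intro add_mono mult_right_mono) (auto simp del: cos_ge_minus_one)
  also have "\<dots> \<le> 3 * t\<^sup>2" by simp
  also have "\<dots> \<le> pi * t\<^sup>2"
    using pi_gt3 by (intro mult_right_mono) auto
  finally show ?thesis using False by (simp add: fejer_def divide_simps add_pos_nonneg mult_ac)
qed

lemma integrable_Cauchy_density: "integrable lborel (\<lambda>t::real. 1 / (1 + t\<^sup>2))"
  using integrable_inverse_1_plus_square by (simp add: set_integrable_def inverse_eq_divide)

lemma fejer_integrable: "integrable lborel fejer"
  by (rule Bochner_Integration.integrable_bound[OF integrable_Cauchy_density])
    (use fejer_le fejer_nonneg in \<open>auto intro!: AE_I2\<close>)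

lemma tri_nonneg: "0 \<le> tri l" by (simp add: tri_def)

lemma tri_measurable [measurable]: "tri \<in> borel_measurable borel"
  unfolding tri_def by measurable

lemma tri_outside: "1 \<le> \<bar>l\<bar> \<Longrightarrow> tri l = 0"
  by (simp add: tri_def)

lemma tri_le_1: "tri l \<le> 1"
  by (simp add: tri_def)

lemma tri_integrable: "integrable lborel tri"
proof (rule Bochner_Integration.integrable_bound)
  show "integrable lborel (\<lambda>x::real. indicator {-1..1} x :: real)"
    by simp
  show "AE x in lborel. norm (tri x) \<le> norm (indicator {-1..1} x :: real)"
    by (auto simp: tri_def split: split_indicator)
qed simp

lemma tri_exp_integrable: "integrable lborel (\<lambda>l. complex_of_real (tri l) * iexp (t * l))"
  by (rule Bochner_Integration.integrable_bound[OF tri_integrable])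
    (auto simp: norm_mult)

lemma tri_cos_has_integral:
  assumes "t \<noteq> 0"
  shows "((\<lambda>l. tri l * cos (t * l)) has_integral 2 * pi * fejer t) UNIV"
proof -
  have r: "((\<lambda>l. (1 - l) * cos (t * l)) has_integral
      ((1 - 1) * sin (t * 1) / t - cos (t * 1) / t\<^sup>2) - ((1 - 0) * sin (t * 0) / t - cos (t * 0) / t\<^sup>2)) {0..1}"
    by (rule fundamental_theorem_of_calculus)
      (use assms in \<open>auto intro!: derivative_eq_intros simp: has_real_derivative_iff_has_vector_derivative[symmetric] field_simps power2_eq_square\<close>)
  have l: "((\<lambda>l. (1 + l) * cos (t * l)) has_integral
      ((1 + 0) * sin (t * 0) / t + cos (t * 0) / t\<^sup>2) - ((1 + (-1)) * sin (t * (-1)) / t + cos (t * (-1)) / t\<^sup>2)) {-1..0}"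
    by (rule fundamental_theorem_of_calculus)
      (use assms in \<open>auto intro!: derivative_eq_intros simp: has_real_derivative_iff_has_vector_derivative[symmetric] field_simps power2_eq_square\<close>)
  have r': "((\<lambda>l. tri l * cos (t * l)) has_integral (1 - cos t) / t\<^sup>2) {0..1}"
    by (rule has_integral_eq[OF _ r[simplified, folded diff_divide_distrib, THEN has_integral_eq_rhs]])
      (auto simp: tri_def field_simps)
  have l': "((\<lambda>l. tri l * cos (t * l)) has_integral (1 - cos t) / t\<^sup>2) {-1..0}"
    by (rule has_integral_eq[OF _ l[THEN has_integral_eq_rhs]])
      (auto simp: tri_def diff_divide_distrib)
  have "((\<lambda>l. tri l * cos (t * l)) has_integral (1 - cos t) / t\<^sup>2 + (1 - cos t) / t\<^sup>2) {-1..1}"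
    by (rule has_integral_combine[OF _ _ l' r']) auto
  then have "((\<lambda>l. tri l * cos (t * l)) has_integral (1 - cos t) / t\<^sup>2 + (1 - cos t) / t\<^sup>2) UNIV"
    by (rule has_integral_on_superset) (auto simp: tri_outside)
  then show ?thesis using assms by (simp add: fejer_def)
qed

lemma integral_odd_eq_0:
  fixes f :: "real \<Rightarrow> real"
  assumes "\<And>x. f (- x) = - f x"
  shows "(LBINT x. f x) = 0"
  using lborel_integral_real_affine[of "-1" f 0] assms by simp

lemma fourier_even:
  fixes f :: "real \<Rightarrow> real"
  assumes "integrable lborel f" "\<And>x. f (- x) = f x"
  shows "(LBINT x. complex_of_real (f x) * iexp (t * x))
    = complex_of_real (LBINT x. f x * cos (t * x))"
proof -
  have [measurable]: "f \<in> borel_measurable borel" using assms(1) by auto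
  have c: "integrable lborel (\<lambda>x. f x * cos (t * x))"
    by (rule Bochner_Integration.integrable_bound[OF assms(1)]) (auto simp: abs_mult mult_left_le)
  have s: "integrable lborel (\<lambda>x. f x * sin (t * x))"
    by (rule Bochner_Integration.integrable_bound[OF assms(1)]) (auto simp: abs_mult mult_left_le)
  have "(LBINT x. complex_of_real (f x) * iexp (t * x))
    = (LBINT x. complex_of_real (f x * cos (t * x)) + \<i> * complex_of_real (f x * sin (t * x)))"
    by (intro Bochner_Integration.integral_cong refl, simp only: cis_conv_exp[symmetric])
      (simp add: complex_eq_iff)
  also have "\<dots> = complex_of_real (LBINT x. f x * cos (t * x)) + \<i> * complex_of_real (LBINT x. f x * sin (t * x))"
    using c s by (subst Bochner_Integration.integral_add) (auto intro!: integrable_mult_right integrable_of_real simp del: of_real_mult)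
  also have "(LBINT x. f x * sin (t * x)) = 0"
    by (rule integral_odd_eq_0) (simp add: assms(2))
  finally show ?thesis by simp
qed

lemma inverse_fourier_tri:
  "(LBINT l. complex_of_real (tri l) * iexp (t * l)) = 2 * pi * fejer t"
proof -
  have "(LBINT l. tri l * cos (t * l)) = 2 * pi * fejer t" if "t \<noteq> 0" for t
  proof -
    have "integrable lborel (\<lambda>l. tri l * cos (t * l))"
      by (rule Bochner_Integration.integrable_bound[OF tri_integrable]) (auto simp: abs_mult mult_left_le)
    then show ?thesis
      using has_integral_integral_lborel tri_cos_has_integral[OF that] has_integral_unique by blast
  qed
  \<comment> \<open>The case t = 0 stands apart because the antiderivatives used for the other
    values divide by t.\<close>
  moreover have "(LBINT l. tri l) = 1"
  proof -
    have "((\<lambda>l. 1 - l) has_integral (1 - 1\<^sup>2 / 2) - (0 - 0\<^sup>2 / (2::real))) {0..1}"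
      by (rule fundamental_theorem_of_calculus[where f="\<lambda>l. l - l\<^sup>2 / 2"])
        (auto intro!: derivative_eq_intros simp: has_real_derivative_iff_has_vector_derivative[symmetric])
    then have "((\<lambda>l. 1 - l) has_integral (1/2::real)) {0..1}" by simp
    then have r: "(tri has_integral 1/2) {0..1}"
      by (rule has_integral_eq[rotated]) (auto simp: tri_def)
    have "((\<lambda>l. 1 + l) has_integral (0 + 0\<^sup>2 / 2) - ((-1) + (-1)\<^sup>2 / (2::real))) {-1..0}"
      by (rule fundamental_theorem_of_calculus[where f="\<lambda>l. l + l\<^sup>2 / 2"])
        (auto intro!: derivative_eq_intros simp: has_real_derivative_iff_has_vector_derivative[symmetric])
    then have "((\<lambda>l. 1 + l) has_integral (1/2::real)) {-1..0}" by simp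
    then have l: "(tri has_integral 1/2) {-1..0}"
      by (rule has_integral_eq[rotated]) (auto simp: tri_def)
    have "(tri has_integral 1/2 + 1/2) {-1..1}"
      by (rule has_integral_combine[OF _ _ l r]) auto
    then have "(tri has_integral 1/2 + 1/2) UNIV"
      by (rule has_integral_on_superset) (auto simp: tri_outside)
    then have "(LBINT l. tri l) = 1/2 + 1/2"
      by (rule has_integral_unique[OF has_integral_integral_lborel[OF tri_integrable]])
    then show ?thesis by simp
  qed
  ultimately have "(LBINT l. tri l * cos (t * l)) = 2 * pi * fejer t"
    by (cases "t = 0") (simp_all add: fejer_def)
  then show ?thesis
    by (subst fourier_even[OF tri_integrable]) (auto simp: tri_def)
qed

lemma integral_tri: "(LBINT l. tri l) = 1"
  using inverse_fourier_tri[of 0] by (simp add: fejer_def flip: of_real_eq_iff)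

text \<open>Integration by parts reduces the integral to that of sin t / t: \<open>?F\<close> is an
  antiderivative with limit 0 at 0 and limit \<pi>/2 at infinity, the Dirichlet integral.\<close>

lemma one_minus_cos_over_square_half_line:
  "set_integrable lborel {0<..} (\<lambda>t::real. (1 - cos t) / t\<^sup>2)"
  "(LBINT t:{0<..}. (1 - cos t) / t\<^sup>2) = pi / 2"
proof -
  let ?F = "\<lambda>t::real. Si t - (1 - cos t) / t"
  have F: "DERIV ?F x :> (1 - cos x) / x\<^sup>2" if "0 < x" for x
    using that by (auto intro!: derivative_eq_intros DERIV_Si simp: field_simps power2_eq_square)
  have lim0: "(?F \<longlongrightarrow> 0) (at_right 0)"
  proof -
    have "((\<lambda>t::real. (1 - cos t) / t) \<longlongrightarrow> 0) (at_right 0)" by real_asymp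
    moreover have "(Si \<longlongrightarrow> Si 0) (at_right 0)"
      using isCont_Si[of 0] by (simp add: isCont_def filterlim_at_split)
    moreover have "Si 0 = 0" using Si_neg[of 0] by simp
    ultimately show ?thesis using tendsto_diff by fastforce
  qed
  have liminf: "(?F \<longlongrightarrow> pi / 2) at_top"
  proof -
    have "((\<lambda>t::real. (1 - cos t) / t) \<longlongrightarrow> 0) at_top" by real_asymp
    from tendsto_diff[OF Si_at_top this] show ?thesis by simp
  qed
  have *: "set_integrable lborel (einterval 0 \<infinity>) (\<lambda>t. (1 - cos t) / t\<^sup>2)"
    "(LBINT t=0..\<infinity>. (1 - cos t) / t\<^sup>2) = pi / 2 - 0"
    by (rule interval_integral_FTC_nonneg[where F="?F"];
      use F lim0 liminf in \<open>auto simp: zero_ereal_def ereal_tendsto_simps intro!: continuous_intros\<close>)+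
  show "set_integrable lborel {0<..} (\<lambda>t::real. (1 - cos t) / t\<^sup>2)"
    using *(1) by (simp add: zero_ereal_def)
  show "(LBINT t:{0<..}. (1 - cos t) / t\<^sup>2) = pi / 2"
    using *(2) by (simp add: zero_ereal_def interval_lebesgue_integral_def)
qed

lemma integral_fejer: "(LBINT t. fejer t) = 1"
proof -
  have i: "integrable lborel (\<lambda>t. indicator {0<..} t * fejer t)"
    by (rule Bochner_Integration.integrable_bound[OF fejer_integrable]) (auto split: split_indicator)
  have half: "(LBINT t. indicator {0<..} t * fejer t) = 1 / 2"
  proof -
    have "(LBINT t. indicator {0<..} t * fejer t) = (LBINT t. indicator {0<..} t *\<^sub>R ((1 - cos t) / t\<^sup>2) / pi)"
      by (intro Bochner_Integration.integral_cong) (auto simp: fejer_def split: split_indicator)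
    also have "\<dots> = 1 / 2"
      using one_minus_cos_over_square_half_line(2)
      unfolding integral_divide_zero set_lebesgue_integral_def by simp
    finally show ?thesis .
  qed
  have i': "integrable lborel (\<lambda>t. indicator {0<..} (- t) * fejer t)"
    by (rule Bochner_Integration.integrable_bound[OF fejer_integrable]) (auto split: split_indicator)
  have half': "(LBINT t. indicator {0<..} (- t) * fejer t) = 1 / 2"
    using lborel_integral_real_affine[of "-1" "\<lambda>t. indicator {0<..} t * fejer t" 0] half by simp
  have "(LBINT t. fejer t) = (LBINT t. indicator {0<..} t * fejer t + indicator {0<..} (- t) * fejer t)"
    using AE_lborel_singleton[of 0] by (intro integral_cong_AE) (auto split: split_indicator)
  also have "\<dots> = 1" by (subst Bochner_Integration.integral_add[OF i i']) (simp add: half half')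
  finally show ?thesis .
qed

lemma one_minus_cos_scaled:
  "integrable lborel (\<lambda>t. (1 - cos (a * t)) / (pi * t\<^sup>2))"
  "(LBINT t. (1 - cos (a * t)) / (pi * t\<^sup>2)) = \<bar>a\<bar>"
proof -
  have *: "a\<^sup>2 * fejer (0 + a * t) = (1 - cos (a * t)) / (pi * t\<^sup>2)" if "t \<noteq> 0" for t
    using that by (cases "a = 0") (auto simp: fejer_def power_mult_distrib)
  have ae: "AE t in lborel. a\<^sup>2 * fejer (0 + a * t) = (1 - cos (a * t)) / (pi * t\<^sup>2)"
    using AE_lborel_singleton[of 0] by eventually_elim (use * in auto)
  show "integrable lborel (\<lambda>t. (1 - cos (a * t)) / (pi * t\<^sup>2))"
  proof (cases "a = 0")
    case False
    then have "integrable lborel (\<lambda>t. a\<^sup>2 * fejer (0 + a * t))"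
      by (intro integrable_mult_right lborel_integrable_real_affine fejer_integrable)
    then show ?thesis using ae by (subst integrable_cong_AE[symmetric]) auto
  qed simp
  have "(LBINT t. (1 - cos (a * t)) / (pi * t\<^sup>2)) = (LBINT t. a\<^sup>2 * fejer (0 + a * t))"
    using ae by (intro integral_cong_AE) auto
  also have "\<dots> = \<bar>a\<bar>"
    using lborel_integral_real_affine[of a fejer 0] integral_fejer
    by (cases "a = 0") (auto simp: field_simps power2_eq_square abs_if split: if_splits)
  finally show "(LBINT t. (1 - cos (a * t)) / (pi * t\<^sup>2)) = \<bar>a\<bar>" .
qed

text \<open>The product formula for cosines reduces the transform to second differences of
  \<open>\<lambda>a. \<integral> (1 - cos (a t)) / (\<pi> t\<^sup>2) = |a|\<close>.\<close>

lemma integral_fejer_cos: "(LBINT t. fejer t * cos (l * t)) = tri l"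
proof -
  let ?g = "\<lambda>a t. (1 - cos (a * t)) / (pi * t\<^sup>2)"
  have *: "fejer t * cos (l * t) = (1 / 2) * ?g (1 + l) t + (1 / 2) * ?g (1 - l) t - ?g l t" if "t \<noteq> 0" for t
    using that by (simp add: fejer_def ring_distribs cos_add cos_diff diff_divide_distrib add_divide_distrib)
  have "(LBINT t. fejer t * cos (l * t)) = (LBINT t. (1 / 2) * ?g (1 + l) t + (1 / 2) * ?g (1 - l) t - ?g l t)"
    using AE_lborel_singleton[of 0] by (intro integral_cong_AE) (auto simp: *)
  also have "\<dots> = (1 / 2) * \<bar>1 + l\<bar> + (1 / 2) * \<bar>1 - l\<bar> - \<bar>l\<bar>"
    by (subst Bochner_Integration.integral_diff Bochner_Integration.integral_add;
        (intro Bochner_Integration.integrable_add integrable_mult_right one_minus_cos_scaled)?)+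
      (simp only: one_minus_cos_scaled(2) integral_mult_right_zero)
  also have "\<dots> = tri l"
  proof -
    have "\<bar>1 + l\<bar> + \<bar>1 - l\<bar> - 2 * \<bar>l\<bar> = 2 * tri l"
      unfolding tri_def max_def abs_real_def by auto
    then show ?thesis by simp
  qed
  finally show ?thesis .
qed

lemma fourier_fejer:
  "(LBINT t. complex_of_real (fejer t) * niexp (t * l)) = tri l"
  using fourier_even[OF fejer_integrable, of "- l"] integral_fejer_cos[of l] by (simp add: mult.commute)

section \<open>Translation of the Fejer kernel\<close>

lemma fejer_Lipschitz: "\<bar>fejer (t + h) - fejer t\<bar> \<le> \<bar>h\<bar>"
proof -
  have "2 * pi * \<bar>fejer (t + h) - fejer t\<bar> = norm (complex_of_real (2 * pi * fejer (t + h)) - complex_of_real (2 * pi * fejer t))"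
    by (simp only: of_real_diff[symmetric] norm_of_real right_diff_distrib[symmetric] abs_mult) simp
  also have "\<dots> = norm (LBINT l. tri l * iexp ((t + h) * l) - tri l * iexp (t * l))"
    by (subst Bochner_Integration.integral_diff[OF tri_exp_integrable tri_exp_integrable]) (simp only: inverse_fourier_tri)
  also have "\<dots> \<le> (LBINT l. \<bar>h\<bar> * tri l)"
  proof (rule Bochner_Integration.integral_norm_bound_integral)
    fix l
    have "norm (tri l * iexp ((t + h) * l) - tri l * iexp (t * l))
      = norm (tri l * (iexp (t * l) * (iexp (h * l) - 1)))"
      by (simp add: algebra_simps exp_add)
    also have "\<dots> = tri l * norm (iexp (h * l) - 1)"
      by (simp add: norm_mult tri_nonneg)
    \<comment> \<open>The factor \<open>\<bar>l\<bar>\<close> is at most 1 wherever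
      \<open>tri\<close> does not vanish, so the transform side gives the Lipschitz constant
      uniformly in \<open>t\<close>, including the removable singularity at 0.\<close>
    also have "\<dots> \<le> tri l * \<bar>h * l\<bar>"
      using iexp_approx1[of "h * l" 0] by (intro mult_left_mono tri_nonneg) auto
    also have "\<dots> \<le> \<bar>h\<bar> * tri l"
    proof (cases "\<bar>l\<bar> \<le> 1")
      case True
      then have "(\<bar>h\<bar> * tri l) * \<bar>l\<bar> \<le> \<bar>h\<bar> * tri l"
        by (intro mult_left_le) (auto simp: tri_nonneg)
      then show ?thesis by (simp add: abs_mult mult_ac)
    qed (simp add: tri_outside)
    finally show "norm (tri l * iexp ((t + h) * l) - tri l * iexp (t * l)) \<le> \<bar>h\<bar> * tri l" .
  next
    show "integrable lborel (\<lambda>l. tri l * iexp ((t + h) * l) - tri l * iexp (t * l))"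
      by (rule Bochner_Integration.integrable_diff[OF tri_exp_integrable tri_exp_integrable])
    show "integrable lborel (\<lambda>l. \<bar>h\<bar> * tri l)"
      by (rule integrable_mult_right[OF tri_integrable])
  qed
  also have "\<dots> = \<bar>h\<bar>" by (simp add: integral_tri)
  finally have "2 * pi * \<bar>fejer (t + h) - fejer t\<bar> \<le> \<bar>h\<bar>" .
  moreover have "\<bar>fejer (t + h) - fejer t\<bar> \<le> 2 * pi * \<bar>fejer (t + h) - fejer t\<bar>"
    using mult_right_mono[of 1 "2 * pi" "\<bar>fejer (t + h) - fejer t\<bar>"] pi_gt3 by simp
  ultimately show ?thesis by (rule order_trans[rotated])
qed

text \<open>Provides an integrable majorant that is linear in \<open>h\<close>. Near 0 the Lipschitz
  bound suffices because 1 + t^2 is at most 5; farther out the shifted argument stays above half of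
  \<open>\<bar>t\<bar>\<close>, and the quotient can be estimated directly.\<close>

lemma fejer_shift:
  assumes h: "\<bar>h\<bar> \<le> 1"
  shows "\<bar>fejer (t + h) - fejer t\<bar> \<le> 20 * \<bar>h\<bar> / (1 + t\<^sup>2)"
proof (cases "\<bar>t\<bar> \<le> 2")
  case True
  then have "1 + t\<^sup>2 \<le> 5" using abs_le_square_iff[of t 2] by simp
  then have "\<bar>h\<bar> * (1 + t\<^sup>2) \<le> \<bar>h\<bar> * 20" by (intro mult_left_mono) auto
  then have "\<bar>h\<bar> \<le> 20 * \<bar>h\<bar> / (1 + t\<^sup>2)" by (simp add: divide_simps add_pos_nonneg mult_ac)
  then show ?thesis using fejer_Lipschitz[of t h] by linarith
next
  case False
  define u where "u = t + h"
  have t: "2 < \<bar>t\<bar>" using False by simp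
  have u: "\<bar>t\<bar> / 2 \<le> \<bar>u\<bar>" using h t unfolding u_def by linarith
  have ut: "\<bar>u\<bar> \<le> 2 * \<bar>t\<bar>" using h t unfolding u_def by linarith
  have u2: "t\<^sup>2 / 4 \<le> u\<^sup>2" using power_mono[OF u, of 2] by (simp add: power_divide)
  have nz: "t \<noteq> 0" "u \<noteq> 0" using t u by auto
  have t2: "4 < t\<^sup>2" using power_strict_mono[OF t, of 2] by simp
  \<comment> \<open>The difference of the quotients is split into the change of the numerator and
    the change of the denominator.\<close>
  have "pi * (fejer u - fejer t) = (cos t - cos u) / u\<^sup>2 + (1 - cos t) * ((t - u) * (t + u)) / (u\<^sup>2 * t\<^sup>2)"
    using nz by (simp add: fejer_def divide_simps power2_eq_square) (simp add: algebra_simps)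
  then have "pi * \<bar>fejer u - fejer t\<bar> = \<bar>(cos t - cos u) / u\<^sup>2 + (1 - cos t) * ((t - u) * (t + u)) / (u\<^sup>2 * t\<^sup>2)\<bar>"
    by (metis abs_mult abs_of_pos pi_gt_zero)
  also have "\<dots> \<le> \<bar>cos t - cos u\<bar> / u\<^sup>2 + \<bar>1 - cos t\<bar> * (\<bar>t - u\<bar> * \<bar>t + u\<bar>) / (u\<^sup>2 * t\<^sup>2)"
    by (rule order_trans[OF abs_triangle_ineq]) (simp add: abs_mult)
  also have "\<dots> \<le> \<bar>h\<bar> / u\<^sup>2 + 2 * (\<bar>h\<bar> * (3 * \<bar>t\<bar>)) / (u\<^sup>2 * t\<^sup>2)"
  proof (intro add_mono divide_right_mono mult_mono)
    show "\<bar>cos t - cos u\<bar> \<le> \<bar>h\<bar>"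
    proof -
      have "\<bar>cos t - cos u\<bar> = 2 * \<bar>sin ((t + u) / 2)\<bar> * \<bar>sin ((u - t) / 2)\<bar>"
        by (simp add: cos_diff_cos abs_mult)
      also have "\<dots> \<le> 2 * 1 * \<bar>(u - t) / 2\<bar>"
        by (intro mult_mono abs_sin_x_le_abs_x) auto
      finally show ?thesis by (simp add: u_def)
    qed
    show "\<bar>1 - cos t\<bar> \<le> 2" using cos_ge_minus_one[of t] cos_le_one[of t] by linarith
    show "\<bar>t + u\<bar> \<le> 3 * \<bar>t\<bar>" using ut by linarith
  qed (auto simp: u_def)
  also have "\<dots> = (\<bar>h\<bar> + 6 * \<bar>h\<bar> / \<bar>t\<bar>) / u\<^sup>2"
  proof -
    have "t\<^sup>2 = \<bar>t\<bar> * \<bar>t\<bar>" by (simp add: power2_eq_square)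
    then show ?thesis using nz by (simp only:) (simp add: field_simps)
  qed
  also have "\<dots> \<le> (\<bar>h\<bar> + 3 * \<bar>h\<bar>) / u\<^sup>2"
    using t mult_left_mono[of 2 "\<bar>t\<bar>" "\<bar>h\<bar>"]
    by (intro divide_right_mono add_left_mono) (auto simp: divide_simps)
  also have "\<dots> \<le> (4 * \<bar>h\<bar>) / (t\<^sup>2 / 4)"
    using u2 nz by (intro frac_le) auto
  also have "\<dots> \<le> 20 * \<bar>h\<bar> / (1 + t\<^sup>2)"
  proof -
    have "16 * (1 + t\<^sup>2) \<le> 20 * t\<^sup>2" using t2 by simp
    then have "\<bar>h\<bar> * (16 * (1 + t\<^sup>2)) \<le> \<bar>h\<bar> * (20 * t\<^sup>2)" by (rule mult_left_mono) simp
    then show ?thesis using nz by (simp add: divide_simps add_pos_nonneg mult_ac)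
  qed
  finally have "pi * \<bar>fejer u - fejer t\<bar> \<le> 20 * \<bar>h\<bar> / (1 + t\<^sup>2)" .
  moreover have "\<bar>fejer u - fejer t\<bar> \<le> pi * \<bar>fejer u - fejer t\<bar>"
    using mult_right_mono[of 1 pi "\<bar>fejer u - fejer t\<bar>"] pi_gt3 by simp
  ultimately have "\<bar>fejer u - fejer t\<bar> \<le> 20 * \<bar>h\<bar> / (1 + t\<^sup>2)" by (rule order_trans[rotated])
  then show ?thesis unfolding u_def .
qed

section \<open>Fourier pairs and kernels on the space\<close>

text \<open>Inversion is part of the notion. For the kernels at hand both transforms are explicit,
  and both directions survive linear combinations and products over coordinates, so no general
  inversion theorem enters.\<close>

definition fourier_pair1 :: "(real \<Rightarrow> complex) \<Rightarrow> (real \<Rightarrow> complex) \<Rightarrow> bool" where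
  "fourier_pair1 g u \<longleftrightarrow> integrable lborel g \<and> integrable lborel u \<and>
     (\<forall>l. (LBINT t. g t * niexp (t * l)) = u l) \<and>
     (\<forall>t. (LBINT l. u l * iexp (t * l)) = complex_of_real (2 * pi) * g t)"

definition fourier_pair :: "(real^'d \<Rightarrow> complex) \<Rightarrow> (real^'d \<Rightarrow> complex) \<Rightarrow> bool" where
  "fourier_pair g u \<longleftrightarrow> integrable lborel g \<and> integrable lborel u \<and>
     (\<forall>l. (LBINT t. g t * niexp (t \<bullet> l)) = u l) \<and>
     (\<forall>t. (LBINT l. u l * iexp (t \<bullet> l)) = complex_of_real ((2 * pi) ^ CARD('d)) * g t)"

lemma integral_affine_complex:
  fixes f :: "real \<Rightarrow> complex"
  assumes "c \<noteq> 0"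
  shows "(LBINT x. f x) = complex_of_real \<bar>c\<bar> * (LBINT x. f (b + c * x))"
  using lborel_integral_real_affine[OF assms, of f b] by (simp add: scaleR_conv_of_real)

lemma fourier_pair1_fejer:
  assumes N: "0 < N"
  shows "fourier_pair1 (\<lambda>t. complex_of_real (N * fejer (N * t)) * iexp (b * t))
    (\<lambda>l. complex_of_real (tri ((l - b) / N)))"
  unfolding fourier_pair1_def
proof (intro conjI allI)
  have "integrable lborel (\<lambda>t. N * fejer (0 + N * t))"
    using N by (intro integrable_mult_right lborel_integrable_real_affine fejer_integrable) auto
  then show "integrable lborel (\<lambda>t. complex_of_real (N * fejer (N * t)) * iexp (b * t))"
    by (rule Bochner_Integration.integrable_bound) (auto simp: norm_mult)
  have "integrable lborel (\<lambda>l. tri (- b / N + (1 / N) * l))"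
    using N by (intro lborel_integrable_real_affine tri_integrable) auto
  then have "integrable lborel (\<lambda>l. tri ((l - b) / N))"
    by (simp add: diff_divide_distrib)
  then show "integrable lborel (\<lambda>l. complex_of_real (tri ((l - b) / N)))" by simp
next
  fix l
  have "(LBINT t. complex_of_real (N * fejer (N * t)) * iexp (b * t) * niexp (t * l))
    = (LBINT t. complex_of_real N * (complex_of_real (fejer (0 + N * t)) * niexp ((0 + N * t) * ((l - b) / N))))"
  proof (intro Bochner_Integration.integral_cong refl)
    fix t :: real
    have "(0 + N * t) * ((l - b) / N) = t * l - b * t" using N by (simp add: field_simps)
    then have e: "complex_of_real ((0 + N * t) * ((l - b) / N)) = complex_of_real (t * l) - complex_of_real (b * t)"
      by (simp only: of_real_diff)
    show "complex_of_real (N * fejer (N * t)) * iexp (b * t) * niexp (t * l)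
      = complex_of_real N * (complex_of_real (fejer (0 + N * t)) * niexp ((0 + N * t) * ((l - b) / N)))"
      unfolding e by (simp add: right_diff_distrib exp_diff exp_minus field_simps)
  qed
  also have "\<dots> = complex_of_real N * (LBINT t. (complex_of_real (fejer (0 + N * t)) * niexp ((0 + N * t) * ((l - b) / N))))"
    by simp
  also have "\<dots> = (LBINT t. complex_of_real (fejer t) * niexp (t * ((l - b) / N)))"
    by (subst integral_affine_complex[of N _ 0]) (use N in simp_all)
  also have "\<dots> = complex_of_real (tri ((l - b) / N))" by (rule fourier_fejer)
  finally show "(LBINT t. complex_of_real (N * fejer (N * t)) * iexp (b * t) * niexp (t * l))
    = complex_of_real (tri ((l - b) / N))" .
next
  fix t
  have "(LBINT l. complex_of_real (tri ((l - b) / N)) * iexp (t * l))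
    = complex_of_real N * (LBINT l. complex_of_real (tri ((b + N * l - b) / N)) * iexp (t * (b + N * l)))"
    by (subst integral_affine_complex[of N _ b]) (use N in simp_all)
  also have "\<dots> = complex_of_real N * (LBINT l. iexp (b * t) * (complex_of_real (tri l) * iexp (N * t * l)))"
    using N by (intro arg_cong[where f="\<lambda>z. complex_of_real N * z"] Bochner_Integration.integral_cong refl)
      (simp add: distrib_left exp_add mult_ac)
  also have "\<dots> = complex_of_real N * (iexp (b * t) * (2 * pi * fejer (N * t)))"
    by (simp only: integral_mult_right_zero inverse_fourier_tri)
  finally show "(LBINT l. complex_of_real (tri ((l - b) / N)) * iexp (t * l))
    = complex_of_real (2 * pi) * (complex_of_real (N * fejer (N * t)) * iexp (b * t))" by (simp add: mult_ac)
qed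

lemma integrable_mult_exp:
  fixes f :: "'a \<Rightarrow> complex"
  assumes "integrable M f" "g \<in> borel_measurable M"
  shows "integrable M (\<lambda>t. f t * iexp (g t))"
    "integrable M (\<lambda>t. f t * niexp (g t))"
proof -
  have [measurable]: "f \<in> borel_measurable M" "g \<in> borel_measurable M" using assms by auto
  show "integrable M (\<lambda>t. f t * iexp (g t))"
    by (rule Bochner_Integration.integrable_bound[OF assms(1)]) (auto simp: norm_mult)
  show "integrable M (\<lambda>t. f t * niexp (g t))"
    by (rule Bochner_Integration.integrable_bound[OF assms(1)]) (auto simp: norm_mult)
qed

lemma fourier_pair1_lincomb:
  assumes "fourier_pair1 g u" "fourier_pair1 g' u'"
  shows "fourier_pair1 (\<lambda>t. c * g t + c' * g' t) (\<lambda>l. c * u l + c' * u' l)"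
proof -
  note [simp] = assms[unfolded fourier_pair1_def]
  have 1: "integrable lborel (\<lambda>t. g t * niexp (t * l))"
    "integrable lborel (\<lambda>t. g' t * niexp (t * l))"
    "integrable lborel (\<lambda>t. u t * iexp (l * t))"
    "integrable lborel (\<lambda>t. u' t * iexp (l * t))" for l
    using assms by (auto intro!: integrable_mult_exp simp: fourier_pair1_def simp del: of_real_mult)
  show ?thesis
    unfolding fourier_pair1_def ring_distribs mult.assoc
    using 1 by (simp add: Bochner_Integration.integral_add del: of_real_mult)
qed

text \<open>Twice the Fejer kernel of scale 2, which is \<open>2 * fejer (2 * t)\<close>, minus the
  one of scale 1. The transform \<open>vhat\<close> is the trapezoid that is 1 on [-1, 1] and
  vanishes outside [-2, 2].\<close>

definition vp :: "real \<Rightarrow> real" where "vp t = 4 * fejer (2 * t) - fejer t"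

definition vhat :: "real \<Rightarrow> real" where "vhat l = 2 * tri (l / 2) - tri l"

lemma vp_measurable [measurable]: "vp \<in> borel_measurable borel"
  unfolding vp_def by measurable

lemma vhat_eq_1: "\<bar>l\<bar> \<le> 1 \<Longrightarrow> vhat l = 1"
  by (auto simp: vhat_def tri_def)

lemma fourier_pair1_vp:
  "fourier_pair1 (\<lambda>t. complex_of_real (vp t) * iexp (b * t)) (\<lambda>l. complex_of_real (vhat (l - b)))"
  using fourier_pair1_lincomb[OF fourier_pair1_fejer[of 2 b] fourier_pair1_fejer[of 1 b], of 2 "-1"]
  by (simp add: vp_def vhat_def algebra_simps)

lemma prod_Basis_vec:
  fixes f :: "'d::finite \<Rightarrow> 'a::comm_monoid_mult"
  shows "(\<Prod>b\<in>(Basis::(real^'d) set). f (THE j. b = axis j 1)) = (\<Prod>j\<in>UNIV. f j)"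
proof -
  have [simp]: "(THE j. axis k (1::real) = axis j 1) = k" for k :: 'd
    by (rule the_equality) (auto simp: axis_eq_axis)
  have B: "(Basis::(real^'d) set) = range (\<lambda>j. axis j 1)" by (auto simp: Basis_vec_def)
  show ?thesis unfolding B by (subst prod.reindex) (auto simp: inj_def axis_eq_axis)
qed

text \<open>Fubini for tensor products. By definition \<open>lborel\<close> is the image of a
  product measure indexed by \<open>Basis\<close>, hence the passage between coordinates and unit
  vectors through \<open>THE\<close>.\<close>

lemma lborel_vec_integral_prod:
  fixes g :: "'d::finite \<Rightarrow> real \<Rightarrow> 'b::{real_normed_field,banach,second_countable_topology}"
  assumes g: "\<And>j. integrable lborel (g j)"
  shows "integrable lborel (\<lambda>t::real^'d. \<Prod>j\<in>UNIV. g j (t $ j))"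
    and "(\<integral>t. (\<Prod>j\<in>UNIV. g j (t $ j)) \<partial>(lborel :: (real^'d) measure)) = (\<Prod>j\<in>UNIV. \<integral>x. g j x \<partial>lborel)"
proof -
  define f where "f b = g (THE j. b = axis j 1)" for b :: "real^'d"
  interpret product_sigma_finite "\<lambda>b::real^'d. lborel :: real measure"
    by standard
  have [simp]: "(\<Sum>b\<in>Basis. x b *\<^sub>R b) \<bullet> b' = x b'" if "b' \<in> Basis" for b' :: "real^'d" and x
    using that by (simp add: inner_sum_left inner_Basis if_distrib sum.delta cong: if_cong)
  have L: "(lborel :: (real^'d) measure) = distr (\<Pi>\<^sub>M b\<in>Basis. lborel) borel (\<lambda>f. \<Sum>b\<in>Basis. f b *\<^sub>R b)"
    unfolding lborel_def[where 'a="real^'d"] lborel_eq_real by simp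
  have eq: "(\<Prod>j\<in>UNIV. g j (t $ j)) = (\<Prod>b\<in>Basis. f b (t \<bullet> b))" for t :: "real^'d"
  proof -
    have "(\<Prod>j\<in>UNIV. g j (t $ j)) = (\<Prod>b\<in>(Basis::(real^'d) set). g (THE j. b = axis j 1) (t $ (THE j. b = axis j 1)))"
      by (rule prod_Basis_vec[symmetric])
    also have "\<dots> = (\<Prod>b\<in>Basis. f b (t \<bullet> b))"
    proof (rule prod.cong[OF refl])
      fix b :: "real^'d" assume "b \<in> Basis"
      then obtain k where b: "b = axis k 1" by (auto simp: Basis_vec_def)
      have "(THE j. b = axis j 1) = k" unfolding b by (rule the_equality) (auto simp: axis_eq_axis)
      then show "g (THE j. b = axis j 1) (t $ (THE j. b = axis j 1)) = f b (t \<bullet> b)"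
        by (simp add: f_def b inner_axis)
    qed
    finally show ?thesis .
  qed
  have gm[measurable]: "g j \<in> borel_measurable borel" for j using g[of j] by auto
  have fi: "integrable lborel (f b)" for b unfolding f_def by (rule g)
  have m: "(\<lambda>t::real^'d. \<Prod>b\<in>Basis. f b (t \<bullet> b)) \<in> borel_measurable borel"
    unfolding f_def by measurable
  have m2: "(\<lambda>f. \<Sum>b\<in>Basis. f b *\<^sub>R b) \<in> (\<Pi>\<^sub>M b\<in>(Basis::(real^'d) set). lborel) \<rightarrow>\<^sub>M borel"
    by measurable
  show "integrable lborel (\<lambda>t::real^'d. \<Prod>j\<in>UNIV. g j (t $ j))"
    unfolding eq L using product_integrable_prod[of Basis f] fi
    by (subst integrable_distr_eq[OF m2 m]) simp
  show "(\<integral>t. (\<Prod>j\<in>UNIV. g j (t $ j)) \<partial>(lborel :: (real^'d) measure)) = (\<Prod>j\<in>UNIV. \<integral>x. g j x \<partial>lborel)"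
  proof -
    have "(\<integral>t. (\<Prod>j\<in>UNIV. g j (t $ j)) \<partial>(lborel :: (real^'d) measure))
      = (\<integral>x. (\<Prod>b\<in>Basis. f b (x b)) \<partial>(\<Pi>\<^sub>M b\<in>(Basis::(real^'d) set). lborel))"
      unfolding eq L by (subst integral_distr[OF m2 m]) simp
    also have "\<dots> = (\<Prod>b\<in>(Basis::(real^'d) set). \<integral>x. f b x \<partial>lborel)"
      by (rule product_integral_prod) (auto simp: fi)
    also have "\<dots> = (\<Prod>j\<in>UNIV. \<integral>x. g j x \<partial>lborel)"
      unfolding f_def by (rule prod_Basis_vec[where f="\<lambda>j. integral\<^sup>L lborel (g j)"])
    finally show ?thesis .
  qed
qed

lemma exp_inner_prod:
  fixes t l :: "real^'d::finite"
  shows "iexp (t \<bullet> l) = (\<Prod>j\<in>UNIV. iexp (t $ j * l $ j))"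
    "niexp (t \<bullet> l) = (\<Prod>j\<in>UNIV. niexp (t $ j * l $ j))"
  by (simp_all add: inner_vec_def exp_sum[symmetric] sum_distrib_left sum_negf)

lemma fourier_pair_prod:
  fixes g u :: "'d::finite \<Rightarrow> real \<Rightarrow> complex"
  assumes "\<And>j. fourier_pair1 (g j) (u j)"
  shows "fourier_pair (\<lambda>t::real^'d. \<Prod>j\<in>UNIV. g j (t $ j)) (\<lambda>l. \<Prod>j\<in>UNIV. u j (l $ j))"
  unfolding fourier_pair_def
proof (intro conjI allI)
  have i: "integrable lborel (g j)" "integrable lborel (u j)" for j
    using assms by (auto simp: fourier_pair1_def)
  show "integrable lborel (\<lambda>t::real^'d. \<Prod>j\<in>UNIV. g j (t $ j))"
    by (rule lborel_vec_integral_prod(1)) (rule i)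
  show "integrable lborel (\<lambda>t::real^'d. \<Prod>j\<in>UNIV. u j (t $ j))"
    by (rule lborel_vec_integral_prod(1)) (rule i)
  fix l :: "real^'d"
  show "(LBINT t. (\<Prod>j\<in>UNIV. g j (t $ j)) * niexp (t \<bullet> l)) = (\<Prod>j\<in>UNIV. u j (l $ j))"
    unfolding exp_inner_prod prod.distrib[symmetric] using assms
    by (subst lborel_vec_integral_prod(2)[of "\<lambda>j x. g j x * niexp (x * l $ j)"])
      (auto simp: fourier_pair1_def intro!: integrable_mult_exp simp del: of_real_mult)
  show "(LBINT t. (\<Prod>j\<in>UNIV. u j (t $ j)) * iexp (l \<bullet> t)) = complex_of_real ((2 * pi) ^ CARD('d)) * (\<Prod>j\<in>UNIV. g j (l $ j))"
    unfolding exp_inner_prod prod.distrib[symmetric] using assms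
    by (subst lborel_vec_integral_prod(2)[of "\<lambda>j x. u j x * iexp (l $ j * x)"])
      (auto simp: fourier_pair1_def prod.distrib intro!: integrable_mult_exp simp del: of_real_mult simp flip: of_real_power)
qed

definition phi_hat :: "real \<Rightarrow> real^'d \<Rightarrow> real^'d \<Rightarrow> complex" where
  "phi_hat N a l = (\<Prod>k\<in>UNIV. complex_of_real (tri ((l $ k - N * a $ k) / N)))"

lemma phi_eq_prod:
  assumes "0 < N"
  shows "phi N a t = (\<Prod>j\<in>UNIV. complex_of_real (N * fejer (N * t $ j)) * iexp (N * a $ j * t $ j))"
  using fourier_pair_prod[where g="\<lambda>j t. complex_of_real (N * fejer (N * t)) * iexp (N * a $ j * t)",
    OF fourier_pair1_fejer[OF assms]]
  unfolding fourier_pair_def phi_def by simp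

lemma fourier_pair_phi:
  assumes "0 < N"
  shows "fourier_pair (phi N a) (phi_hat N a)"
proof -
  have e: "phi N a = (\<lambda>t. \<Prod>j\<in>UNIV. complex_of_real (N * fejer (N * t $ j)) * iexp (N * a $ j * t $ j))"
    using phi_eq_prod[OF assms] by blast
  show ?thesis
    unfolding phi_hat_def e
    by (rule fourier_pair_prod[where g="\<lambda>j t. complex_of_real (N * fejer (N * t)) * iexp (N * a $ j * t)"])
      (rule fourier_pair1_fejer[OF assms])
qed

text \<open>The factors \<open>vp\<close> are de la Vallee-Poussin kernels, whose transform equals \<open>1\<close> on the support of that of \<open>fejer\<close>.\<close>

definition Vk :: "real^'d \<Rightarrow> real^'d \<Rightarrow> complex" where
  "Vk a t = (\<Prod>j\<in>UNIV. complex_of_real (vp (t $ j)) * iexp (a $ j * t $ j))"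

definition Vk_hat :: "real^'d \<Rightarrow> real^'d \<Rightarrow> complex" where
  "Vk_hat a l = (\<Prod>j\<in>UNIV. complex_of_real (vhat (l $ j - a $ j)))"

lemma fourier_pair_Vk: "fourier_pair (Vk a) (Vk_hat a)"
  unfolding Vk_hat_def Vk_def[abs_def]
  by (rule fourier_pair_prod[where g="\<lambda>j t. complex_of_real (vp t) * iexp (a $ j * t)"])
    (rule fourier_pair1_vp)

text \<open>The inversion formula for \<open>g\<close> is inserted and the integrals are
  interchanged. The result determines the convolution at every point; the module acts on functions
  and not on classes modulo null sets, so identities of kernels are wanted in this form.\<close>

lemma conv_fourier_pair:
  fixes f g :: "real^'d::finite \<Rightarrow> complex"
  assumes "fourier_pair f u" "fourier_pair g v"
  shows "complex_of_real ((2 * pi) ^ CARD('d)) * conv f g t = (LBINT l. u l * v l * iexp (t \<bullet> l))"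
proof -
  have f: "integrable lborel f" "\<And>l. (LBINT t. f t * niexp (t \<bullet> l)) = u l"
    and g: "integrable lborel v" "\<And>t. (LBINT l. v l * iexp (t \<bullet> l)) = complex_of_real ((2 * pi) ^ CARD('d)) * g t"
    using assms unfolding fourier_pair_def by auto
  have [measurable]: "f \<in> borel_measurable borel" "v \<in> borel_measurable borel" using f g by auto
  define H where "H s l = f s * (v l * iexp ((t - s) \<bullet> l))" for s l
  have Hm[measurable]: "case_prod H \<in> borel_measurable (lborel \<Otimes>\<^sub>M lborel)"
    unfolding H_def by measurable
  have Hn: "norm (H s l) = norm (f s) * norm (v l)" for s l by (simp add: H_def norm_mult)
  have Hint: "integrable (lborel \<Otimes>\<^sub>M lborel) (case_prod H)"
  proof (rule lborel_pair.Fubini_integrable)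
    show "integrable lborel (\<lambda>s. \<integral>l. norm (case_prod H (s, l)) \<partial>lborel)"
      using f(1) by (simp add: Hn)
    show "AE s in lborel. integrable lborel (\<lambda>l. case_prod H (s, l))"
      using g(1) by (auto simp: H_def intro!: AE_I2 integrable_mult_right integrable_mult_exp)
  qed measurable
  have "complex_of_real ((2 * pi) ^ CARD('d)) * conv f g t = (LBINT s. f s * (complex_of_real ((2 * pi) ^ CARD('d)) * g (t - s)))"
    unfolding conv_def by (subst integral_mult_right_zero[symmetric]) (simp add: mult_ac)
  also have "\<dots> = (\<integral>s. \<integral>l. H s l \<partial>lborel \<partial>lborel)"
    unfolding g(2)[symmetric] H_def by simp
  also have "\<dots> = (\<integral>l. \<integral>s. H s l \<partial>lborel \<partial>lborel)"
    by (rule lborel_pair.Fubini_integral[symmetric]) (rule Hint)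
  also have "\<dots> = (LBINT l. u l * v l * iexp (t \<bullet> l))"
  proof (rule Bochner_Integration.integral_cong[OF refl])
    fix l
    have "(LBINT s. H s l) = (LBINT s. (f s * niexp (s \<bullet> l)) * (v l * iexp (t \<bullet> l)))"
      unfolding H_def by (simp add: inner_diff_left exp_diff exp_minus field_simps)
    also have "\<dots> = u l * (v l * iexp (t \<bullet> l))"
      by (simp add: f(2))
    finally show "(LBINT s. H s l) = u l * v l * iexp (t \<bullet> l)" by simp
  qed
  finally show ?thesis .
qed

lemma conv_eq_right:
  assumes "fourier_pair f u" "fourier_pair g v" "\<And>l. u l * v l = v l"
  shows "conv f g = g"
proof
  fix t
  show "conv f g t = g t"
    using conv_fourier_pair[OF assms(1,2), of t] assms(2) by (simp add: assms(3) fourier_pair_def)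
qed

lemma conv_eq_0:
  assumes "fourier_pair f u" "fourier_pair g v" "\<And>l. u l * v l = 0"
  shows "conv f g = (\<lambda>_. 0)"
proof
  fix t
  show "conv f g t = 0"
    using conv_fourier_pair[OF assms(1,2), of t] by (simp add: assms(3))
qed

text \<open>A finite partition of unity on the set where \<open>u\<close> is nonzero is enough; the
  bound on the \<open>v n\<close> serves the integrability of the products.\<close>

lemma sum_conv_eq_left:
  fixes f :: "real^'d::finite \<Rightarrow> complex"
  assumes f: "fourier_pair f u" and g: "\<And>n. n \<in> F \<Longrightarrow> fourier_pair (g n) (v n)" and "finite F"
    and one: "\<And>l. u l \<noteq> 0 \<Longrightarrow> (\<Sum>n\<in>F. v n l) = 1" and bd: "\<And>n l. n \<in> F \<Longrightarrow> norm (v n l) \<le> 1"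
  shows "(\<lambda>t. \<Sum>n\<in>F. conv f (g n) t) = f"
proof
  fix t
  have u: "integrable lborel u" using f by (simp add: fourier_pair_def)
  have i: "integrable lborel (\<lambda>l. u l * v n l * iexp (t \<bullet> l))" if "n \<in> F" for n
  proof (rule integrable_mult_exp)
    have "integrable lborel (v n)" using g[OF that] by (simp add: fourier_pair_def)
    then have [measurable]: "v n \<in> borel_measurable borel" "u \<in> borel_measurable borel" using u by auto
    show "integrable lborel (\<lambda>l. u l * v n l)"
      by (rule Bochner_Integration.integrable_bound[OF u])
        (use bd[OF that] in \<open>auto simp: norm_mult mult_left_le\<close>)
  qed simp
  have "complex_of_real ((2 * pi) ^ CARD('d)) * (\<Sum>n\<in>F. conv f (g n) t) = (\<Sum>n\<in>F. complex_of_real ((2 * pi) ^ CARD('d)) * conv f (g n) t)"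
    by (rule sum_distrib_left)
  also have "\<dots> = (\<Sum>n\<in>F. \<integral>l. u l * v n l * iexp (t \<bullet> l) \<partial>lborel)"
    by (rule sum.cong[OF refl conv_fourier_pair[OF f g]])
  also have "\<dots> = (LBINT l. (\<Sum>n\<in>F. u l * v n l * iexp (t \<bullet> l)))"
    by (rule Bochner_Integration.integral_sum[symmetric]) (rule i)
  also have "\<dots> = (LBINT l. u l * iexp (t \<bullet> l))"
  proof (rule Bochner_Integration.integral_cong[OF refl])
    fix l
    have "(\<Sum>n\<in>F. u l * v n l * iexp (t \<bullet> l)) = u l * (\<Sum>n\<in>F. v n l) * iexp (t \<bullet> l)"
      by (simp add: sum_distrib_left sum_distrib_right)
    then show "(\<Sum>n\<in>F. u l * v n l * iexp (t \<bullet> l)) = u l * iexp (t \<bullet> l)"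
      using one[of l] by (cases "u l = 0") auto
  qed
  also have "\<dots> = complex_of_real ((2 * pi) ^ CARD('d)) * f t" using f by (simp add: fourier_pair_def)
  finally show "(\<Sum>n\<in>F. conv f (g n) t) = f t" by simp
qed

section \<open>The partition of unity over the frequency lattice\<close>

definition rvec :: "int^'d \<Rightarrow> real^'d" where "rvec n = (\<chi> j. real_of_int (n $ j))"

lemma rvec_nth [simp]: "rvec n $ j = real_of_int (n $ j)" by (simp add: rvec_def)

abbreviation phik :: "int^'d \<Rightarrow> real^'d \<Rightarrow> complex" where "phik n \<equiv> phi 1 (rvec n)"

text \<open>Only the two integers next to \<open>l\<close> contribute, and the values of
  \<open>tri\<close> there add up to 1.\<close>

lemma tri_partition_of_unity:
  assumes "\<bar>l - real_of_int m\<bar> \<le> real L"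
  shows "(\<Sum>a = m - int L..m + int L. tri (l - real_of_int a)) = 1"
proof -
  define b where "b = \<lfloor>l\<rfloor>"
  have b: "real_of_int b \<le> l" "l < real_of_int b + 1" unfolding b_def by linarith+
  have z: "tri (l - real_of_int a) = 0" if "a \<noteq> b" "a \<noteq> b + 1" for a
  proof (rule tri_outside)
    have "a \<le> b - 1 \<or> a \<ge> b + 2" using that by linarith
    then have "real_of_int a \<le> real_of_int b - 1 \<or> real_of_int a \<ge> real_of_int b + 2" by linarith
    then show "1 \<le> \<bar>l - real_of_int a\<bar>" using b by linarith
  qed
  have lo: "m - int L \<le> b" using assms b by linarith
  have hi: "b \<le> m + int L" using assms b by linarith
  show ?thesis
  proof (cases "b + 1 \<le> m + int L")
    case True
    have "(\<Sum>a = m - int L..m + int L. tri (l - real_of_int a)) = (\<Sum>a\<in>{b, b + 1}. tri (l - real_of_int a))"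
      by (rule sum.mono_neutral_right) (use lo hi True z in auto)
    also have "\<dots> = 1" using b by (simp add: tri_def)
    finally show ?thesis .
  next
    \<comment> \<open>The right neighbour can leave the window only if \<open>l\<close> is the right
      end of it, and then its contribution would be 0.\<close>
    case False
    then have bm: "b = m + int L" using hi by simp
    then have l: "l = real_of_int b" using assms b by linarith
    have "(\<Sum>a = m - int L..m + int L. tri (l - real_of_int a)) = (\<Sum>a\<in>{b}. tri (l - real_of_int a))"
      by (rule sum.mono_neutral_right) (use lo hi z bm in auto)
    also have "\<dots> = 1" using l by (simp add: tri_def)
    finally show ?thesis .
  qed
qed

lemma phi_hat_partition_of_unity:
  fixes m :: "int^'d::finite"
  assumes "\<And>j. \<bar>l $ j - real_of_int (m $ j)\<bar> \<le> real L"
  shows "(\<Sum>n\<in>{n. supnorm (n - m) \<le> int L}. phi_hat 1 (rvec n) l) = 1"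
proof -
  have bij: "bij_betw vec_lambda (PiE UNIV (\<lambda>j. {m $ j - int L..m $ j + int L})) {n. supnorm (n - m) \<le> int L}"
  proof (rule bij_betw_byWitness[where f'=vec_nth])
    show "vec_lambda ` (PiE UNIV (\<lambda>j. {m $ j - int L..m $ j + int L})) \<subseteq> {n. supnorm (n - m) \<le> int L}"
      by (auto simp: supnorm_le_iff abs_le_iff PiE_iff) (smt (verit))+
    show "vec_nth ` {n. supnorm (n - m) \<le> int L} \<subseteq> PiE UNIV (\<lambda>j. {m $ j - int L..m $ j + int L})"
      by (auto simp: supnorm_le_iff abs_le_iff PiE_iff) (smt (verit))+
  qed auto
  have "(\<Sum>n\<in>{n. supnorm (n - m) \<le> int L}. phi_hat 1 (rvec n) l)
    = (\<Sum>g\<in>PiE UNIV (\<lambda>j. {m $ j - int L..m $ j + int L}). \<Prod>j\<in>UNIV. complex_of_real (tri (l $ j - real_of_int (g j))))"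
    by (subst sum.reindex_bij_betw[OF bij, symmetric]) (simp add: phi_hat_def)
  also have "\<dots> = (\<Prod>j\<in>UNIV. \<Sum>a = m $ j - int L..m $ j + int L. complex_of_real (tri (l $ j - real_of_int a)))"
    by (rule prod_sum_PiE[symmetric]) auto
  also have "\<dots> = 1"
    by (rule prod.neutral) (simp only: of_real_sum[symmetric] tri_partition_of_unity[OF assms], simp)
  finally show ?thesis .
qed

lemma norm_phi_hat_le: "norm (phi_hat N a l) \<le> 1"
  unfolding phi_hat_def prod_norm[symmetric]
  by (rule prod_le_1) (auto simp: tri_nonneg tri_le_1)

lemma phi_hat_nonzeroD: "phi_hat N a l \<noteq> 0 \<Longrightarrow> \<bar>(l $ j - N * a $ j) / N\<bar> < 1"
  unfolding phi_hat_def using tri_outside[of "(l $ j - N * a $ j) / N"] by (auto simp: not_le[symmetric])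

lemma conv_Vk_phik: "conv (Vk (rvec n)) (phik n) = phik n"
proof (rule conv_eq_right[OF fourier_pair_Vk fourier_pair_phi])
  fix l
  show "Vk_hat (rvec n) l * phi_hat 1 (rvec n) l = phi_hat 1 (rvec n) l"
  proof (cases "phi_hat 1 (rvec n) l = 0")
    case False
    then have "vhat (l $ j - rvec n $ j) = 1" for j
      using phi_hat_nonzeroD[OF False, of j] by (intro vhat_eq_1) simp
    then show ?thesis by (simp add: Vk_hat_def)
  qed simp
qed simp

text \<open>The transforms vanish outside the open cubes of radius 1 around \<open>m\<close> and
  \<open>n\<close>, which are disjoint as soon as one coordinate differs by 2.\<close>

lemma conv_phik_eq_0:
  assumes "2 \<le> supnorm (n - m)"
  shows "conv (phik m) (phik n) = (\<lambda>_. 0)"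
proof (rule conv_eq_0[OF fourier_pair_phi fourier_pair_phi])
  fix l :: "real^'a"
  obtain j where j: "supnorm (n - m) = \<bar>(n - m) $ j\<bar>" using supnorm_attained by blast
  then have "2 \<le> real_of_int \<bar>(n - m) $ j\<bar>" using assms by linarith
  then have 2: "2 \<le> \<bar>real_of_int (n $ j) - real_of_int (m $ j)\<bar>" by simp
  show "phi_hat 1 (rvec m) l * phi_hat 1 (rvec n) l = 0"
  proof (rule ccontr)
    assume "phi_hat 1 (rvec m) l * phi_hat 1 (rvec n) l \<noteq> 0"
    then have "\<bar>l $ j - real_of_int (m $ j)\<bar> < 1" "\<bar>l $ j - real_of_int (n $ j)\<bar> < 1"
      using phi_hat_nonzeroD[of 1 "rvec m" l j] phi_hat_nonzeroD[of 1 "rvec n" l j] by auto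
    then show False using 2 by linarith
  qed
qed simp_all

text \<open>Needed in two cases: \<open>N = 1\<close>, where a component meets only its neighbours,
  and \<open>a = 0\<close> with growing \<open>N\<close>, where the kernels form an approximate
  identity.\<close>

lemma sum_conv_phi:
  fixes m :: "int^'d::finite"
  assumes "0 < N" "N \<le> real L" "N *\<^sub>R a = rvec m"
  shows "(\<lambda>t. \<Sum>n\<in>{n. supnorm (n - m) \<le> int L}. conv (phi N a) (phik n) t) = phi N a"
proof (rule sum_conv_eq_left[OF fourier_pair_phi[OF assms(1)]])
  show "finite {n. supnorm (n - m) \<le> int L}" by (rule finite_supnorm_diff_le)
  fix l assume nz: "phi_hat N a l \<noteq> 0"
  have "\<bar>l $ j - real_of_int (m $ j)\<bar> \<le> real L" for j
  proof -
    have "N * a $ j = real_of_int (m $ j)" using assms(3) by (metis rvec_nth real_scaleR_def vector_scaleR_component)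
    then have "\<bar>(l $ j - real_of_int (m $ j)) / N\<bar> < 1" using phi_hat_nonzeroD[OF nz, of j] by simp
    then have "\<bar>l $ j - real_of_int (m $ j)\<bar> < N" using assms(1) by (simp add: abs_divide)
    then show ?thesis using assms(2) by linarith
  qed
  then show "(\<Sum>n\<in>{n. supnorm (n - m) \<le> int L}. phi_hat 1 (rvec n) l) = 1"
    by (rule phi_hat_partition_of_unity)
qed (auto intro!: fourier_pair_phi norm_phi_hat_le)

text \<open>The constant \<open>180\<close> makes one majorant serve for \<open>fejer\<close>, \<open>vp\<close> and the difference quotients of \<open>vp\<close>.\<close>

definition shift_const :: "'d::finite itself \<Rightarrow> real" where
  "shift_const _ = (\<integral>t. (\<Prod>j\<in>(UNIV::'d set). 180 / (1 + (t $ j)\<^sup>2)) \<partial>(lborel :: (real^'d) measure))"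

lemma shift_majorant_integrable: "integrable lborel (\<lambda>t::real^'d::finite. \<Prod>j\<in>UNIV. 180 / (1 + (t $ j)\<^sup>2))"
  using lborel_vec_integral_prod(1)[of "\<lambda>j x. 180 / (1 + x\<^sup>2)"] integrable_Cauchy_density
  by (simp add: integrable_mult_right_iff divide_inverse)

lemma shift_const_nonneg: "0 \<le> shift_const TYPE('d::finite)"
  unfolding shift_const_def by (intro Bochner_Integration.integral_nonneg prod_nonneg) auto

lemma vp_le: "\<bar>vp t\<bar> \<le> 180 / (1 + t\<^sup>2)"
proof -
  have "fejer (2 * t) \<le> 1 / (1 + t\<^sup>2)"
    using fejer_le[of "2 * t"] by (rule order_trans) (auto intro!: divide_left_mono simp: add_pos_nonneg power_mult_distrib)
  then have "\<bar>vp t\<bar> \<le> 4 * (1 / (1 + t\<^sup>2)) + 1 / (1 + t\<^sup>2)"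
    using fejer_le[of t] fejer_nonneg[of t] fejer_nonneg[of "2 * t"] unfolding vp_def by linarith
  also have "\<dots> \<le> 180 / (1 + t\<^sup>2)" by (simp add: divide_simps add_pos_nonneg)
  finally show ?thesis .
qed

text \<open>The restriction \<open>\<bar>h\<bar> \<le> 1 / 2\<close>, present in all later
  estimates, comes from the doubled step in \<open>fejer (2 * t)\<close>. The constant is 4 * 40 +
  20.\<close>

lemma vp_shift:
  assumes "\<bar>h\<bar> \<le> 1 / 2"
  shows "\<bar>vp (t + h) - vp t\<bar> \<le> \<bar>h\<bar> * (180 / (1 + t\<^sup>2))"
proof -
  have "\<bar>fejer (2 * t + 2 * h) - fejer (2 * t)\<bar> \<le> 20 * \<bar>2 * h\<bar> / (1 + (2 * t)\<^sup>2)"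
    using assms by (intro fejer_shift) auto
  also have "\<dots> \<le> 40 * \<bar>h\<bar> / (1 + t\<^sup>2)"
    by (auto intro!: frac_le simp: add_pos_nonneg power_mult_distrib abs_mult)
  finally have 1: "\<bar>fejer (2 * t + 2 * h) - fejer (2 * t)\<bar> \<le> 40 * \<bar>h\<bar> / (1 + t\<^sup>2)" .
  have 2: "\<bar>fejer (t + h) - fejer t\<bar> \<le> 20 * \<bar>h\<bar> / (1 + t\<^sup>2)"
    using assms by (intro fejer_shift) auto
  have "\<bar>vp (t + h) - vp t\<bar> \<le> 4 * \<bar>fejer (2 * t + 2 * h) - fejer (2 * t)\<bar> + \<bar>fejer (t + h) - fejer t\<bar>"
  proof -
    have "\<bar>4 * a - b - (4 * c - d)\<bar> \<le> 4 * \<bar>a - c\<bar> + \<bar>b - d\<bar>" for a b c d :: real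
    proof -
      have "\<bar>4 * a - b - (4 * c - d)\<bar> = \<bar>4 * (a - c) - (b - d)\<bar>" by simp
      also have "\<dots> \<le> \<bar>4 * (a - c)\<bar> + \<bar>b - d\<bar>" by (rule abs_triangle_ineq4)
      also have "\<bar>4 * (a - c)\<bar> = 4 * \<bar>a - c\<bar>" by (simp only: abs_mult abs_numeral)
      finally show ?thesis .
    qed
    then show ?thesis unfolding vp_def distrib_left .
  qed
  also have "\<dots> \<le> 4 * (40 * \<bar>h\<bar> / (1 + t\<^sup>2)) + 20 * \<bar>h\<bar> / (1 + t\<^sup>2)"
    using 1 2 by (intro add_mono mult_left_mono) auto
  also have "\<dots> = \<bar>h\<bar> * (180 / (1 + t\<^sup>2))" by (simp add: field_simps)
  finally show ?thesis .
qed

text \<open>A shift along one axis changes a single factor, and the phase cancels the modulation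
  there; hence the bound is the same for all frequencies \<open>n\<close>.\<close>

lemma Vk_shift:
  fixes n :: "int^'d::finite"
  assumes h: "\<bar>h\<bar> \<le> 1 / 2"
  shows "norm (niexp (real_of_int (n $ j) * h) * Vk (rvec n) (s + axis j h) - Vk (rvec n) s)
    \<le> \<bar>h\<bar> * (\<Prod>i\<in>UNIV. 180 / (1 + (s $ i)\<^sup>2))"
proof -
  let ?e = "\<lambda>x. exp (\<i> * complex_of_real x)"
  have V: "Vk (rvec n) t = complex_of_real (vp (t $ j)) * ?e (real_of_int (n $ j) * t $ j)
    * (\<Prod>i\<in>UNIV - {j}. complex_of_real (vp (t $ i)) * ?e (real_of_int (n $ i) * t $ i))" for t
    unfolding Vk_def by (subst prod.remove[of _ j]) auto
  have "(\<Prod>i\<in>UNIV - {j}. complex_of_real (vp ((s + axis j h) $ i)) * ?e (real_of_int (n $ i) * (s + axis j h) $ i))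
    = (\<Prod>i\<in>UNIV - {j}. complex_of_real (vp (s $ i)) * ?e (real_of_int (n $ i) * s $ i))" (is "_ = ?P")
    by (rule prod.cong) (auto simp: axis_def)
  then have "niexp (real_of_int (n $ j) * h) * Vk (rvec n) (s + axis j h) - Vk (rvec n) s
    = complex_of_real (vp (s $ j + h) - vp (s $ j)) * ?e (real_of_int (n $ j) * s $ j) * ?P"
    unfolding V by (simp add: axis_def algebra_simps exp_add exp_minus)
  then have "norm (niexp (real_of_int (n $ j) * h) * Vk (rvec n) (s + axis j h) - Vk (rvec n) s)
    = \<bar>vp (s $ j + h) - vp (s $ j)\<bar> * norm ?P"
    by (simp only: norm_mult norm_exp_i_times norm_of_real)
  also have "\<dots> \<le> (\<bar>h\<bar> * (180 / (1 + (s $ j)\<^sup>2))) * (\<Prod>i\<in>UNIV - {j}. 180 / (1 + (s $ i)\<^sup>2))"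
  proof (intro mult_mono vp_shift[OF h])
    have "norm ?P = (\<Prod>i\<in>UNIV - {j}. \<bar>vp (s $ i)\<bar>)"
      by (simp only: prod_norm[symmetric] norm_mult norm_exp_i_times norm_of_real) simp
    also have "\<dots> \<le> (\<Prod>i\<in>UNIV - {j}. 180 / (1 + (s $ i)\<^sup>2))"
      by (intro prod_mono) (auto simp: vp_le)
    finally show "norm ?P \<le> (\<Prod>i\<in>UNIV - {j}. 180 / (1 + (s $ i)\<^sup>2))" .
  qed auto
  also have "\<dots> = \<bar>h\<bar> * (\<Prod>i\<in>UNIV. 180 / (1 + (s $ i)\<^sup>2))"
    by (subst prod.remove[of UNIV j]) auto
  finally show ?thesis .
qed

lemma phik_norm_le: "norm (phik n t) \<le> (\<Prod>i\<in>UNIV. 180 / (1 + (t $ i)\<^sup>2))"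
proof -
  have "norm (phik n t) = (\<Prod>i\<in>UNIV. fejer (t $ i))"
    by (simp add: phi_eq_prod prod_norm[symmetric] norm_mult fejer_nonneg del: of_real_mult)
  also have "\<dots> \<le> (\<Prod>i\<in>UNIV. 180 / (1 + (t $ i)\<^sup>2))"
  proof (intro prod_mono conjI fejer_nonneg)
    fix i show "fejer (t $ i) \<le> 180 / (1 + (t $ i)\<^sup>2)"
      by (rule order_trans[OF fejer_le]) (auto simp: divide_simps add_pos_nonneg)
  qed
  finally show ?thesis .
qed

lemma phi_in_L1: "0 < N \<Longrightarrow> phi N a \<in> L1"
  using fourier_pair_phi[of N a] by (simp add: L1_def fourier_pair_def)

lemma Vk_in_L1: "Vk a \<in> L1"
  using fourier_pair_Vk[of a] by (simp add: L1_def fourier_pair_def)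

lemma l1norm_phik_le: "l1norm (phik n :: real^'d::finite \<Rightarrow> complex) \<le> shift_const TYPE('d)"
  unfolding l1norm_def shift_const_def
  by (intro integral_mono shift_majorant_integrable phik_norm_le integrable_norm)
    (use phi_in_L1[of 1 "rvec n"] in \<open>simp add: L1_def\<close>)

section \<open>Approximation in the mean\<close>

lemma integral_lborel_affine:
  fixes f :: "'a::euclidean_space \<Rightarrow> 'b::{banach, second_countable_topology}"
  assumes [measurable]: "f \<in> borel_measurable borel" and c: "c \<noteq> 0"
  shows "(LBINT x. f x) = \<bar>c\<bar> ^ DIM('a) *\<^sub>R (LBINT x. f (t + c *\<^sub>R x))"
  by (subst lborel_affine[OF c, of t]) (simp add: integral_density integral_distr)

lemma nn_integral_lborel_translate:
  fixes f :: "'a::euclidean_space \<Rightarrow> ennreal"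
  assumes [measurable]: "f \<in> borel_measurable borel"
  shows "(\<integral>\<^sup>+x. f (a + x) \<partial>lborel) = (\<integral>\<^sup>+x. f x \<partial>lborel)"
proof -
  have "(\<integral>\<^sup>+x. f x \<partial>lborel) = (\<integral>\<^sup>+x. f x \<partial>distr lborel borel ((+) a))"
    by (simp only: lborel_distr_plus)
  also have "\<dots> = (\<integral>\<^sup>+x. f (a + x) \<partial>lborel)"
    by (subst nn_integral_distr) auto
  finally show ?thesis by simp
qed

lemma conv_in_L1:
  fixes f g :: "real^'d::finite \<Rightarrow> complex"
  assumes "f \<in> L1" "g \<in> L1"
  shows "conv f g \<in> L1"
proof -
  have f: "integrable lborel f" and g: "integrable lborel g" using assms by (auto simp: L1_def)
  have [measurable]: "f \<in> borel_measurable borel" "g \<in> borel_measurable borel" using f g by auto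
  have m: "conv f g \<in> borel_measurable borel" unfolding conv_def by measurable
  have "ennreal (norm (conv f g t)) \<le> (\<integral>\<^sup>+s. ennreal (norm (f s)) * ennreal (norm (g (t - s))) \<partial>lborel)" for t
  \<comment> \<open>Where the convolution integral does not exist it has the default value 0, for
    which the bound is trivial.\<close>
  proof (cases "integrable lborel (\<lambda>s. f s * g (t - s))")
    case True
    then show ?thesis
      unfolding conv_def using integral_norm_bound_ennreal[OF True] by (simp add: norm_mult ennreal_mult')
  qed (simp add: conv_def not_integrable_integral_eq)
  then have "(\<integral>\<^sup>+t. ennreal (norm (conv f g t)) \<partial>lborel)
    \<le> (\<integral>\<^sup>+t. \<integral>\<^sup>+s. ennreal (norm (f s)) * ennreal (norm (g (t - s))) \<partial>lborel \<partial>lborel)"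
    by (intro nn_integral_mono)
  also have "\<dots> = (\<integral>\<^sup>+s. \<integral>\<^sup>+t. ennreal (norm (f s)) * ennreal (norm (g (t - s))) \<partial>lborel \<partial>lborel)"
    by (rule lborel_pair.Fubini') measurable
  also have "\<dots> = (\<integral>\<^sup>+s. ennreal (norm (f s)) * (\<integral>\<^sup>+t. ennreal (norm (g (- s + t))) \<partial>lborel) \<partial>lborel)"
    by (intro nn_integral_cong) (simp add: nn_integral_cmult)
  also have "\<dots> = (\<integral>\<^sup>+s. ennreal (norm (f s)) * (\<integral>\<^sup>+t. ennreal (norm (g t)) \<partial>lborel) \<partial>lborel)"
    by (intro nn_integral_cong arg_cong2[where f="(*)"] refl nn_integral_lborel_translate[where f="\<lambda>t. ennreal (norm (g t))"]) measurable
  also have "\<dots> < \<infinity>"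
    using f g by (simp add: nn_integral_multc nn_integral_eq_integral ennreal_mult_less_top)
  finally show ?thesis using m by (auto simp: L1_def intro!: integrableI_bounded)
qed

text \<open>For positive \<open>k\<close> the radial retraction of the plane onto the disc of radius
  \<open>k\<close>. It makes continuous approximants bounded, keeps them continuous and does not
  move limits in the disc.\<close>

definition clamp_norm :: "real \<Rightarrow> complex \<Rightarrow> complex" where
  "clamp_norm k z = (k / max k (norm z)) *\<^sub>R z"

lemma clamp_norm_le: "0 < k \<Longrightarrow> norm (clamp_norm k z) \<le> k"
  unfolding clamp_norm_def by (auto simp: divide_simps max_def)

lemma clamp_norm_eq: "0 < k \<Longrightarrow> norm z \<le> k \<Longrightarrow> clamp_norm k z = z"
  unfolding clamp_norm_def by (simp add: max_def)

lemma continuous_clamp_norm: "0 < k \<Longrightarrow> isCont (clamp_norm k) z"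
  unfolding clamp_norm_def[abs_def] by (intro continuous_intros) (auto simp: max_def)

text \<open>Stated as domination by a multiple of the indicator of a ball, so that integrable
  majorants are at hand.\<close>

definition compactly_supported :: "('a::real_normed_vector \<Rightarrow> complex) \<Rightarrow> bool" where
  "compactly_supported g \<longleftrightarrow> continuous_on UNIV g \<and> (\<exists>k M. \<forall>t. norm (g t) \<le> M * indicator (cball 0 k) t)"

lemma integrable_indicator_cball: "integrable lborel (\<lambda>t::'a::euclidean_space. M * indicator (cball 0 k) t :: real)"
  by (intro integrable_mult_right integrable_real_indicator) (use emeasure_lborel_cball_finite in auto)

lemma compactly_supported_integrable:
  fixes g :: "'a::euclidean_space \<Rightarrow> complex"
  assumes "compactly_supported g"
  shows "integrable lborel g"
proof -
  obtain k M where b: "\<And>t. norm (g t) \<le> M * indicator (cball 0 k) t" and c: "continuous_on UNIV g"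
    using assms unfolding compactly_supported_def by blast
  have [measurable]: "g \<in> borel_measurable borel" using c by (rule borel_measurable_continuous_onI)
  show ?thesis
    by (rule Bochner_Integration.integrable_bound[OF integrable_indicator_cball[of M k]])
      (use b in \<open>auto intro!: order_trans[OF b]\<close>)
qed

text \<open>A measurable function is an almost everywhere limit of continuous ones. Clamping and a
  cutoff that is 1 on the ball carrying \<open>F\<close> preserve the limit and supply the majorant
  for dominated convergence.\<close>

lemma bounded_L1_approx:
  fixes F :: "real^'d::finite \<Rightarrow> complex"
  assumes F: "integrable lborel F" and k: "0 < k"
    and bd: "\<And>t. norm (F t) \<le> k" and supp: "\<And>t. k < norm t \<Longrightarrow> F t = 0" and eps: "0 < \<epsilon>"
  shows "\<exists>g. compactly_supported g \<and> (LBINT t. norm (g t - F t)) < \<epsilon>"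
proof -
  have [measurable]: "F \<in> borel_measurable borel" using F by auto
  have "F measurable_on UNIV"
    by (intro lebesgue_measurable_imp_measurable_on measurable_completion) auto
  then obtain N g where N: "negligible N" and g: "\<And>n. continuous_on UNIV (g n)"
    and lim: "\<And>x. x \<notin> N \<Longrightarrow> (\<lambda>n. g n x) \<longlonglongrightarrow> F x"
    unfolding measurable_on_def by (simp only: UNIV_I if_True) blast
  define cutoff where "cutoff t = max 0 (min 1 (k + 1 - norm t))" for t :: "real^'d"
  define G where "G n t = cutoff t *\<^sub>R clamp_norm k (g n t)" for n t
  have Gc: "continuous_on UNIV (G n)" for n
  proof -
    have "continuous_on UNIV (\<lambda>t. clamp_norm k (g n t))"
      using continuous_on_compose2[OF continuous_at_imp_continuous_on[of UNIV "clamp_norm k"] g[of n]]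
        continuous_clamp_norm[OF k] by blast
    then show ?thesis unfolding G_def cutoff_def by (intro continuous_intros)
  qed
  have Gb: "norm (G n t) \<le> k * indicator (cball 0 (k + 1)) t" for n t
  proof (cases "norm t \<le> k + 1")
    case True
    have "norm (G n t) \<le> 1 * k"
      unfolding G_def norm_scaleR by (intro mult_mono clamp_norm_le[OF k]) (auto simp: cutoff_def)
    then show ?thesis using True by simp
  next
    case False
    then have "cutoff t = 0" by (simp add: cutoff_def)
    then show ?thesis by (simp add: G_def k less_imp_le)
  qed
  have Gcs: "compactly_supported (G n)" for n
    unfolding compactly_supported_def using Gc Gb by blast
  have [measurable]: "G n \<in> borel_measurable borel" for n
    using Gc by (rule borel_measurable_continuous_onI)
  have "(\<lambda>n. \<integral>t. norm (G n t - F t) \<partial>lborel) \<longlonglongrightarrow> (\<integral>t. 0 \<partial>(lborel::(real^'d) measure))"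
  proof (rule integral_dominated_convergence)
    have "AE t in lebesgue. t \<notin> N"
      using N by (intro AE_not_in) (simp add: negligible_iff_null_sets)
    then have "AE t in lborel. t \<notin> N" by (simp add: AE_completion_iff)
    then show "AE t in lborel. (\<lambda>n. norm (G n t - F t)) \<longlonglongrightarrow> 0"
    proof eventually_elim
      fix t assume "t \<notin> N"
      then have "(\<lambda>n. clamp_norm k (g n t)) \<longlonglongrightarrow> clamp_norm k (F t)"
        using lim continuous_clamp_norm[OF k] isCont_tendsto_compose by blast
      then have "(\<lambda>n. G n t) \<longlonglongrightarrow> cutoff t *\<^sub>R F t"
        unfolding G_def using clamp_norm_eq[OF k bd] by (intro tendsto_intros) auto
      moreover have "cutoff t *\<^sub>R F t = F t"
        using supp[of t] by (cases "k < norm t") (auto simp: cutoff_def)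
      ultimately have "(\<lambda>n. norm (G n t - F t)) \<longlonglongrightarrow> norm (F t - F t)"
        by (intro tendsto_intros) auto
      then show "(\<lambda>n. norm (G n t - F t)) \<longlonglongrightarrow> 0" by simp
    qed
    show "integrable lborel (\<lambda>t. 2 * k * indicator (cball 0 (k + 1)) (t::real^'d))"
      by (rule integrable_indicator_cball)
    fix n
    have Fb: "norm (F t) \<le> k * indicator (cball 0 (k + 1)) t" for t
    proof (cases "norm t \<le> k + 1")
      case True
      then have "t \<in> cball 0 (k + 1)" by simp
      then show ?thesis using bd[of t] by (simp only: indicator_simps mult_1_right)
    next
      case False
      then have "F t = 0" by (intro supp) linarith
      then show ?thesis using k by (simp add: less_imp_le)
    qed
    show "AE t in lborel. norm (norm (G n t - F t)) \<le> 2 * k * indicator (cball 0 (k + 1)) t"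
    proof (rule AE_I2)
      fix t
      show "norm (norm (G n t - F t)) \<le> 2 * k * indicator (cball 0 (k + 1)) t"
        using norm_triangle_ineq4[of "G n t" "F t"] add_mono[OF Gb[of n t] Fb[of t]]
        by (simp only: real_norm_def abs_norm_cancel mult_2 distrib_right)
    qed
  qed auto
  then have "eventually (\<lambda>n. (LBINT t. norm (G n t - F t)) < \<epsilon>) sequentially"
    using eps by (intro order_tendstoD(2)) auto
  then show ?thesis using Gcs by (auto simp: eventually_sequentially)
qed

lemma L1_approx_compactly_supported:
  fixes f :: "real^'d::finite \<Rightarrow> complex"
  assumes f: "integrable lborel f" and eps: "0 < \<epsilon>"
  shows "\<exists>g. compactly_supported g \<and> (LBINT t. norm (g t - f t)) < \<epsilon>"
proof -
  have [measurable]: "f \<in> borel_measurable borel" using f by auto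
  define F where "F k t = (if norm (f t) \<le> real k \<and> norm t \<le> real k then f t else 0)" for k :: nat and t
  have [measurable]: "F k \<in> borel_measurable borel" for k unfolding F_def by measurable
  have Fi: "integrable lborel (F k)" for k
    by (rule Bochner_Integration.integrable_bound[OF f]) (auto simp: F_def)
  have "(\<lambda>k. \<integral>t. norm (F k t - f t) \<partial>lborel) \<longlonglongrightarrow> (\<integral>t. 0 \<partial>(lborel::(real^'d) measure))"
  proof (rule integral_dominated_convergence)
    show "AE t in lborel. (\<lambda>k. norm (F k t - f t)) \<longlonglongrightarrow> 0"
    proof (rule AE_I2)
      fix t
      obtain k0 where k0: "max (norm (f t)) (norm t) \<le> real k0" using real_arch_simple by blast
      have "F k t = f t" if "k \<ge> k0" for k
        using k0 of_nat_mono[OF that, where 'a=real] by (simp add: F_def)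
      then have "eventually (\<lambda>k. norm (F k t - f t) = 0) sequentially"
        by (intro eventually_sequentiallyI[of k0]) simp
      then show "(\<lambda>k. norm (F k t - f t)) \<longlonglongrightarrow> 0" by (rule tendsto_eventually)
    qed
    show "integrable lborel (\<lambda>t. norm (f t))" using f by simp
  qed (auto simp: F_def)
  then have "eventually (\<lambda>k. (LBINT t. norm (F k t - f t)) < \<epsilon> / 2) sequentially"
    using eps by (intro order_tendstoD(2)) auto
  \<comment> \<open>\<open>Suc k\<close> keeps the radius positive, as
    \<open>bounded_L1_approx\<close> requires.\<close>
  then obtain k where k: "(LBINT t. norm (F (Suc k) t - f t)) < \<epsilon> / 2"
    by (auto simp: eventually_sequentially intro: le_SucI)
  have "norm (F (Suc k) t) \<le> real (Suc k)" "real (Suc k) < norm t \<Longrightarrow> F (Suc k) t = 0" for t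
    by (auto simp: F_def)
  then obtain g where g: "compactly_supported g" "(LBINT t. norm (g t - F (Suc k) t)) < \<epsilon> / 2"
    using bounded_L1_approx[OF Fi[of "Suc k"], of "real (Suc k)" "\<epsilon> / 2"] eps by auto
  note gi = compactly_supported_integrable[OF g(1)]
  have tri: "norm (g t - f t) \<le> norm (g t - F (Suc k) t) + norm (F (Suc k) t - f t)" for t
    using norm_triangle_ineq[of "g t - F (Suc k) t" "F (Suc k) t - f t"] by simp
  have "(LBINT t. norm (g t - f t)) \<le> (LBINT t. norm (g t - F (Suc k) t) + norm (F (Suc k) t - f t))"
    by (intro integral_mono Bochner_Integration.integrable_add integrable_norm Bochner_Integration.integrable_diff gi Fi f tri)
  also have "\<dots> = (LBINT t. norm (g t - F (Suc k) t)) + (LBINT t. norm (F (Suc k) t - f t))"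
    by (intro Bochner_Integration.integral_add integrable_norm Bochner_Integration.integrable_diff gi Fi f)
  also have "\<dots> < \<epsilon>" using k g(2) by simp
  finally show ?thesis using g(1) by blast
qed

lemma compactly_supported_translation:
  fixes g :: "'a::euclidean_space \<Rightarrow> complex"
  assumes g: "compactly_supported g"
  shows "(\<lambda>N. \<integral>\<^sup>+t. ennreal (norm (g (t - (1 / real (Suc N)) *\<^sub>R u) - g t)) \<partial>lborel) \<longlonglongrightarrow> 0"
proof -
  let ?s = "\<lambda>N t. t - (1 / real (Suc N)) *\<^sub>R u"
  obtain k M where b: "\<And>t. norm (g t) \<le> M * indicator (cball 0 k) t" and c: "continuous_on UNIV g"
    using assms unfolding compactly_supported_def by blast
  have [measurable]: "g \<in> borel_measurable borel" using c by (rule borel_measurable_continuous_onI)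
  \<comment> \<open>All the shifts have length at most \<open>norm u\<close>, so that one enlarged
    ball serves for every \<open>N\<close>.\<close>
  define w where "w t = \<bar>M\<bar> * indicator (cball 0 (k + norm u)) t + \<bar>M\<bar> * indicator (cball 0 k) t" for t :: 'a
  have wi: "integrable lborel w"
    unfolding w_def[abs_def] by (intro Bochner_Integration.integrable_add integrable_indicator_cball)
  then have [measurable]: "w \<in> borel_measurable borel" by auto
  have "(\<lambda>N. \<integral>\<^sup>+t. ennreal (norm (g (?s N t) - g t)) \<partial>lborel) \<longlonglongrightarrow> (\<integral>\<^sup>+t. 0 \<partial>(lborel :: 'a measure))"
  proof (rule nn_integral_dominated_convergence)
    show "(\<integral>\<^sup>+t. ennreal (w t) \<partial>lborel) < \<infinity>"
      by (subst nn_integral_eq_integral[OF wi]) (auto simp: w_def)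
    have w: "norm (g (?s N t) - g t) \<le> w t" for N t
    proof -
            have "norm (g (?s N t)) \<le> \<bar>M\<bar> * indicator (cball 0 (k + norm u)) t"
      proof (cases "norm (?s N t) \<le> k")
        case True
        have "norm ((1 / real (Suc N)) *\<^sub>R u) \<le> norm u"
          using mult_left_mono[of 1 "1 + real N" "norm u"] by (simp add: divide_le_eq)
        then have "norm t \<le> k + norm u"
          using True norm_triangle_ineq[of "?s N t" "(1 / real (Suc N)) *\<^sub>R u"] by simp
        then show ?thesis using b[of "?s N t"] True by (simp split: split_indicator_asm)
      next
        case False
        then show ?thesis using b[of "?s N t"] by (simp split: split_indicator_asm)
      qed
      moreover have "norm (g t) \<le> \<bar>M\<bar> * indicator (cball 0 k) t"
        using b[of t] by (rule order_trans) (auto split: split_indicator)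
      ultimately show ?thesis
        unfolding w_def using norm_triangle_ineq4[of "g (?s N t)" "g t"] by linarith
    qed
    show "AE t in lborel. ennreal (norm (g (?s N t) - g t)) \<le> ennreal (w t)" for N
      by (intro AE_I2 ennreal_leI w)
    show "AE t in lborel. (\<lambda>N. ennreal (norm (g (?s N t) - g t))) \<longlonglongrightarrow> 0"
    proof (rule AE_I2)
      fix t
      have "(\<lambda>N. ?s N t) \<longlonglongrightarrow> t - 0 *\<^sub>R u"
        by (intro tendsto_intros LIMSEQ_Suc[OF lim_1_over_n])
      then have "(\<lambda>N. g (?s N t)) \<longlonglongrightarrow> g t"
        using c by (intro isCont_tendsto_compose[of t g]) (auto simp: continuous_on_eq_continuous_at)
      then have "(\<lambda>N. norm (g (?s N t) - g t)) \<longlonglongrightarrow> norm (g t - g t)"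
        by (intro tendsto_intros)
      then show "(\<lambda>N. ennreal (norm (g (?s N t) - g t))) \<longlonglongrightarrow> 0"
        using tendsto_ennrealI by fastforce
    qed
  qed auto
  then show ?thesis by simp
qed

section \<open>Dilated Fejer kernels as an approximate identity\<close>

definition fejer_kernel :: "real^'d \<Rightarrow> real" where "fejer_kernel u = (\<Prod>j\<in>UNIV. fejer (u $ j))"

lemma fejer_kernel_nonneg: "0 \<le> fejer_kernel u"
  unfolding fejer_kernel_def by (intro prod_nonneg) (simp add: fejer_nonneg)

lemma fejer_kernel_integrable: "integrable lborel (fejer_kernel :: real^'d::finite \<Rightarrow> real)"
  and integral_fejer_kernel: "(\<integral>u. fejer_kernel u \<partial>(lborel :: (real^'d::finite) measure)) = 1"
  using lborel_vec_integral_prod[of "\<lambda>_. fejer", OF fejer_integrable]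
  unfolding fejer_kernel_def[abs_def] by (auto simp: integral_fejer)

text \<open>The substitution s = t - u / (N + 1) trades the dilation of the kernel for a shrinking
  translation of \<open>g\<close>; the Jacobian cancels the normalising power.\<close>

lemma conv_dilated_fejer:
  fixes g :: "real^'d::finite \<Rightarrow> complex"
  assumes [measurable]: "g \<in> borel_measurable borel"
  shows "conv g (phi (real (Suc N)) 0) t = (LBINT u. fejer_kernel u *\<^sub>R g (t - (1 / real (Suc N)) *\<^sub>R u))"
proof -
  let ?N = "real (Suc N)"
  have ph: "phi ?N 0 s = complex_of_real (?N ^ CARD('d) * fejer_kernel (?N *\<^sub>R s))" for s :: "real^'d"
    by (simp add: phi_eq_prod fejer_kernel_def prod.distrib)
  have [measurable]: "fejer_kernel \<in> borel_measurable (borel :: (real^'d) measure)"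
    unfolding fejer_kernel_def by measurable
  have "conv g (phi ?N 0) t = (LBINT s. g s * complex_of_real (?N ^ CARD('d) * fejer_kernel (?N *\<^sub>R (t - s))))"
    unfolding conv_def ph by simp
  also have "\<dots> = \<bar>- (1 / ?N)\<bar> ^ CARD('d) *\<^sub>R (LBINT u. g (t + (- (1 / ?N)) *\<^sub>R u) *
      complex_of_real (?N ^ CARD('d) * fejer_kernel (?N *\<^sub>R (t - (t + (- (1 / ?N)) *\<^sub>R u)))))"
    by (subst integral_lborel_affine[where c="- (1 / ?N)" and t=t]) auto
  also have "\<dots> = (LBINT u. \<bar>- (1 / ?N)\<bar> ^ CARD('d) *\<^sub>R (g (t + (- (1 / ?N)) *\<^sub>R u) *
      complex_of_real (?N ^ CARD('d) * fejer_kernel (?N *\<^sub>R (t - (t + (- (1 / ?N)) *\<^sub>R u))))))"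
    by simp
  also have "\<dots> = (LBINT u. fejer_kernel u *\<^sub>R g (t - (1 / ?N) *\<^sub>R u))"
  proof (intro Bochner_Integration.integral_cong refl)
    fix u :: "real^'d"
    have "?N *\<^sub>R (t - (t + (- (1 / ?N)) *\<^sub>R u)) = u" by (simp del: of_nat_Suc)
    moreover have "\<bar>- (1 / ?N)\<bar> ^ CARD('d) * ?N ^ CARD('d) = 1"
      by (simp add: power_one_over del: of_nat_Suc flip: power_mult_distrib)
    ultimately show "\<bar>- (1 / ?N)\<bar> ^ CARD('d) *\<^sub>R (g (t + (- (1 / ?N)) *\<^sub>R u) *
        complex_of_real (?N ^ CARD('d) * fejer_kernel (?N *\<^sub>R (t - (t + (- (1 / ?N)) *\<^sub>R u)))))
      = fejer_kernel u *\<^sub>R g (t - (1 / ?N) *\<^sub>R u)"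
      by (simp only: scaleR_conv_of_real[where 'a=complex])
        (simp add: mult_ac del: of_nat_Suc of_real_mult of_real_power flip: mult.assoc of_real_mult)
  qed
  finally show ?thesis .
qed

text \<open>The distance in the mean is at most the average, under the Fejer kernel, of the
  translation moduli \<open>\<omega> N u\<close>. These tend to 0 for each \<open>u\<close> and are
  bounded by twice the norm of \<open>g\<close>, so dominated convergence applies.\<close>

lemma conv_dilated_fejer_tendsto:
  fixes g :: "real^'d::finite \<Rightarrow> complex"
  assumes g: "compactly_supported g"
  shows "(\<lambda>N. l1norm (\<lambda>t. conv g (phi (real (Suc N)) 0) t - g t)) \<longlonglongrightarrow> 0"
proof -
  let ?s = "\<lambda>N u t. t - (1 / real (Suc N)) *\<^sub>R u" and ?k = "\<lambda>u. ennreal (fejer_kernel u)" and ?L = "lborel :: (real^'d) measure"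
  note gi = compactly_supported_integrable[OF g]
  have gm[measurable]: "g \<in> borel_measurable borel" using gi by auto
  have km[measurable]: "fejer_kernel \<in> borel_measurable (borel :: (real^'d) measure)"
    unfolding fejer_kernel_def by measurable
  let ?c = "\<lambda>N. conv g (phi (real (Suc N)) 0)"
  define \<omega> where "\<omega> N u = (\<integral>\<^sup>+t. ennreal (norm (g (?s N u t) - g t)) \<partial>lborel)" for N u
  have \<omega>m[measurable]: "\<omega> N \<in> borel_measurable borel" for N
    unfolding \<omega>_def by measurable
  have \<omega>b: "\<omega> N u \<le> 2 * ennreal (l1norm g)" for N u
  proof -
    have "\<omega> N u \<le> (\<integral>\<^sup>+t. ennreal (norm (g (- (1 / real (Suc N)) *\<^sub>R u + t))) + ennreal (norm (g t)) \<partial>lborel)"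
      unfolding \<omega>_def
      by (intro nn_integral_mono) (simp add: norm_triangle_ineq4 flip: ennreal_plus)
    also have "\<dots> = (\<integral>\<^sup>+t. ennreal (norm (g (- (1 / real (Suc N)) *\<^sub>R u + t))) \<partial>lborel) + (\<integral>\<^sup>+t. ennreal (norm (g t)) \<partial>lborel)"
      by (rule nn_integral_add) auto
    also have "\<dots> = 2 * (\<integral>\<^sup>+t. ennreal (norm (g t)) \<partial>lborel)"
      by (subst nn_integral_lborel_translate[where f="\<lambda>t. ennreal (norm (g t))"]) (auto simp: mult_2)
    also have "(\<integral>\<^sup>+t. ennreal (norm (g t)) \<partial>lborel) = ennreal (l1norm g)"
      unfolding l1norm_def using gi by (intro nn_integral_eq_integral) auto
    finally show ?thesis .
  qed
  have bound: "(\<integral>\<^sup>+t. ennreal (norm (?c N t - g t)) \<partial>lborel) \<le> (\<integral>\<^sup>+u. ?k u * \<omega> N u \<partial>lborel)" for N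
  proof -
    have "ennreal (norm (?c N t - g t)) \<le> (\<integral>\<^sup>+u. ?k u * ennreal (norm (g (?s N u t) - g t)) \<partial>lborel)" for t
    proof -
      obtain k M where b: "\<And>t. norm (g t) \<le> M * indicator (cball 0 k) t"
        using assms unfolding compactly_supported_def by blast
      have b': "norm (g t) \<le> \<bar>M\<bar>" for t by (rule order_trans[OF b]) (auto split: split_indicator)
      have i1: "integrable lborel (\<lambda>u. fejer_kernel u *\<^sub>R g (?s N u t))"
        by (rule Bochner_Integration.integrable_bound[OF integrable_mult_right[OF fejer_kernel_integrable, of "\<bar>M\<bar>"]])
          (use b' in \<open>auto simp: fejer_kernel_nonneg mult.commute[of "fejer_kernel _"] intro!: AE_I2 mult_right_mono\<close>)
      have i2: "integrable lborel (\<lambda>u. fejer_kernel u *\<^sub>R g t)"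
        by (intro integrable_scaleR_left fejer_kernel_integrable)
      have "?c N t - g t = (LBINT u. fejer_kernel u *\<^sub>R g (?s N u t)) - (\<integral>u. fejer_kernel u *\<^sub>R g t \<partial>?L)"
        unfolding conv_dilated_fejer[OF gm]
        by (simp add: integral_scaleR_left[OF fejer_kernel_integrable] integral_fejer_kernel)
      also have "\<dots> = (LBINT u. fejer_kernel u *\<^sub>R (g (?s N u t) - g t))"
        unfolding scaleR_diff_right by (rule Bochner_Integration.integral_diff[OF i1 i2, symmetric])
      finally have e: "?c N t - g t = (LBINT u. fejer_kernel u *\<^sub>R (g (?s N u t) - g t))" .
      have "ennreal (norm (?c N t - g t)) \<le> (\<integral>\<^sup>+u. ennreal (norm (fejer_kernel u *\<^sub>R (g (?s N u t) - g t))) \<partial>lborel)"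
        unfolding e using Bochner_Integration.integrable_diff[OF i1 i2]
        by (intro integral_norm_bound_ennreal) (simp add: scaleR_diff_right)
      then show ?thesis by (simp add: fejer_kernel_nonneg ennreal_mult')
    qed
    then have "(\<integral>\<^sup>+t. ennreal (norm (?c N t - g t)) \<partial>lborel)
      \<le> (\<integral>\<^sup>+t. \<integral>\<^sup>+u. ?k u * ennreal (norm (g (?s N u t) - g t)) \<partial>lborel \<partial>lborel)"
      by (intro nn_integral_mono)
    also have "\<dots> = (\<integral>\<^sup>+u. \<integral>\<^sup>+t. ?k u * ennreal (norm (g (?s N u t) - g t)) \<partial>lborel \<partial>lborel)"
      by (rule lborel_pair.Fubini') measurable
    also have "\<dots> = (\<integral>\<^sup>+u. ?k u * \<omega> N u \<partial>lborel)"
      unfolding \<omega>_def by (intro nn_integral_cong nn_integral_cmult) measurable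
    finally show ?thesis .
  qed
  have dom: "(\<integral>\<^sup>+u. ?k u * (2 * ennreal (l1norm g)) \<partial>?L) < \<infinity>"
    by (subst nn_integral_multc)
      (auto simp: nn_integral_eq_integral[OF fejer_kernel_integrable] fejer_kernel_nonneg integral_fejer_kernel ennreal_mult_less_top)
  have "?c N \<in> L1" for N using gi by (intro conv_in_L1 phi_in_L1) (auto simp: L1_def)
  then have di: "integrable lborel (\<lambda>t. ?c N t - g t)" for N using gi by (simp add: L1_def del: of_nat_Suc)
  have "(\<lambda>N. \<integral>\<^sup>+u. ?k u * \<omega> N u \<partial>lborel) \<longlonglongrightarrow> (\<integral>\<^sup>+u. 0 \<partial>?L)"
  proof (rule nn_integral_dominated_convergence[where w="\<lambda>u. ?k u * (2 * ennreal (l1norm g))"])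
    show "(\<integral>\<^sup>+u. ?k u * (2 * ennreal (l1norm g)) \<partial>?L) < \<infinity>" by (rule dom)
    show "AE u in lborel. ?k u * \<omega> N u \<le> ?k u * (2 * ennreal (l1norm g))" for N
      by (intro AE_I2 mult_left_mono \<omega>b) auto
    show "AE u in lborel. (\<lambda>N. ?k u * \<omega> N u) \<longlonglongrightarrow> 0"
    proof (rule AE_I2)
      fix u :: "real^'d"
      have "(\<lambda>N. ?k u * \<omega> N u) \<longlonglongrightarrow> ?k u * 0"
        using compactly_supported_translation[OF g, of u] unfolding \<omega>_def
        by (intro ennreal_tendsto_cmult) auto
      then show "(\<lambda>N. ?k u * \<omega> N u) \<longlonglongrightarrow> 0" by simp
    qed
  qed auto
  then have "(\<lambda>N. \<integral>\<^sup>+u. ?k u * \<omega> N u \<partial>lborel) \<longlonglongrightarrow> 0" by simp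
  then have "(\<lambda>N. \<integral>\<^sup>+t. ennreal (norm (?c N t - g t)) \<partial>lborel) \<longlonglongrightarrow> 0"
    by (rule tendsto_sandwich[OF _ _ tendsto_const, rotated 2]) (auto simp del: of_nat_Suc intro!: always_eventually bound)
  moreover have "(\<integral>\<^sup>+t. ennreal (norm (?c N t - g t)) \<partial>lborel) = ennreal (l1norm (\<lambda>t. ?c N t - g t))" for N
    unfolding l1norm_def using di by (intro nn_integral_eq_integral) auto
  ultimately have "(\<lambda>N. ennreal (l1norm (\<lambda>t. ?c N t - g t))) \<longlonglongrightarrow> ennreal 0" by simp
  then show "(\<lambda>N. l1norm (\<lambda>t. ?c N t - g t)) \<longlonglongrightarrow> 0"
    by (subst (asm) tendsto_ennreal_iff) (auto simp: l1norm_def)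
qed

section \<open>Frequency components of operators\<close>

lemma scaleC_scaleR_commute: "c *\<^sub>C (r *\<^sub>R x) = r *\<^sub>R (c *\<^sub>C (x::'a::complex_normed_vector))"
  by (simp add: scaleR_scaleC scaleC_scaleC mult.commute)

lemma bounded_linear_scaleC: "bounded_linear (\<lambda>x::'a::complex_normed_vector. c *\<^sub>C x)"
  by (rule bounded_linear_intro[where K="cmod c"])
    (auto simp: scaleC_add_right scaleC_scaleR_commute norm_scaleC mult.commute)

lemma csc_apply: "blinfun_apply (csc c A) v = c *\<^sub>C blinfun_apply A v"
  unfolding csc_def
  by (subst bounded_linear_Blinfun_apply)
    (rule bounded_linear_compose[OF bounded_linear_scaleC blinfun.bounded_linear_right], rule refl)

lemma csc_in_CL [simp]: "A \<in> CL \<Longrightarrow> csc c A \<in> CL"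
  by (auto simp: CL_def csc_apply scaleC_scaleC mult.commute)

lemma scaleC_zero_right: "c *\<^sub>C (0::'a::complex_normed_vector) = 0"
  using scaleC_add_right[of c 0 "0::'a"] by simp

lemma zero_in_CL [simp]: "0 \<in> CL"
  by (simp add: CL_def scaleC_zero_right)

lemma id_in_CL [simp]: "id_blinfun \<in> CL" by (simp add: CL_def)

lemma add_in_CL [simp]: "A \<in> CL \<Longrightarrow> B \<in> CL \<Longrightarrow> A + B \<in> CL"
  by (auto simp: CL_def blinfun.bilinear_simps scaleC_add_right)

lemma csc_minus_one: "csc (- 1) A = - A"
proof (rule blinfun_eqI)
  fix v
  have "(-1 :: complex) *\<^sub>C x = - x" for x :: 'b
    using scaleR_scaleC[of "-1" x] by simp
  then show "csc (- 1) A v = (- A) v" by (simp add: csc_apply blinfun.bilinear_simps)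
qed

lemma uminus_in_CL [simp]: "A \<in> CL \<Longrightarrow> - A \<in> CL"
  using csc_in_CL[of A "-1"] by (simp add: csc_minus_one)

lemma diff_in_CL [simp]: "A \<in> CL \<Longrightarrow> B \<in> CL \<Longrightarrow> A - B \<in> CL"
  using add_in_CL[of A "- B"] by simp

lemma compose_in_CL [simp]: "A \<in> CL \<Longrightarrow> B \<in> CL \<Longrightarrow> A o\<^sub>L B \<in> CL"
  by (auto simp: CL_def)

lemma sum_in_CL: "(\<And>i. i \<in> F \<Longrightarrow> g i \<in> CL) \<Longrightarrow> sum g F \<in> CL"
  by (induction F rule: infinite_finite_induct) auto

lemma csc_add: "csc c (A + B) = csc c A + csc c B"
  by (rule blinfun_eqI) (simp add: csc_apply blinfun.bilinear_simps scaleC_add_right)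

lemma csc_add_left: "csc (a + b) A = csc a A + csc b A"
  by (rule blinfun_eqI) (simp add: csc_apply blinfun.bilinear_simps scaleC_add_left)

lemma csc_csc: "csc a (csc b A) = csc (a * b) A"
  by (rule blinfun_eqI) (simp add: csc_apply scaleC_scaleC)

lemma csc_uminus: "csc c (- A) = - csc c A"
  using csc_csc[of c "-1" A] csc_csc[of "-1" c A] by (simp add: csc_minus_one)

lemma csc_diff: "csc c (A - B) = csc c A - csc c B"
  using csc_add[of c A "- B"] by (simp add: csc_uminus)

lemma csc_one [simp]: "csc 1 A = A"
  by (rule blinfun_eqI) (simp add: csc_apply scaleC_one)

lemma csc_compose: "A \<in> CL \<Longrightarrow> csc (a * b) (A o\<^sub>L B) = csc a A o\<^sub>L csc b B"
  by (rule blinfun_eqI) (simp add: csc_apply CL_def scaleC_scaleC)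

lemma norm_csc_le: "norm (csc c A) \<le> cmod c * norm A"
proof (rule norm_blinfun_bound)
  fix v
  show "norm (csc c A v) \<le> cmod c * norm A * norm v"
    using mult_left_mono[OF norm_blinfun[of A v], of "cmod c"] by (simp add: csc_apply norm_scaleC mult.assoc)
qed simp

lemma norm_csc_unit:
  assumes "cmod c = 1"
  shows "norm (csc c A) = norm A"
proof (rule antisym)
  show "norm (csc c A) \<le> norm A" using norm_csc_le[of c A] assms by simp
  have "norm (csc (inverse c) (csc c A)) \<le> norm (csc c A)"
    using norm_csc_le[of "inverse c" "csc c A"] assms by (simp add: norm_inverse)
  moreover have "inverse c * c = 1" using assms by (intro left_inverse) auto
  ultimately show "norm A \<le> norm (csc c A)" by (simp add: csc_csc)
qed

lemma closed_CL: "closed (CL :: ('u::complex_normed_vector \<Rightarrow>\<^sub>L 'v::complex_normed_vector) set)"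
proof -
  have eq: "(CL :: ('u \<Rightarrow>\<^sub>L 'v) set) = (\<Inter>c. \<Inter>v. {A. blinfun_apply A (c *\<^sub>C v) = c *\<^sub>C blinfun_apply A v})"
    by (auto simp: CL_def)
  have cl: "closed {A :: 'u \<Rightarrow>\<^sub>L 'v. blinfun_apply A (c *\<^sub>C v) = c *\<^sub>C blinfun_apply A v}" for c v
    by (intro closed_Collect_eq linear_continuous_on blinfun.bounded_linear_left
        bounded_linear_compose[OF bounded_linear_scaleC])
  show ?thesis unfolding eq by (intro closed_INT ballI cl)
qed

lemma has_sum_in_CL:
  assumes "(g has_sum x) UNIV" "\<And>i. g i \<in> CL"
  shows "x \<in> CL"
proof (rule Lim_in_closed_set[OF closed_CL])
  show "(sum g \<longlongrightarrow> x) (finite_subsets_at_top UNIV)" using assms(1) by (simp add: has_sum_def)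
  show "\<forall>\<^sub>F F in finite_subsets_at_top UNIV. sum g F \<in> CL"
    using assms(2) by (intro always_eventually allI sum_in_CL)
qed simp

section \<open>Twisted translations and their differences\<close>

definition dif :: "('a \<Rightarrow> 'a::ab_group_add) \<Rightarrow> 'a \<Rightarrow> 'a" where "dif S X = S X - X"

text \<open>The weights \<open>s\<^sup>m / m!\<close> turn the Leibniz rule into a Cauchy product, which makes this quantity submultiplicative.\<close>

definition smooth_norm :: "('a \<Rightarrow> 'a::real_normed_vector) \<Rightarrow> real \<Rightarrow> nat \<Rightarrow> 'a \<Rightarrow> real" where
  "smooth_norm S s M X = (\<Sum>m\<le>M. s ^ m / fact m * norm ((dif S ^^ m) X))"

lemma smooth_norm_ge_term:
  assumes "0 \<le> s" "m \<le> M"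
  shows "s ^ m / fact m * norm ((dif S ^^ m) X) \<le> smooth_norm S s M X"
  unfolding smooth_norm_def using assms by (intro member_le_sum) auto

lemma norm_le_smooth_norm: "0 \<le> s \<Longrightarrow> norm X \<le> smooth_norm S s M X"
  using smooth_norm_ge_term[of s 0 M S X] by simp

text \<open>Translation by \<open>h\<close> along the axis \<open>j\<close>, divided by the phase it
  would have at the frequency \<open>\<nu>\<close>. A component of frequency \<open>\<nu>\<close> is
  therefore almost fixed for small \<open>h\<close>.\<close>

definition twist :: "(real^'d \<Rightarrow> ('u \<Rightarrow>\<^sub>L 'v) \<Rightarrow> ('u::complex_normed_vector \<Rightarrow>\<^sub>L 'v::complex_normed_vector))
    \<Rightarrow> int^'d \<Rightarrow> 'd \<Rightarrow> real \<Rightarrow> ('u \<Rightarrow>\<^sub>L 'v) \<Rightarrow> ('u \<Rightarrow>\<^sub>L 'v)" where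
  "twist T \<nu> j h X = csc (niexp (real_of_int (\<nu> $ j) * h)) (T (axis j h) X)"

locale cl_module =
  fixes act :: "(real^'d::finite \<Rightarrow> complex) \<Rightarrow> ('u::complex_normed_vector \<Rightarrow>\<^sub>L 'v::{complex_normed_vector,banach}) \<Rightarrow> ('u \<Rightarrow>\<^sub>L 'v)"
    and T :: "real^'d \<Rightarrow> ('u \<Rightarrow>\<^sub>L 'v) \<Rightarrow> ('u \<Rightarrow>\<^sub>L 'v)"
  assumes L1_mod: "L1_module CL csc act T"
begin

lemmas module_ax = L1_mod[unfolded L1_module_def]

lemmas act_ax = module_ax[THEN conjunct2, THEN conjunct2, THEN conjunct2, THEN conjunct2, THEN conjunct2, THEN conjunct2]

lemmas act_ax2 = act_ax[THEN conjunct2, THEN conjunct2, THEN conjunct2, THEN conjunct2, THEN conjunct2]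

lemma T_in_CL [simp]: "X \<in> CL \<Longrightarrow> T t X \<in> CL"
  using module_ax[THEN conjunct1] bij_betw_apply by metis

lemma T_onto: "Y \<in> CL \<Longrightarrow> \<exists>X\<in>CL. T t X = Y"
  using module_ax[THEN conjunct1] unfolding bij_betw_def by (metis imageE)

lemma T_add: "X \<in> CL \<Longrightarrow> Y \<in> CL \<Longrightarrow> T t (X + Y) = T t X + T t Y"
  using module_ax[THEN conjunct2, THEN conjunct1] by blast

lemma T_norm: "X \<in> CL \<Longrightarrow> norm (T t X) = norm X"
  using module_ax[THEN conjunct2, THEN conjunct2, THEN conjunct2, THEN conjunct1] by blast

lemma act_in_CL [simp]: "f \<in> L1 \<Longrightarrow> X \<in> CL \<Longrightarrow> act f X \<in> CL"
  using act_ax[THEN conjunct1] by blast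

lemma act_add_left: "f \<in> L1 \<Longrightarrow> g \<in> L1 \<Longrightarrow> X \<in> CL \<Longrightarrow> act (\<lambda>s. f s + g s) X = act f X + act g X"
  using act_ax[THEN conjunct2, THEN conjunct1] by blast

lemma act_cmult_left: "f \<in> L1 \<Longrightarrow> X \<in> CL \<Longrightarrow> act (\<lambda>s. c * f s) X = csc c (act f X)"
  using act_ax[THEN conjunct2, THEN conjunct2, THEN conjunct1] by blast

lemma act_add: "f \<in> L1 \<Longrightarrow> X \<in> CL \<Longrightarrow> Y \<in> CL \<Longrightarrow> act f (X + Y) = act f X + act f Y"
  using act_ax[THEN conjunct2, THEN conjunct2, THEN conjunct2, THEN conjunct1] by blast

lemma act_csc: "f \<in> L1 \<Longrightarrow> X \<in> CL \<Longrightarrow> act f (csc c X) = csc c (act f X)"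
  using act_ax[THEN conjunct2, THEN conjunct2, THEN conjunct2, THEN conjunct2, THEN conjunct1] by blast

lemma act_conv: "f \<in> L1 \<Longrightarrow> g \<in> L1 \<Longrightarrow> X \<in> CL \<Longrightarrow> act (conv f g) X = act f (act g X)"
  using act_ax2[THEN conjunct1] by blast

lemma norm_act_le: "f \<in> L1 \<Longrightarrow> X \<in> CL \<Longrightarrow> norm (act f X) \<le> l1norm f * norm X"
  using act_ax2[THEN conjunct2, THEN conjunct1] by blast

lemma T_act: "f \<in> L1 \<Longrightarrow> X \<in> CL \<Longrightarrow> T t (act f X) = act (\<lambda>s. f (s + t)) X"
  using act_ax2[THEN conjunct2, THEN conjunct2, THEN conjunct1] by blast

lemma T_act_commute: "f \<in> L1 \<Longrightarrow> X \<in> CL \<Longrightarrow> T t (act f X) = act f (T t X)"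
  using act_ax2[THEN conjunct2, THEN conjunct2, THEN conjunct1] by simp

lemma nondegenerate: "X \<in> CL \<Longrightarrow> (\<And>f. f \<in> L1 \<Longrightarrow> act f X = 0) \<Longrightarrow> X = 0"
  using act_ax2[THEN conjunct2, THEN conjunct2, THEN conjunct2, THEN conjunct1] by blast

lemma act_diff: "f \<in> L1 \<Longrightarrow> X \<in> CL \<Longrightarrow> Y \<in> CL \<Longrightarrow> act f (X - Y) = act f X - act f Y"
  using act_add[of f "X - Y" Y] by simp

lemma act_zero: "f \<in> L1 \<Longrightarrow> act f 0 = 0"
  using act_add[of f 0 0] by simp

lemma act_sum: "f \<in> L1 \<Longrightarrow> (\<And>i. i \<in> F \<Longrightarrow> g i \<in> CL) \<Longrightarrow> act f (sum g F) = (\<Sum>i\<in>F. act f (g i))"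
  by (induction F rule: infinite_finite_induct) (auto simp: act_zero act_add sum_in_CL)

lemma act_zero_left:
  assumes "X \<in> CL"
  shows "act (\<lambda>_. 0) X = 0"
proof -
  have "(\<lambda>_. 0) \<in> L1" by (simp add: L1_def)
  from act_add_left[OF this this assms] show ?thesis by simp
qed

lemma act_sum_left:
  assumes "X \<in> CL"
  shows "finite F \<Longrightarrow> (\<And>i. i \<in> F \<Longrightarrow> g i \<in> L1) \<Longrightarrow> act (\<lambda>t. \<Sum>i\<in>F. g i t) X = (\<Sum>i\<in>F. act (g i) X)"
proof (induction F rule: finite_induct)
  case (insert i F)
  then have "(\<lambda>t. \<Sum>i\<in>F. g i t) \<in> L1" "g i \<in> L1" by (auto simp: L1_def)
  then show ?case using insert act_add_left[of "g i" "\<lambda>t. \<Sum>i\<in>F. g i t" X] assms by simp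
qed (simp add: act_zero_left assms)

lemma act_diff_left:
  assumes "f \<in> L1" "g \<in> L1" "X \<in> CL"
  shows "act (\<lambda>s. f s - g s) X = act f X - act g X"
proof -
  have "(\<lambda>s. f s - g s) \<in> L1" using assms by (simp add: L1_def)
  from act_add_left[OF this assms(2,3)] show ?thesis by simp
qed

lemma act_has_sum:
  assumes g: "(g has_sum X) UNIV" "\<And>i. g i \<in> CL" and f: "f \<in> L1"
  shows "((\<lambda>i. act f (g i)) has_sum act f X) UNIV"
proof -
  have X: "X \<in> CL" using g by (rule has_sum_in_CL)
  have "((\<lambda>F. act f (sum g F)) \<longlongrightarrow> act f X) (finite_subsets_at_top UNIV)"
  proof (rule LIM_zero_cancel, rule Lim_null_comparison)
    show "\<forall>\<^sub>F F in finite_subsets_at_top UNIV. norm (act f (sum g F) - act f X) \<le> l1norm f * norm (sum g F - X)"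
      using norm_act_le[OF f, of "sum g _ - X"] g(2) X f
      by (intro always_eventually allI) (simp add: act_diff sum_in_CL)
    have "((\<lambda>F. l1norm f * norm (sum g F - X)) \<longlongrightarrow> l1norm f * norm (X - X)) (finite_subsets_at_top UNIV)"
      using g(1) unfolding has_sum_def by (intro tendsto_intros)
    then show "((\<lambda>F. l1norm f * norm (sum g F - X)) \<longlongrightarrow> 0) (finite_subsets_at_top UNIV)" by simp
  qed
  moreover have "act f (sum g F) = (\<Sum>i\<in>F. act f (g i))" for F using f g(2) by (intro act_sum)
  ultimately show ?thesis unfolding has_sum_def by simp
qed

lemma norm_act_phik_le: "X \<in> CL \<Longrightarrow> norm (act (phik n) X) \<le> shift_const TYPE('d) * norm X"
  by (rule order_trans[OF norm_act_le mult_right_mono[OF l1norm_phik_le]]) (auto simp: phi_in_L1)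

lemma twist_in_CL [simp]: "X \<in> CL \<Longrightarrow> twist T \<nu> j h X \<in> CL"
  by (simp add: twist_def)

lemma twist_add: "X \<in> CL \<Longrightarrow> Y \<in> CL \<Longrightarrow> twist T \<nu> j h (X + Y) = twist T \<nu> j h X + twist T \<nu> j h Y"
  by (simp add: twist_def T_add csc_add)

lemma twist_norm: "X \<in> CL \<Longrightarrow> norm (twist T \<nu> j h X) = norm X"
  unfolding twist_def by (subst norm_csc_unit) (auto simp: T_norm)

lemma act_twist: "f \<in> L1 \<Longrightarrow> X \<in> CL \<Longrightarrow> act f (twist T \<nu> j h X) = twist T \<nu> j h (act f X)"
  by (simp add: twist_def act_csc T_act_commute)

lemma dif_pow_in_CL [simp]: "X \<in> CL \<Longrightarrow> (dif (twist T \<nu> j h) ^^ m) X \<in> CL"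
  by (induction m) (auto simp: dif_def)

lemma act_dif: "f \<in> L1 \<Longrightarrow> X \<in> CL \<Longrightarrow> act f (dif (twist T \<nu> j h) X) = dif (twist T \<nu> j h) (act f X)"
  by (simp add: dif_def act_diff act_twist)

lemma act_dif_pow: "f \<in> L1 \<Longrightarrow> X \<in> CL \<Longrightarrow> act f ((dif (twist T \<nu> j h) ^^ m) X) = (dif (twist T \<nu> j h) ^^ m) (act f X)"
  by (induction m) (auto simp: act_dif)

text \<open>The component \<open>phik n x\<close> is reproduced by the smooth kernel \<open>Vk n\<close>, so that translating it
  by \<open>h\<close> moves it by \<open>O(|h|)\<close> relative to its own norm, up to the phase of the frequency \<open>n\<close>.\<close>

lemma norm_dif_twist_phik_same:
  assumes X: "X \<in> CL" and h: "\<bar>h\<bar> \<le> 1 / 2"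
  shows "norm (dif (twist T n j h) (act (phik n) X)) \<le> shift_const TYPE('d) * \<bar>h\<bar> * norm (act (phik n) X)"
proof -
  let ?y = "act (phik n) X" and ?e = "niexp (real_of_int (n $ j) * h)"
  let ?V = "Vk (rvec n) :: real^'d \<Rightarrow> complex"
  let ?W = "\<lambda>s. ?e * ?V (s + axis j h) - ?V s"
  have y: "?y \<in> CL" using X by (simp add: phi_in_L1)
  have rep: "act ?V ?y = ?y"
    using act_conv[OF Vk_in_L1 phi_in_L1 X, of 1 "rvec n" "rvec n"] conv_Vk_phik[of n] by simp
  have Vi: "integrable lborel ?V" using Vk_in_L1[of "rvec n"] by (simp add: L1_def)
  then have Vm[measurable]: "?V \<in> borel_measurable borel" by auto
  have "integrable (distr lborel borel ((+) (axis j h))) ?V" using Vi by (simp add: lborel_distr_plus)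
  then have "integrable lborel (\<lambda>s. ?V (axis j h + s))"
    by (subst (asm) integrable_distr_eq) auto
  then have Ws: "(\<lambda>s. ?V (s + axis j h)) \<in> L1" by (simp add: L1_def add.commute)
  then have eW: "(\<lambda>s. ?e * ?V (s + axis j h)) \<in> L1" by (simp add: L1_def)
  have W: "?W \<in> L1" using eW Vi by (simp add: L1_def)
  have "twist T n j h ?y = csc ?e (act (\<lambda>s. ?V (s + axis j h)) ?y)"
    unfolding twist_def using T_act[OF Vk_in_L1[of "rvec n"] y, of "axis j h"] rep by simp
  also have "\<dots> = act (\<lambda>s. ?e * ?V (s + axis j h)) ?y"
    using act_cmult_left[OF Ws y] by simp
  finally have "dif (twist T n j h) ?y = act (\<lambda>s. ?e * ?V (s + axis j h)) ?y - act ?V ?y"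
    unfolding dif_def rep by simp
  also have "\<dots> = act ?W ?y" by (rule act_diff_left[OF eW Vk_in_L1 y, symmetric])
  finally have "norm (dif (twist T n j h) ?y) \<le> l1norm ?W * norm ?y"
    using norm_act_le[OF W y] by simp
  also have "l1norm ?W \<le> (\<integral>s. \<bar>h\<bar> * (\<Prod>i\<in>UNIV. 180 / (1 + (s $ i)\<^sup>2)) \<partial>(lborel :: (real^'d) measure))"
    unfolding l1norm_def using W
    by (intro integral_mono Vk_shift[OF h] integrable_norm integrable_mult_right shift_majorant_integrable) (simp add: L1_def)
  also have "\<dots> = shift_const TYPE('d) * \<bar>h\<bar>" by (simp add: shift_const_def)
  finally show ?thesis by (simp add: mult_right_mono)
qed

text \<open>Changing the reference frequency from \<open>n\<close> to \<open>\<nu>\<close>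
  multiplies the twisted translation by a unit scalar that differs from 1 by at most
  \<open>\<bar>n $ j - \<nu> $ j\<bar> * \<bar>h\<bar>\<close>.\<close>

lemma norm_dif_twist_phik:
  assumes X: "X \<in> CL" and h: "\<bar>h\<bar> \<le> 1 / 2"
  shows "norm (dif (twist T \<nu> j h) (act (phik n) X))
    \<le> (shift_const TYPE('d) + \<bar>real_of_int (n $ j - \<nu> $ j)\<bar>) * \<bar>h\<bar> * norm (act (phik n) X)"
proof -
  let ?y = "act (phik n) X" and ?c = "iexp (real_of_int (n $ j - \<nu> $ j) * h)"
  have y: "?y \<in> CL" using X by (simp add: phi_in_L1)
  have "niexp (real_of_int (\<nu> $ j) * h) = ?c * niexp (real_of_int (n $ j) * h)"
    by (simp add: exp_add[symmetric] algebra_simps)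
  then have "twist T \<nu> j h ?y = csc ?c (twist T n j h ?y)"
    by (simp add: twist_def csc_csc)
  then have "dif (twist T \<nu> j h) ?y = csc ?c (dif (twist T n j h) ?y) + csc (?c - 1) ?y"
    using csc_add_left[of "?c - 1" 1 ?y] by (simp add: dif_def csc_diff)
  then have "norm (dif (twist T \<nu> j h) ?y) \<le> norm (csc ?c (dif (twist T n j h) ?y)) + norm (csc (?c - 1) ?y)"
    using norm_triangle_ineq by metis
  also have "\<dots> \<le> norm (dif (twist T n j h) ?y) + cmod (?c - 1) * norm ?y"
    by (intro add_mono norm_csc_le) (subst norm_csc_unit, auto)
  also have "\<dots> \<le> shift_const TYPE('d) * \<bar>h\<bar> * norm ?y + \<bar>real_of_int (n $ j - \<nu> $ j) * h\<bar> * norm ?y"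
    using iexp_approx1[of "real_of_int (n $ j - \<nu> $ j) * h" 0]
    by (intro add_mono mult_right_mono norm_dif_twist_phik_same[OF X h]) auto
  also have "\<dots> = (shift_const TYPE('d) + \<bar>real_of_int (n $ j - \<nu> $ j)\<bar>) * \<bar>h\<bar> * norm ?y"
    by (simp only: abs_mult distrib_right mult.assoc)
  finally show ?thesis .
qed

text \<open>Differences commute with the action, so each further one is again applied to a component
  at \<open>n\<close>, namely that of a differenced operator; this is what lets the first-order
  bound be iterated.\<close>

lemma norm_dif_pow_twist_phik:
  assumes X: "X \<in> CL" and h: "\<bar>h\<bar> \<le> 1 / 2"
  shows "norm ((dif (twist T \<nu> j h) ^^ m) (act (phik n) X))
    \<le> ((shift_const TYPE('d) + \<bar>real_of_int (n $ j - \<nu> $ j)\<bar>) * \<bar>h\<bar>) ^ m * norm (act (phik n) X)"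
proof (induction m)
  case (Suc m)
  let ?D = "dif (twist T \<nu> j h)" and ?K = "(shift_const TYPE('d) + \<bar>real_of_int (n $ j - \<nu> $ j)\<bar>) * \<bar>h\<bar>"
  have p: "phik n \<in> L1" by (simp add: phi_in_L1)
  have "norm ((?D ^^ Suc m) (act (phik n) X)) = norm (?D (act (phik n) ((?D ^^ m) X)))"
    by (simp add: act_dif_pow[OF p X])
  also have "\<dots> \<le> ?K * norm (act (phik n) ((?D ^^ m) X))"
    by (rule norm_dif_twist_phik[OF dif_pow_in_CL[OF X] h])
  also have "\<dots> = ?K * norm ((?D ^^ m) (act (phik n) X))"
    by (simp add: act_dif_pow[OF p X])
  also have "\<dots> \<le> ?K * (?K ^ m * norm (act (phik n) X))"
    by (intro mult_left_mono Suc.IH mult_nonneg_nonneg add_nonneg_nonneg shift_const_nonneg) auto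
  finally show ?case by simp
qed simp

text \<open>For the step \<open>h = \<pi> / (n\<^sub>j - \<nu>\<^sub>j)\<close> the phase of the translation at the frequency \<open>n\<close>, relative to \<open>\<nu>\<close>,
  is \<open>-1\<close>: the twisted difference almost doubles the component at \<open>n\<close>.\<close>

lemma norm_phik_le_dif:
  assumes X: "X \<in> CL" and h: "\<bar>h\<bar> \<le> 1 / 2" and hp: "real_of_int (n $ j - \<nu> $ j) * h = pi"
    and small: "shift_const TYPE('d) * \<bar>h\<bar> \<le> 1"
  shows "norm (act (phik n) X) \<le> norm (act (phik n) (dif (twist T \<nu> j h) X))"
proof -
  let ?y = "act (phik n) X"
  have y: "?y \<in> CL" using X by (simp add: phi_in_L1)
  have ph: "niexp (real_of_int (\<nu> $ j) * h) = - niexp (real_of_int (n $ j) * h)"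
  proof -
    have "real_of_int (\<nu> $ j) * h = real_of_int (n $ j) * h - pi" using hp by (simp add: algebra_simps)
    then have "niexp (real_of_int (\<nu> $ j) * h)
      = niexp (real_of_int (n $ j) * h) * exp (\<i> * complex_of_real pi)"
      by (simp add: exp_add[symmetric] right_diff_distrib del: exp_pi_i exp_pi_i')
    then show ?thesis by (simp add: exp_pi_i')
  qed
  have "csc (- c) Y = - csc c Y" for c and Y :: "'u \<Rightarrow>\<^sub>L 'v"
    using csc_csc[of "-1" c Y] by (simp add: csc_minus_one)
  then have "twist T \<nu> j h ?y = - twist T n j h ?y"
    unfolding twist_def ph by blast
  then have "dif (twist T \<nu> j h) ?y + dif (twist T n j h) ?y = - (2 *\<^sub>R ?y)"
    by (simp add: dif_def scaleR_2)
  then have "2 * norm ?y = norm (dif (twist T \<nu> j h) ?y + dif (twist T n j h) ?y)" by simp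
  also have "\<dots> \<le> norm (dif (twist T \<nu> j h) ?y) + norm (dif (twist T n j h) ?y)"
    by (rule norm_triangle_ineq)
  also have "norm (dif (twist T n j h) ?y) \<le> shift_const TYPE('d) * \<bar>h\<bar> * norm ?y"
    by (rule norm_dif_twist_phik_same[OF X h])
  also have "\<dots> \<le> 1 * norm ?y" by (intro mult_right_mono small) simp
  finally show ?thesis using X by (simp add: act_dif phi_in_L1)
qed

lemma norm_phik_le_dif_pow:
  assumes X: "X \<in> CL" and h: "\<bar>h\<bar> \<le> 1 / 2" and hp: "real_of_int (n $ j - \<nu> $ j) * h = pi"
    and small: "shift_const TYPE('d) * \<bar>h\<bar> \<le> 1"
  shows "norm (act (phik n) X) \<le> norm (act (phik n) ((dif (twist T \<nu> j h) ^^ m) X))"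
proof (induction m)
  case (Suc m)
  then show ?case
    using norm_phik_le_dif[OF dif_pow_in_CL[OF X] h hp small, where m1=m] by (auto intro: order_trans)
qed simp

text \<open>Smoothness turns into decay: the \<open>M\<close>-th difference controls the component
  at \<open>n\<close>, and its weight in \<open>smooth_norm\<close> yields the power of the step.
  The second summand of the constant covers the frequencies near \<open>\<mu>\<close>, where the
  trivial bound is enough.\<close>

lemma phik_decay:
  assumes X: "X \<in> CL" and \<delta>: "0 < \<delta>"
    and w: "\<And>j h. h \<noteq> 0 \<Longrightarrow> \<bar>h\<bar> \<le> 1 / 2 \<Longrightarrow> smooth_norm (twist T \<mu> j h) (\<delta> / \<bar>h\<bar>) M X \<le> w"
  defines "C \<equiv> shift_const TYPE('d)"
  shows "norm (act (phik n) X)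
    \<le> w * (C * (fact M * (2 * pi / \<delta>) ^ M + (1 + 2 * pi + C * pi) ^ M) / (1 + real_of_int (supnorm (n - \<mu>))) ^ M)"
proof -
  have C: "0 \<le> C" unfolding C_def by (rule shift_const_nonneg)
  define L where "L = real_of_int (supnorm (n - \<mu>))"
  have L0: "0 \<le> L" unfolding L_def by (simp add: supnorm_nonneg)
  \<comment> \<open>Any admissible step and direction will do, because the term of order 0 is
    \<open>norm X\<close>.\<close>
  have Xw: "norm X \<le> w"
    using w[of "1/2" undefined] norm_le_smooth_norm[of "\<delta> / (1/2)" X "twist T \<mu> undefined (1/2)" M] \<delta> by simp
  then have w0: "0 \<le> w" using norm_ge_zero order_trans by blast
  show ?thesis
  \<comment> \<open>With a step of modulus \<pi> / L the two conditions say that the step is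
    admissible and that \<open>C * \<bar>h\<bar> \<le> 1\<close>.\<close>
  proof (cases "2 * pi \<le> L \<and> C * pi \<le> L")
    case True
    obtain j where j: "supnorm (n - \<mu>) = \<bar>(n - \<mu>) $ j\<bar>" using supnorm_attained by blast
    define k where "k = real_of_int (n $ j - \<mu> $ j)"
    have k: "\<bar>k\<bar> = L" unfolding L_def k_def j by simp
    have Lp: "6 \<le> L" using True pi_gt3 by linarith
    then have k0: "k \<noteq> 0" using k by auto
    define h where "h = pi / k"
    have habs: "\<bar>h\<bar> = pi / L" unfolding h_def using k by simp
    have h: "\<bar>h\<bar> \<le> 1 / 2" unfolding habs using True Lp by (simp add: divide_simps)
    have h0: "h \<noteq> 0" unfolding h_def using k0 by simp
    have "norm (act (phik n) X) \<le> norm (act (phik n) ((dif (twist T \<mu> j h) ^^ M) X))"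
    proof (rule norm_phik_le_dif_pow[OF X h])
      show "real_of_int (n $ j - \<mu> $ j) * h = pi" using k0 unfolding h_def k_def by simp
      show "shift_const TYPE('d) * \<bar>h\<bar> \<le> 1"
        unfolding habs using True Lp by (simp add: divide_simps C_def)
    qed
    also have "\<dots> \<le> C * norm ((dif (twist T \<mu> j h) ^^ M) X)"
      unfolding C_def by (rule norm_act_phik_le) (simp add: X)
    also have "norm ((dif (twist T \<mu> j h) ^^ M) X) \<le> w * (fact M * (\<bar>h\<bar> / \<delta>) ^ M)"
    proof -
      have "(\<delta> / \<bar>h\<bar>) ^ M / fact M * norm ((dif (twist T \<mu> j h) ^^ M) X) \<le> w"
        using w[OF h0 h, of j] smooth_norm_ge_term[of "\<delta> / \<bar>h\<bar>" M M "twist T \<mu> j h" X] \<delta> by simp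
      then show ?thesis using \<delta> h0 by (simp add: field_simps power_divide)
    qed
    also have "(\<bar>h\<bar> / \<delta>) ^ M \<le> (2 * pi / \<delta> / (1 + L)) ^ M"
    proof (rule power_mono)
      \<comment> \<open>The factor 2 replaces L by 1 + L, which makes the bound uniform down to L =
        0.\<close>
      have "pi / L \<le> 2 * pi / (1 + L)" using Lp by (simp add: field_simps)
      then have "pi / L / \<delta> \<le> 2 * pi / (1 + L) / \<delta>" using \<delta> by (intro divide_right_mono) auto
      then show "\<bar>h\<bar> / \<delta> \<le> 2 * pi / \<delta> / (1 + L)" unfolding habs by (simp add: mult.commute)
    qed (use \<delta> in simp)
    also have "(2 * pi / \<delta> / (1 + L)) ^ M = (2 * pi / \<delta>) ^ M / (1 + L) ^ M" by (rule power_divide)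
    finally have "norm (act (phik n) X) \<le> C * (w * (fact M * ((2 * pi / \<delta>) ^ M / (1 + L) ^ M)))"
      using C w0 by (simp add: mult_left_mono)
    also have "\<dots> = w * (C * (fact M * (2 * pi / \<delta>) ^ M) / (1 + L) ^ M)" by simp
    also have "\<dots> \<le> w * (C * (fact M * (2 * pi / \<delta>) ^ M + (1 + 2 * pi + C * pi) ^ M) / (1 + L) ^ M)"
      using C w0 L0 by (intro mult_left_mono divide_right_mono) auto
    finally show ?thesis unfolding L_def .
  next
    case False
    have "C * pi \<ge> 0" using C by simp
    then have "1 + L \<le> 1 + 2 * pi + C * pi" using False pi_gt_zero by linarith
    then have "(1 + L) ^ M \<le> (1 + 2 * pi + C * pi) ^ M" using L0 by (intro power_mono) auto
    then have D: "1 \<le> (1 + 2 * pi + C * pi) ^ M / (1 + L) ^ M" using L0 by (simp add: add_pos_nonneg)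
    have "norm (act (phik n) X) \<le> C * norm X" unfolding C_def by (rule norm_act_phik_le[OF X])
    also have "\<dots> \<le> C * w * 1" using Xw C by (simp add: mult_left_mono)
    also have "\<dots> \<le> C * w * ((1 + 2 * pi + C * pi) ^ M / (1 + L) ^ M)"
      using D C w0 by (intro mult_left_mono) auto
    also have "\<dots> = w * (C * ((1 + 2 * pi + C * pi) ^ M) / (1 + L) ^ M)" by simp
    also have "\<dots> \<le> w * (C * (fact M * (2 * pi / \<delta>) ^ M + (1 + 2 * pi + C * pi) ^ M) / (1 + L) ^ M)"
      using C w0 L0 \<delta> by (intro mult_left_mono divide_right_mono) auto
    finally show ?thesis unfolding L_def .
  qed
qed

section \<open>Reconstruction of an operator from its components\<close>

lemma act_phi_decompose:
  assumes X: "X \<in> CL" and N: "0 < N" "N \<le> real L" "N *\<^sub>R a = rvec m"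
  shows "act (phi N a) X = (\<Sum>n\<in>{n. supnorm (n - m) \<le> int L}. act (phi N a) (act (phik n) X))"
proof -
  have L1: "conv (phi N a) (phik n) \<in> L1" for n
    by (intro conv_in_L1 phi_in_L1 N(1)) simp
  have "act (phi N a) X = act (\<lambda>t. \<Sum>n\<in>{n. supnorm (n - m) \<le> int L}. conv (phi N a) (phik n) t) X"
    by (simp only: sum_conv_phi[OF N])
  also have "\<dots> = (\<Sum>n\<in>{n. supnorm (n - m) \<le> int L}. act (conv (phi N a) (phik n)) X)"
    by (rule act_sum_left[OF X finite_supnorm_diff_le L1])
  also have "\<dots> = (\<Sum>n\<in>{n. supnorm (n - m) \<le> int L}. act (phi N a) (act (phik n) X))"
    using X N by (intro sum.cong refl act_conv phi_in_L1) auto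
  finally show ?thesis .
qed

text \<open>Each kernel \<open>phi N 0\<close> with positive integer \<open>N\<close> splits into
  finitely many \<open>phik\<close>, so it annihilates \<open>X\<close>. These kernels form an
  approximate identity, whence every continuous function of bounded support annihilates
  \<open>X\<close>, then by density every integrable one, and non-degeneracy concludes.\<close>

lemma phik_separating:
  assumes X: "X \<in> CL" and z: "\<And>n. act (phik n) X = 0"
  shows "X = 0"
proof (rule nondegenerate[OF X])
  fix f :: "real^'d \<Rightarrow> complex" assume f: "f \<in> L1"
  have K: "act (phi (real (Suc N)) 0) X = 0" for N
  proof -
    have "real (Suc N) *\<^sub>R 0 = (rvec 0 :: real^'d)" by (simp add: vec_eq_iff)
    from act_phi_decompose[OF X _ _ this, of "Suc N"] z show ?thesis
      by (simp add: act_zero phi_in_L1)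
  qed
  have cs: "act g X = 0" if g: "compactly_supported g" for g
  proof -
    have gL: "g \<in> L1" using compactly_supported_integrable[OF g] by (simp add: L1_def)
    have "norm (act g X) \<le> l1norm (\<lambda>t. conv g (phi (real (Suc N)) 0) t - g t) * norm X" for N
    proof -
      let ?c = "conv g (phi (real (Suc N)) 0)"
      have cL: "?c \<in> L1" using gL by (intro conv_in_L1 phi_in_L1) auto
      have "act ?c X = 0" using act_conv[OF gL phi_in_L1 X] K act_zero[OF gL] by simp
      then have "norm (act g X) = norm (act (\<lambda>t. ?c t - g t) X)" by (simp add: act_diff_left[OF cL gL X] del: of_nat_Suc)
      also have "\<dots> \<le> l1norm (\<lambda>t. ?c t - g t) * norm X"
        using cL gL by (intro norm_act_le X) (simp add: L1_def)
      finally show ?thesis .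
    qed
    moreover have "(\<lambda>N. l1norm (\<lambda>t. conv g (phi (real (Suc N)) 0) t - g t) * norm X) \<longlonglongrightarrow> 0 * norm X"
      by (intro tendsto_mult_right conv_dilated_fejer_tendsto[OF g])
    ultimately have "norm (act g X) \<le> 0 * norm X"
      by (intro LIMSEQ_le_const[of _ "0 * norm X" "norm (act g X)"]) auto
    then show ?thesis by simp
  qed
  show "act f X = 0"
  proof (rule ccontr)
    assume nz: "act f X \<noteq> 0"
    define \<epsilon> where "\<epsilon> = norm (act f X) / (1 + norm X)"
    have e: "0 < \<epsilon>" unfolding \<epsilon>_def using nz by (simp add: add_pos_nonneg)
    obtain g where g: "compactly_supported g" "(LBINT t. norm (g t - f t)) < \<epsilon>"
      using L1_approx_compactly_supported[OF _ e, of f] f by (auto simp: L1_def)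
    have gL: "g \<in> L1" using compactly_supported_integrable[OF g(1)] by (simp add: L1_def)
    have "norm (act f X) = norm (act (\<lambda>t. g t - f t) X)"
      using act_diff_left[OF gL f X] cs[OF g(1)] by simp
    also have "\<dots> \<le> l1norm (\<lambda>t. g t - f t) * norm X"
      using f gL by (intro norm_act_le X) (simp add: L1_def)
    also have "\<dots> \<le> \<epsilon> * norm X" using g(2) by (intro mult_right_mono) (auto simp: l1norm_def)
    also have "\<dots> < \<epsilon> * (1 + norm X)" using e by simp
    also have "\<dots> = norm (act f X)" unfolding \<epsilon>_def by (simp add: add_pos_nonneg less_imp_neq[symmetric])
    finally show False by simp
  qed
qed

text \<open>Absolute summability yields only some limit \<open>S\<close>. A component of
  \<open>S\<close> involves just the neighbouring terms, so it agrees with that of the original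
  operator, and separation identifies the two.\<close>

lemma phik_has_sum:
  assumes A: "A \<in> CL" and fin: "(\<integral>\<^sup>+n. ennreal (norm (act (phik n) A)) \<partial>count_space UNIV) < \<infinity>"
  shows "((\<lambda>n. act (phik n) A) has_sum A) UNIV"
proof -
  have p: "phik n \<in> L1" for n :: "int^'d" by (simp add: phi_in_L1)
  have "(\<lambda>n. act (phik n) A) abs_summable_on UNIV"
  proof (rule nonneg_bdd_above_summable_on)
    show "bdd_above (sum (\<lambda>n. norm (act (phik n) A)) ` {F. F \<subseteq> UNIV \<and> finite F})"
    proof (rule bdd_aboveI2)
      fix F :: "(int^'d) set" assume "F \<in> {F. F \<subseteq> UNIV \<and> finite F}"
      then have "ennreal (\<Sum>n\<in>F. norm (act (phik n) A)) \<le> (\<integral>\<^sup>+n. ennreal (norm (act (phik n) A)) \<partial>count_space UNIV)"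
        unfolding nn_integral_count_space_SUP_finite by (subst sum_ennreal[symmetric]) (auto intro!: SUP_upper)
      then show "(\<Sum>n\<in>F. norm (act (phik n) A)) \<le> enn2real (\<integral>\<^sup>+n. ennreal (norm (act (phik n) A)) \<partial>count_space UNIV)"
        using fin enn2real_mono by (fastforce simp: sum_nonneg)
    qed
  qed simp
  then have "(\<lambda>n. act (phik n) A) summable_on UNIV" by (rule abs_summable_summable)
  then obtain S where S: "((\<lambda>n. act (phik n) A) has_sum S) UNIV" by (auto simp: summable_on_def)
  have SC: "S \<in> CL" by (rule has_sum_in_CL[OF S]) (simp add: p A)
  have "act (phik m) S = act (phik m) A" for m
  proof -
    have 1: "((\<lambda>n. act (phik m) (act (phik n) A)) has_sum act (phik m) S) UNIV"
      by (rule act_has_sum[OF S _ p]) (simp add: p A)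
    have z: "act (phik m) (act (phik n) A) = 0" if "n \<notin> {n. supnorm (n - m) \<le> int 1}" for n
      using act_conv[OF p p A, of m n] conv_phik_eq_0[of n m] that A by (simp add: act_zero_left)
    have "act (phik m) A = (\<Sum>n\<in>{n. supnorm (n - m) \<le> int 1}. act (phik m) (act (phik n) A))"
      by (rule act_phi_decompose[OF A]) auto
    moreover have "((\<lambda>n. act (phik m) (act (phik n) A)) has_sum
        (\<Sum>n\<in>{n. supnorm (n - m) \<le> int 1}. act (phik m) (act (phik n) A))) UNIV"
      by (rule has_sum_finite_neutralI) (use z finite_supnorm_diff_le in auto)
    ultimately show ?thesis using 1 has_sum_unique by metis
  qed
  then have "act (phik m) (S - A) = 0" for m using SC A p by (simp add: act_diff)
  then have "S - A = 0" using phik_separating[of "S - A"] SC A by simp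
  then show ?thesis using S by simp
qed

end

section \<open>Leibniz rule for twisted differences\<close>

lemma blinfun_compose_assoc: "(A o\<^sub>L B) o\<^sub>L C = A o\<^sub>L (B o\<^sub>L C)"
  by (rule blinfun_eqI) simp

lemma blinfun_compose_id [simp]: "id_blinfun o\<^sub>L A = A" "A o\<^sub>L id_blinfun = A"
  by (rule blinfun_eqI, simp)+

lemma neumann_series:
  fixes X :: "'a::banach \<Rightarrow>\<^sub>L 'a"
  assumes X: "norm X \<le> 1 / 2"
  shows "\<exists>S. S o\<^sub>L (id_blinfun - X) = id_blinfun \<and> (id_blinfun - X) o\<^sub>L S = id_blinfun \<and> norm S \<le> 2"
proof -
  define p where "p k = (((o\<^sub>L) X) ^^ k) id_blinfun" for k
  have p0: "p 0 = id_blinfun" and pS: "p (Suc k) = X o\<^sub>L p k" for k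
    by (auto simp: p_def)
  have pS': "p k o\<^sub>L X = p (Suc k)" for k
    by (induction k) (auto simp: p0 pS blinfun_compose_assoc)
  have np: "norm (p k) \<le> (1 / 2) ^ k" for k
  proof (induction k)
    case 0
    then show ?case by (simp add: p0 norm_blinfun_id_le)
  next
    case (Suc k)
    have "norm (p (Suc k)) \<le> norm X * norm (p k)" unfolding pS by (rule norm_blinfun_compose)
    also have "\<dots> \<le> (1 / 2) * (1 / 2) ^ k" by (intro mult_mono X Suc) auto
    finally show ?case by simp
  qed
  have g: "summable (\<lambda>k. (1 / 2 :: real) ^ k)" by (rule summable_geometric) simp
  have sp: "summable p" by (rule summable_comparison_test'[OF g, of 0]) (rule np)
  define S where "S = suminf p"
  have "X o\<^sub>L S = (\<Sum>k. X o\<^sub>L p k)"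
    unfolding S_def by (rule bounded_linear.suminf[OF bounded_bilinear.bounded_linear_right[OF bounded_bilinear_blinfun_compose] sp])
  also have "\<dots> = S - id_blinfun" unfolding S_def using suminf_split_head[OF sp] by (simp add: pS p0)
  finally have 1: "X o\<^sub>L S = S - id_blinfun" .
  have "S o\<^sub>L X = (\<Sum>k. p k o\<^sub>L X)"
    unfolding S_def by (rule bounded_linear.suminf[OF bounded_bilinear.bounded_linear_left[OF bounded_bilinear_blinfun_compose] sp])
  also have "\<dots> = S - id_blinfun" unfolding S_def pS' using suminf_split_head[OF sp] by (simp add: p0)
  finally have 2: "S o\<^sub>L X = S - id_blinfun" .
  have "norm S \<le> (\<Sum>k. (1 / 2 :: real) ^ k)" unfolding S_def by (rule norm_suminf_le[OF np g])
  also have "\<dots> = 2" by (subst suminf_geometric) auto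
  finally have 3: "norm S \<le> 2" .
  have "S o\<^sub>L (id_blinfun - X) = S - (S o\<^sub>L X)" "(id_blinfun - X) o\<^sub>L S = S - (X o\<^sub>L S)"
    by (rule blinfun_eqI, simp add: blinfun.bilinear_simps)+
  then show ?thesis using 1 2 3 by auto
qed

text \<open>Factor A - R as A (1 - B R) and invert the second factor. The bound does not mention
  \<open>R\<close>, so it will hold uniformly in the cutoff.\<close>

lemma perturbed_inverse:
  fixes A R :: "'x::{complex_normed_vector,banach} \<Rightarrow>\<^sub>L 'y::{complex_normed_vector,banach}"
  assumes inv: "mutually_inverse A B" and small: "norm B * norm R \<le> 1 / 2"
  shows "\<exists>B'. (A - R) o\<^sub>L B' = id_blinfun \<and> B' o\<^sub>L (A - R) = id_blinfun \<and> norm B' \<le> 2 * norm B"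
proof -
  have AB: "A o\<^sub>L B = id_blinfun" and BA: "B o\<^sub>L A = id_blinfun" using inv by (auto simp: mutually_inverse_def)
  have "norm (B o\<^sub>L R) \<le> 1 / 2" using norm_blinfun_compose[of B R] small by linarith
  then obtain S where S: "S o\<^sub>L (id_blinfun - (B o\<^sub>L R)) = id_blinfun" "(id_blinfun - (B o\<^sub>L R)) o\<^sub>L S = id_blinfun" "norm S \<le> 2"
    using neumann_series by blast
  have AB': "blinfun_apply A (blinfun_apply B v) = v" for v using AB by (metis blinfun_apply_blinfun_compose blinfun_apply_id_blinfun id_apply)
  have AR: "A - R = A o\<^sub>L (id_blinfun - (B o\<^sub>L R))"
    by (rule blinfun_eqI) (simp add: blinfun.bilinear_simps AB')
  have AR': "B o\<^sub>L (A - R) = id_blinfun - (B o\<^sub>L R)"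
  proof -
    have "B o\<^sub>L (A - R) = (B o\<^sub>L A) - (B o\<^sub>L R)" by (rule blinfun_eqI) (simp add: blinfun.bilinear_simps)
    then show ?thesis by (simp add: BA)
  qed
  have "(A - R) o\<^sub>L (S o\<^sub>L B) = A o\<^sub>L ((id_blinfun - (B o\<^sub>L R)) o\<^sub>L S) o\<^sub>L B"
    unfolding AR by (simp only: blinfun_compose_assoc)
  also have "\<dots> = id_blinfun" unfolding S(2) by (simp add: AB)
  finally have 1: "(A - R) o\<^sub>L (S o\<^sub>L B) = id_blinfun" .
  have "(S o\<^sub>L B) o\<^sub>L (A - R) = S o\<^sub>L (B o\<^sub>L (A - R))" by (simp only: blinfun_compose_assoc)
  also have "\<dots> = id_blinfun" unfolding AR' by (rule S(1))
  finally have 2: "(S o\<^sub>L B) o\<^sub>L (A - R) = id_blinfun" .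
  have "norm (S o\<^sub>L B) \<le> norm S * norm B" by (rule norm_blinfun_compose)
  also have "\<dots> \<le> 2 * norm B" using S(3) by (intro mult_right_mono) auto
  finally show ?thesis using 1 2 by blast
qed

lemma inverse_in_CL:
  assumes "A \<in> CL" "A o\<^sub>L B = id_blinfun" "B o\<^sub>L A = id_blinfun"
  shows "B \<in> CL"
proof -
  have AB: "blinfun_apply A (blinfun_apply B v) = v" for v using assms(2) by (metis blinfun_apply_blinfun_compose blinfun_apply_id_blinfun id_apply)
  have BA: "blinfun_apply B (blinfun_apply A v) = v" for v using assms(3) by (metis blinfun_apply_blinfun_compose blinfun_apply_id_blinfun id_apply)
  have "blinfun_apply B (c *\<^sub>C v) = c *\<^sub>C blinfun_apply B v" for c v
  proof -
    have "blinfun_apply B (c *\<^sub>C v) = blinfun_apply B (c *\<^sub>C blinfun_apply A (blinfun_apply B v))" by (simp add: AB)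
    also have "\<dots> = blinfun_apply B (blinfun_apply A (c *\<^sub>C blinfun_apply B v))" using assms(1) by (simp add: CL_def)
    finally show ?thesis by (simp add: BA)
  qed
  then show ?thesis by (simp add: CL_def)
qed

text \<open>What the Leibniz rule uses of a twisted translation, demanded only on \<open>CL\<close>,
  where the module axioms hold. Three such maps occur together, one for each factor and one for the
  product.\<close>

definition additive_isometry_on_CL :: "(('u \<Rightarrow>\<^sub>L 'v) \<Rightarrow> ('u::complex_normed_vector \<Rightarrow>\<^sub>L 'v::complex_normed_vector)) \<Rightarrow> bool" where
  "additive_isometry_on_CL S \<longleftrightarrow> (\<forall>X\<in>CL. S X \<in> CL \<and> norm (S X) = norm X) \<and> (\<forall>X\<in>CL. \<forall>Y\<in>CL. S (X + Y) = S X + S Y)"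

context
  fixes S :: "('u \<Rightarrow>\<^sub>L 'v) \<Rightarrow> ('u::complex_normed_vector \<Rightarrow>\<^sub>L 'v::complex_normed_vector)"
  assumes S: "additive_isometry_on_CL S"
begin

lemma isometry_in_CL: "X \<in> CL \<Longrightarrow> S X \<in> CL"
  and isometry_norm: "X \<in> CL \<Longrightarrow> norm (S X) = norm X"
  and isometry_add: "X \<in> CL \<Longrightarrow> Y \<in> CL \<Longrightarrow> S (X + Y) = S X + S Y"
  using S unfolding additive_isometry_on_CL_def by auto

lemma isometry_diff: "X \<in> CL \<Longrightarrow> Y \<in> CL \<Longrightarrow> S (X - Y) = S X - S Y"
  using isometry_add[of "X - Y" Y] by simp

lemma isometry_pow_in_CL: "X \<in> CL \<Longrightarrow> (S ^^ m) X \<in> CL"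
  by (induction m) (auto simp: isometry_in_CL)

lemma isometry_pow_norm: "X \<in> CL \<Longrightarrow> norm ((S ^^ m) X) = norm X"
  by (induction m) (auto simp: isometry_norm isometry_pow_in_CL)

lemma dif_isometry_in_CL: "X \<in> CL \<Longrightarrow> dif S X \<in> CL"
  by (simp add: dif_def isometry_in_CL)

lemma dif_isometry_pow_in_CL: "X \<in> CL \<Longrightarrow> (dif S ^^ m) X \<in> CL"
  by (induction m) (auto simp: dif_isometry_in_CL)

lemma dif_isometry_add: "X \<in> CL \<Longrightarrow> Y \<in> CL \<Longrightarrow> dif S (X + Y) = dif S X + dif S Y"
  by (simp add: dif_def isometry_add)

lemma dif_isometry_pow_add: "X \<in> CL \<Longrightarrow> Y \<in> CL \<Longrightarrow> (dif S ^^ m) (X + Y) = (dif S ^^ m) X + (dif S ^^ m) Y"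
  by (induction m) (auto simp: dif_isometry_add dif_isometry_pow_in_CL)

lemma dif_isometry_pow_zero: "(dif S ^^ m) 0 = 0"
  using dif_isometry_pow_add[of 0 0 m] by simp

lemma dif_isometry_pow_sum:
  "(\<And>i. i \<in> F \<Longrightarrow> g i \<in> CL) \<Longrightarrow> (dif S ^^ m) (sum g F) = (\<Sum>i\<in>F. (dif S ^^ m) (g i))"
  by (induction F rule: infinite_finite_induct) (auto simp: dif_isometry_pow_zero dif_isometry_pow_add sum_in_CL)

lemma dif_isometry_pow_commute: "X \<in> CL \<Longrightarrow> (dif S ^^ m) (S X) = S ((dif S ^^ m) X)"
  by (induction m) (auto simp: dif_def[of S] isometry_diff dif_isometry_pow_in_CL isometry_in_CL)

end

context
  fixes S1 :: "('v \<Rightarrow>\<^sub>L 'w) \<Rightarrow> ('v::complex_normed_vector \<Rightarrow>\<^sub>L 'w::complex_normed_vector)"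
    and S2 :: "('u \<Rightarrow>\<^sub>L 'v) \<Rightarrow> ('u::complex_normed_vector \<Rightarrow>\<^sub>L 'v)"
    and S3 :: "('u \<Rightarrow>\<^sub>L 'w) \<Rightarrow> ('u \<Rightarrow>\<^sub>L 'w)"
  assumes S1: "additive_isometry_on_CL S1" and S2: "additive_isometry_on_CL S2" and S3: "additive_isometry_on_CL S3"
    and mult: "\<And>A B. A \<in> CL \<Longrightarrow> B \<in> CL \<Longrightarrow> S3 (B o\<^sub>L A) = S1 B o\<^sub>L S2 A"
begin

text \<open>Iterates D(BA) = (DB)(SA) + B(DA). The translate left on the second factor commutes with
  the differences, and Pascal's rule collects the terms.\<close>

lemma dif_pow_Leibniz:
  "A \<in> CL \<Longrightarrow> B \<in> CL \<Longrightarrow>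
    (dif S3 ^^ m) (B o\<^sub>L A) = (\<Sum>i\<le>m. real (m choose i) *\<^sub>R ((dif S1 ^^ i) B o\<^sub>L (S2 ^^ i) ((dif S2 ^^ (m - i)) A)))"
proof (induction m arbitrary: A B)
  case (Suc m)
  define t where "t i = (dif S1 ^^ i) B o\<^sub>L (S2 ^^ i) ((dif S2 ^^ (Suc m - i)) A)" for i
  have A: "A \<in> CL" "S2 A \<in> CL" "dif S2 A \<in> CL" and B: "B \<in> CL" "dif S1 B \<in> CL"
    using Suc.prems isometry_in_CL[OF S2] dif_isometry_in_CL[OF S1] dif_isometry_in_CL[OF S2] by auto
  have "dif S3 (B o\<^sub>L A) = (dif S1 B o\<^sub>L S2 A) + (B o\<^sub>L dif S2 A)"
    unfolding dif_def mult[OF A(1) B(1)] by (rule blinfun_eqI) (simp add: blinfun.bilinear_simps)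
  then have "(dif S3 ^^ Suc m) (B o\<^sub>L A) = (dif S3 ^^ m) (dif S1 B o\<^sub>L S2 A) + (dif S3 ^^ m) (B o\<^sub>L dif S2 A)"
    using dif_isometry_pow_add[OF S3, of "dif S1 B o\<^sub>L S2 A" "B o\<^sub>L dif S2 A" m] A B
    by (simp add: funpow_swap1)
  also have "(dif S3 ^^ m) (dif S1 B o\<^sub>L S2 A) = (\<Sum>i\<le>m. real (m choose i) *\<^sub>R t (Suc i))"
    unfolding Suc.IH[OF A(2) B(2)] t_def
    using A(1) by (intro sum.cong refl) (simp add: dif_isometry_pow_commute[OF S2] funpow_swap1)
  also have "(dif S3 ^^ m) (B o\<^sub>L dif S2 A) = (\<Sum>i\<le>m. real (m choose i) *\<^sub>R t i)"
    unfolding Suc.IH[OF A(3) B(1)] t_def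
    by (intro sum.cong refl) (simp add: Suc_diff_le funpow_swap1)
  also have "(\<Sum>i\<le>m. real (m choose i) *\<^sub>R t i) = (\<Sum>i\<le>Suc m. real (m choose i) *\<^sub>R t i)" by simp
  also have "\<dots> = t 0 + (\<Sum>i\<le>m. real (m choose Suc i) *\<^sub>R t (Suc i))"
    by (subst sum.atMost_Suc_shift) simp
  also have "(\<Sum>i\<le>m. real (m choose i) *\<^sub>R t (Suc i)) + (t 0 + (\<Sum>i\<le>m. real (m choose Suc i) *\<^sub>R t (Suc i)))
    = t 0 + (\<Sum>i\<le>m. real (Suc m choose Suc i) *\<^sub>R t (Suc i))"
    by (simp add: scaleR_add_left sum.distrib)
  also have "\<dots> = (\<Sum>i\<le>Suc m. real (Suc m choose i) *\<^sub>R t i)"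
    by (subst sum.atMost_Suc_shift) simp
  finally show ?case unfolding t_def .
qed simp

text \<open>The binomial coefficient splits the weight of order \<open>m\<close> into those of
  orders \<open>i\<close> and \<open>m - i\<close>; the translate on the second factor is an
  isometry and costs nothing.\<close>

lemma norm_Leibniz_term:
  assumes "A \<in> CL" "B \<in> CL" "i \<le> m"
  shows "s ^ m / fact m * norm (real (m choose i) *\<^sub>R ((dif S1 ^^ i) B o\<^sub>L (S2 ^^ i) ((dif S2 ^^ (m - i)) A)))
    \<le> (\<bar>s\<bar> ^ i / fact i * norm ((dif S1 ^^ i) B)) * (\<bar>s\<bar> ^ (m - i) / fact (m - i) * norm ((dif S2 ^^ (m - i)) A))"
proof -
  have c: "\<bar>s\<bar> ^ m / fact m * real (m choose i) = (\<bar>s\<bar> ^ i / fact i) * (\<bar>s\<bar> ^ (m - i) / fact (m - i))"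
    using assms(3) by (simp add: binomial_fact power_add[symmetric])
  have "s ^ m / fact m * norm (real (m choose i) *\<^sub>R ((dif S1 ^^ i) B o\<^sub>L (S2 ^^ i) ((dif S2 ^^ (m - i)) A)))
    \<le> \<bar>s\<bar> ^ m / fact m * (real (m choose i) * (norm ((dif S1 ^^ i) B) * norm ((dif S2 ^^ (m - i)) A)))"
  proof (intro mult_mono divide_right_mono)
    show "s ^ m \<le> \<bar>s\<bar> ^ m" by (metis abs_ge_self power_abs)
    have "norm ((dif S1 ^^ i) B o\<^sub>L (S2 ^^ i) ((dif S2 ^^ (m - i)) A)) \<le> norm ((dif S1 ^^ i) B) * norm ((dif S2 ^^ (m - i)) A)"
      using norm_blinfun_compose[of "(dif S1 ^^ i) B" "(S2 ^^ i) ((dif S2 ^^ (m - i)) A)"]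
      by (simp add: isometry_pow_norm[OF S2 dif_isometry_pow_in_CL[OF S2 assms(1)]])
    then show "norm (real (m choose i) *\<^sub>R ((dif S1 ^^ i) B o\<^sub>L (S2 ^^ i) ((dif S2 ^^ (m - i)) A)))
      \<le> real (m choose i) * (norm ((dif S1 ^^ i) B) * norm ((dif S2 ^^ (m - i)) A))"
      by (simp add: mult_left_mono)
  qed auto
  also have "\<dots> = (\<bar>s\<bar> ^ m / fact m * real (m choose i)) * (norm ((dif S1 ^^ i) B) * norm ((dif S2 ^^ (m - i)) A))" by simp
  also have "\<dots> = (\<bar>s\<bar> ^ i / fact i * norm ((dif S1 ^^ i) B)) * (\<bar>s\<bar> ^ (m - i) / fact (m - i) * norm ((dif S2 ^^ (m - i)) A))"
    unfolding c by (simp only: mult_ac)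
  finally show ?thesis .
qed

end

lemma triangle_sum_le_product:
  fixes a b :: "nat \<Rightarrow> real"
  assumes "\<And>i. 0 \<le> a i" "\<And>i. 0 \<le> b i"
  shows "(\<Sum>m\<le>M. \<Sum>i\<le>m. a i * b (m - i)) \<le> (\<Sum>i\<le>M. a i) * (\<Sum>i\<le>M. b i)"
proof -
  have "(\<Sum>m\<le>M. \<Sum>i\<le>m. a i * b (m - i)) = (\<Sum>(i,j)\<in>{(i,j). i + j \<le> M}. a i * b j)"
    by (rule sum.triangle_reindex_eq[symmetric])
  also have "\<dots> \<le> (\<Sum>(i,j)\<in>{..M} \<times> {..M}. a i * b j)"
    by (rule sum_mono2) (auto simp: assms)
  also have "\<dots> = (\<Sum>i\<le>M. a i) * (\<Sum>i\<le>M. b i)"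
    by (simp add: sum_product sum.cartesian_product)
  finally show ?thesis .
qed

lemma smooth_norm_compose:
  assumes S: "additive_isometry_on_CL S1" "additive_isometry_on_CL S2" "additive_isometry_on_CL S3"
    and mult: "\<And>A B. A \<in> CL \<Longrightarrow> B \<in> CL \<Longrightarrow> S3 (B o\<^sub>L A) = S1 B o\<^sub>L S2 A"
    and AB: "A \<in> CL" "B \<in> CL" and s: "0 \<le> s"
  shows "smooth_norm S3 s M (B o\<^sub>L A) \<le> smooth_norm S1 s M B * smooth_norm S2 s M A"
proof -
  let ?b = "\<lambda>i. s ^ i / fact i * norm ((dif S1 ^^ i) B)" and ?a = "\<lambda>i. s ^ i / fact i * norm ((dif S2 ^^ i) A)"
  have "smooth_norm S3 s M (B o\<^sub>L A) \<le> (\<Sum>m\<le>M. \<Sum>i\<le>m. ?b i * ?a (m - i))"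
    unfolding smooth_norm_def
  proof (rule sum_mono)
    fix m
    have L: "(dif S3 ^^ m) (B o\<^sub>L A) = (\<Sum>i\<le>m. real (m choose i) *\<^sub>R ((dif S1 ^^ i) B o\<^sub>L (S2 ^^ i) ((dif S2 ^^ (m - i)) A)))"
      by (rule dif_pow_Leibniz[OF S mult AB])
    have "s ^ m / fact m * norm ((dif S3 ^^ m) (B o\<^sub>L A))
      \<le> s ^ m / fact m * (\<Sum>i\<le>m. norm (real (m choose i) *\<^sub>R ((dif S1 ^^ i) B o\<^sub>L (S2 ^^ i) ((dif S2 ^^ (m - i)) A))))"
      unfolding L using s by (intro mult_left_mono norm_sum) auto
    also have "\<dots> \<le> (\<Sum>i\<le>m. ?b i * ?a (m - i))"
      unfolding sum_distrib_left using norm_Leibniz_term[OF S mult AB, of _ m s] s by (intro sum_mono) auto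
    finally show "s ^ m / fact m * norm ((dif S3 ^^ m) (B o\<^sub>L A)) \<le> (\<Sum>i\<le>m. ?b i * ?a (m - i))" .
  qed
  also have "\<dots> \<le> (\<Sum>i\<le>M. ?b i) * (\<Sum>i\<le>M. ?a i)"
    using s by (intro triangle_sum_le_product) auto
  finally show ?thesis unfolding smooth_norm_def .
qed

text \<open>The Leibniz rule for the constant \<open>A o\<^sub>L B = id_blinfun\<close> solves recursively for the differences of \<open>B\<close>;
  only the differences of positive order of \<open>A\<close> need to be small.\<close>

lemma smooth_norm_inverse:
  assumes S: "additive_isometry_on_CL S1" "additive_isometry_on_CL S2" "additive_isometry_on_CL S3"
    and mult: "\<And>A B. A \<in> CL \<Longrightarrow> B \<in> CL \<Longrightarrow> S3 (B o\<^sub>L A) = S1 B o\<^sub>L S2 A" and id: "S3 id_blinfun = id_blinfun"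
    and AB: "B \<in> CL" "A \<in> CL" and inv: "A o\<^sub>L B = id_blinfun" "B o\<^sub>L A = id_blinfun" and s: "0 \<le> s"
    and small: "norm B * (\<Sum>m\<in>{1..M}. s ^ m / fact m * norm ((dif S1 ^^ m) A)) \<le> 1 / 2"
  shows "smooth_norm S2 s M B \<le> 2 * norm B"
proof -
  \<comment> \<open>With \<open>a 0 = 0\<close> the order 0 drops out although the sums below run
    over full triangles, as \<open>triangle_sum_le_product\<close> needs.\<close>
  define a where "a i = (if i = 0 then 0 else s ^ i / fact i * norm ((dif S1 ^^ i) A))" for i
  define b where "b i = s ^ i / fact i * norm ((dif S2 ^^ i) B)" for i
  have a0: "0 \<le> a i" and b0: "0 \<le> b i" for i using s by (auto simp: a_def b_def)
  have rec: "b m \<le> norm B * (\<Sum>i\<le>m. a i * b (m - i))" if "m \<noteq> 0" for m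
  proof -
    let ?t = "\<lambda>i. real (m choose i) *\<^sub>R ((dif S1 ^^ i) A o\<^sub>L (S2 ^^ i) ((dif S2 ^^ (m - i)) B))"
    have "(dif S3 ^^ m) id_blinfun = 0"
    proof -
      obtain k where "m = Suc k" using \<open>m \<noteq> 0\<close> by (cases m) auto
      moreover have "dif S3 id_blinfun = 0" by (simp add: dif_def id)
      ultimately show ?thesis using dif_isometry_pow_zero[OF S(3)] by (simp add: funpow_swap1)
    qed
    then have "0 = (\<Sum>i\<le>m. ?t i)" using dif_pow_Leibniz[OF S mult AB, of m] inv(1) by simp
    also have "\<dots> = ?t 0 + (\<Sum>i\<in>{1..m}. ?t i)"
    proof -
      have "{..m} = insert 0 {1..m}" by auto
      then show ?thesis by simp
    qed
    finally have t0: "A o\<^sub>L (dif S2 ^^ m) B = - (\<Sum>i\<in>{1..m}. ?t i)" by (simp add: eq_neg_iff_add_eq_0)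
    \<comment> \<open>Multiplication by \<open>B\<close> from the left isolates the highest
      difference of \<open>B\<close>, the only one without a factor from \<open>a\<close>.\<close>
    have "(dif S2 ^^ m) B = B o\<^sub>L (A o\<^sub>L (dif S2 ^^ m) B)"
      by (simp add: inv(2) flip: blinfun_compose_assoc)
    then have "norm ((dif S2 ^^ m) B) \<le> norm B * norm (A o\<^sub>L (dif S2 ^^ m) B)"
      using norm_blinfun_compose by metis
    also have "\<dots> \<le> norm B * (\<Sum>i\<in>{1..m}. norm (?t i))"
      unfolding t0 norm_minus_cancel by (intro mult_left_mono norm_sum) auto
    finally have "b m \<le> s ^ m / fact m * (norm B * (\<Sum>i\<in>{1..m}. norm (?t i)))"
      unfolding b_def using s by (intro mult_left_mono) auto
    also have "\<dots> = norm B * (\<Sum>i\<in>{1..m}. s ^ m / fact m * norm (?t i))"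
      by (simp add: sum_distrib_left mult_ac)
    also have "\<dots> \<le> norm B * (\<Sum>i\<in>{1..m}. a i * b (m - i))"
      using norm_Leibniz_term[OF S mult AB, of _ m s] s
      by (intro mult_left_mono sum_mono) (auto simp: a_def b_def)
    also have "(\<Sum>i\<in>{1..m}. a i * b (m - i)) = (\<Sum>i\<le>m. a i * b (m - i))"
      by (rule sum.mono_neutral_left) (auto simp: a_def)
    finally show ?thesis .
  qed
  have "(\<Sum>m\<le>M. b m) \<le> (\<Sum>m\<le>M. (if m = 0 then norm B else 0) + norm B * (\<Sum>i\<le>m. a i * b (m - i)))"
  proof (rule sum_mono)
    fix m
    show "b m \<le> (if m = 0 then norm B else 0) + norm B * (\<Sum>i\<le>m. a i * b (m - i))"
      using rec[of m] by (cases "m = 0") (auto simp: b_def a_def)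
  qed
  also have "\<dots> = norm B + norm B * (\<Sum>m\<le>M. \<Sum>i\<le>m. a i * b (m - i))"
    by (simp add: sum.distrib sum_distrib_left sum.delta)
  also have "\<dots> \<le> norm B + norm B * ((\<Sum>i\<le>M. a i) * (\<Sum>i\<le>M. b i))"
    by (intro add_left_mono mult_left_mono triangle_sum_le_product a0 b0) auto
  also have "(\<Sum>i\<le>M. a i) = (\<Sum>m\<in>{1..M}. s ^ m / fact m * norm ((dif S1 ^^ m) A))"
    by (rule sum.mono_neutral_cong_right) (auto simp: a_def)
  \<comment> \<open>The sum of the \<open>b i\<close> stands on both sides; \<open>small\<close>
    leaves it with the factor 1/2 on the right, where it is absorbed.\<close>
  also have "norm B + norm B * ((\<Sum>m\<in>{1..M}. s ^ m / fact m * norm ((dif S1 ^^ m) A)) * (\<Sum>i\<le>M. b i))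
    \<le> norm B + 1 / 2 * (\<Sum>i\<le>M. b i)"
    using mult_right_mono[OF small, of "\<Sum>i\<le>M. b i"] b0 by (simp add: sum_nonneg mult.assoc)
  finally have "(\<Sum>m\<le>M. b m) \<le> 2 * norm B" by simp
  then show ?thesis unfolding smooth_norm_def b_def .
qed

lemma (in cl_module) additive_isometry_twist: "additive_isometry_on_CL (twist T \<nu> j h)"
  by (simp add: additive_isometry_on_CL_def twist_norm twist_add)

text \<open>Phases multiply under composition, hence frequencies add.\<close>

lemma twist_compose:
  assumes "\<And>t. T3 t (B o\<^sub>L A) = T1 t B o\<^sub>L T2 t A" "\<And>t. T1 t B \<in> CL"
  shows "twist T3 (\<nu> + \<mu>) j h (B o\<^sub>L A) = twist T1 \<nu> j h B o\<^sub>L twist T2 \<mu> j h A"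
proof -
  have "niexp (real_of_int ((\<nu> + \<mu>) $ j) * h)
    = niexp (real_of_int (\<nu> $ j) * h) * niexp (real_of_int (\<mu> $ j) * h)"
    by (simp add: exp_add[symmetric] algebra_simps)
  then show ?thesis unfolding twist_def assms(1) using csc_compose[OF assms(2)] by simp
qed

section \<open>Smoothness of operators around a frequency\<close>

definition smooth_at :: "(real^'d \<Rightarrow> ('u \<Rightarrow>\<^sub>L 'v) \<Rightarrow> ('u::complex_normed_vector \<Rightarrow>\<^sub>L 'v::complex_normed_vector))
    \<Rightarrow> real \<Rightarrow> nat \<Rightarrow> int^'d \<Rightarrow> ('u \<Rightarrow>\<^sub>L 'v) \<Rightarrow> real \<Rightarrow> bool" where
  "smooth_at T \<delta> M \<mu> X w \<longleftrightarrow>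
     (\<forall>j h. h \<noteq> 0 \<longrightarrow> \<bar>h\<bar> \<le> 1 / 2 \<longrightarrow> smooth_norm (twist T \<mu> j h) (\<delta> / \<bar>h\<bar>) M X \<le> w)"

lemma smooth_at_nonneg:
  assumes "0 < \<delta>" "smooth_at T \<delta> M \<mu> X w"
  shows "0 \<le> w"
proof -
  have "smooth_norm (twist T \<mu> undefined (1/2)) (\<delta> / \<bar>1/2\<bar>) M X \<le> w"
    using assms(2)[unfolded smooth_at_def, rule_format, of "1/2" undefined] by simp
  moreover have "0 \<le> smooth_norm (twist T \<mu> undefined (1/2)) (\<delta> / \<bar>1/2\<bar>) M X"
    unfolding smooth_norm_def using assms(1) by (intro sum_nonneg) auto
  ultimately show ?thesis by linarith
qed

lemma smooth_at_compose:
  assumes c1: "cl_module act1 T1" and c2: "cl_module act2 T2" and c3: "cl_module act3 T3"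
    and mult: "\<And>t A B. A \<in> CL \<Longrightarrow> B \<in> CL \<Longrightarrow> T3 t (B o\<^sub>L A) = T1 t B o\<^sub>L T2 t A"
    and AB: "A \<in> CL" "B \<in> CL" and \<delta>: "0 < \<delta>"
    and wB: "smooth_at T1 \<delta> M \<nu> B w1" and wA: "smooth_at T2 \<delta> M \<mu> A w2"
  shows "smooth_at T3 \<delta> M (\<nu> + \<mu>) (B o\<^sub>L A) (w1 * w2)"
  unfolding smooth_at_def
proof (intro allI impI)
  fix j and h :: real assume h: "h \<noteq> 0" "\<bar>h\<bar> \<le> 1 / 2"
  have "smooth_norm (twist T3 (\<nu> + \<mu>) j h) (\<delta> / \<bar>h\<bar>) M (B o\<^sub>L A)
    \<le> smooth_norm (twist T1 \<nu> j h) (\<delta> / \<bar>h\<bar>) M B * smooth_norm (twist T2 \<mu> j h) (\<delta> / \<bar>h\<bar>) M A"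
  proof (rule smooth_norm_compose)
    show "twist T3 (\<nu> + \<mu>) j h (B o\<^sub>L A) = twist T1 \<nu> j h B o\<^sub>L twist T2 \<mu> j h A" if "A \<in> CL" "B \<in> CL" for A B
      using mult[OF that] cl_module.T_in_CL[OF c1 that(2)] by (rule twist_compose)
  qed (use c1 c2 c3 AB \<delta> in \<open>auto intro: cl_module.additive_isometry_twist\<close>)
  also have "\<dots> \<le> w1 * w2"
    using wA wB h smooth_at_nonneg[OF \<delta> wB] \<delta> unfolding smooth_at_def
    by (intro mult_mono) (auto simp: smooth_norm_def intro!: sum_nonneg)
  finally show "smooth_norm (twist T3 (\<nu> + \<mu>) j h) (\<delta> / \<bar>h\<bar>) M (B o\<^sub>L A) \<le> w1 * w2" .
qed

text \<open>A difference of order m brings the m-th power of the step, which cancels against the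
  weight. Because \<open>\<delta> \<le> 1\<close> the constant is free of \<open>\<delta>\<close>,
  so refining the scale does not enlarge the bounds for the remainder.\<close>

lemma (in cl_module) smooth_at_phik:
  assumes X: "X \<in> CL" and \<delta>: "0 < \<delta>" "\<delta> \<le> 1"
  shows "smooth_at T \<delta> M n (act (phik n) X) ((\<Sum>m\<le>M. shift_const TYPE('d) ^ m / fact m) * norm (act (phik n) X))"
  unfolding smooth_at_def smooth_norm_def sum_distrib_right
proof (intro allI impI sum_mono)
  fix j :: 'd and h :: real and m assume h: "h \<noteq> 0" "\<bar>h\<bar> \<le> 1 / 2"
  let ?C = "shift_const TYPE('d)"
  have "(\<delta> / \<bar>h\<bar>) ^ m / fact m * norm ((dif (twist T n j h) ^^ m) (act (phik n) X))
    \<le> (\<delta> / \<bar>h\<bar>) ^ m / fact m * ((?C * \<bar>h\<bar>) ^ m * norm (act (phik n) X))"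
    using norm_dif_pow_twist_phik[OF X h(2), where \<nu>=n and n=n and j=j and m=m] \<delta> by (intro mult_left_mono) auto
  also have "\<dots> = (\<delta> * ?C) ^ m / fact m * norm (act (phik n) X)"
    using h by (simp add: power_mult_distrib power_divide)
  also have "\<dots> \<le> ?C ^ m / fact m * norm (act (phik n) X)"
    using \<delta> shift_const_nonneg[where 'd='d]
    by (intro mult_right_mono divide_right_mono power_mono) (auto intro: mult_left_le_one_le)
  finally show "(\<delta> / \<bar>h\<bar>) ^ m / fact m * norm ((dif (twist T n j h) ^^ m) (act (phik n) X))
    \<le> ?C ^ m / fact m * norm (act (phik n) X)" .
qed

text \<open>Frequencies up to \<open>N\<close> give differences of order m bounded by a multiple of
  the m-th power of the step, so \<open>\<delta> ^ m\<close> survives. Without the order 0 at least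
  one factor \<open>\<delta>\<close> is left, which makes the whole sum small at a fine scale, as
  required for inversion.\<close>

lemma (in cl_module) band_limited_differences:
  assumes X: "X \<in> CL" and \<delta>: "0 < \<delta>" "\<delta> \<le> 1" and h: "h \<noteq> 0" "\<bar>h\<bar> \<le> 1 / 2"
  shows "(\<Sum>m\<in>{1..M}. (\<delta> / \<bar>h\<bar>) ^ m / fact m * norm ((dif (twist T 0 j h) ^^ m) (\<Sum>n\<in>{n. supnorm n \<le> int N}. act (phik n) X)))
    \<le> \<delta> * (\<Sum>m\<in>{1..M}. \<Sum>n\<in>{n. supnorm n \<le> int N}. (shift_const TYPE('d) + real N) ^ m * norm (act (phik n) X))"
proof -
  have step: "(\<delta> / \<bar>h\<bar>) ^ m / fact m * norm ((dif (twist T 0 j h) ^^ m) (\<Sum>n\<in>{n. supnorm n \<le> int N}. act (phik n) X))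
    \<le> \<delta> * (\<Sum>n\<in>{n. supnorm n \<le> int N}. (shift_const TYPE('d) + real N) ^ m * norm (act (phik n) X))"
    if m: "m \<in> {1..M}" for m
  proof -
    let ?C = "shift_const TYPE('d)" and ?F = "{n :: int^'d. supnorm n \<le> int N}"
    have C: "0 \<le> ?C" by (rule shift_const_nonneg)
    have "norm ((dif (twist T 0 j h) ^^ m) (\<Sum>n\<in>?F. act (phik n) X))
      \<le> (\<Sum>n\<in>?F. norm ((dif (twist T 0 j h) ^^ m) (act (phik n) X)))"
      using X by (subst dif_isometry_pow_sum[OF additive_isometry_twist]) (auto simp: phi_in_L1 norm_sum)
    also have "\<dots> \<le> (\<Sum>n\<in>?F. ((?C + real N) * \<bar>h\<bar>) ^ m * norm (act (phik n) X))"
    proof (rule sum_mono)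
      fix n assume n: "n \<in> ?F"
      have "\<bar>n $ j\<bar> \<le> int N" using n supnorm_ge[of n j] by simp
      then have nj: "\<bar>real_of_int (n $ j - 0 $ j)\<bar> \<le> real N" by simp
      show "norm ((dif (twist T 0 j h) ^^ m) (act (phik n) X)) \<le> ((?C + real N) * \<bar>h\<bar>) ^ m * norm (act (phik n) X)"
        by (rule order_trans[OF norm_dif_pow_twist_phik[OF X h(2)]])
          (use nj C in \<open>intro mult_right_mono power_mono add_left_mono; auto\<close>)
    qed
    finally have "(\<delta> / \<bar>h\<bar>) ^ m / fact m * norm ((dif (twist T 0 j h) ^^ m) (\<Sum>n\<in>?F. act (phik n) X))
      \<le> (\<delta> / \<bar>h\<bar>) ^ m / 1 * (\<Sum>n\<in>?F. ((?C + real N) * \<bar>h\<bar>) ^ m * norm (act (phik n) X))"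
      using \<delta> by (intro mult_mono divide_left_mono) (auto simp: fact_ge_1 intro!: sum_nonneg)
    also have "\<dots> = \<delta> ^ m * (\<Sum>n\<in>?F. (?C + real N) ^ m * norm (act (phik n) X))"
      unfolding sum_distrib_left using h by (intro sum.cong refl) (simp add: power_mult_distrib power_divide)
    also have "\<dots> \<le> \<delta> * (\<Sum>n\<in>?F. (?C + real N) ^ m * norm (act (phik n) X))"
      using \<delta> m C power_decreasing[of 1 m \<delta>] by (intro mult_right_mono sum_nonneg) auto
    finally show ?thesis .
  qed
  show ?thesis
    by (subst sum_distrib_left) (rule sum_mono, rule step)
qed

section \<open>Inverse closedness\<close>

text \<open>Surjectivity gives \<open>Z\<close> with \<open>T t Z = id_blinfun\<close>;
  multiplicativity for \<open>id_blinfun o\<^sub>L Z\<close> then identifies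
  \<open>T t id_blinfun\<close>.\<close>

lemma representation_id:
  fixes T :: "real^'d::finite \<Rightarrow> ('u \<Rightarrow>\<^sub>L 'u) \<Rightarrow> ('u::{complex_normed_vector,banach} \<Rightarrow>\<^sub>L 'u)"
  assumes "cl_module act T" and mult: "\<And>t A B. A \<in> CL \<Longrightarrow> B \<in> CL \<Longrightarrow> T t (B o\<^sub>L A) = T t B o\<^sub>L T t A"
  shows "T t id_blinfun = id_blinfun"
proof -
  obtain Z where Z: "Z \<in> CL" "T t Z = id_blinfun"
    using cl_module.T_onto[OF assms(1) id_in_CL] by blast
  then show ?thesis using mult[OF Z(1) id_in_CL, of t] by simp
qed

lemma twist_zero_id: "T (axis j h) id_blinfun = id_blinfun \<Longrightarrow> twist T 0 j h id_blinfun = id_blinfun"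
  by (simp add: twist_def)

lemma smooth_at_id:
  assumes c: "cl_module act T" and T: "\<And>t. T t id_blinfun = id_blinfun"
  shows "smooth_at T \<delta> M 0 id_blinfun 1"
  unfolding smooth_at_def
proof (intro allI impI)
  fix j and h :: real
  have z: "(dif (twist T 0 j h) ^^ m) id_blinfun = 0" if "m \<noteq> 0" for m
  proof -
    obtain k where "m = Suc k" using \<open>m \<noteq> 0\<close> by (cases m) auto
    moreover have "dif (twist T 0 j h) id_blinfun = 0" by (simp add: dif_def twist_zero_id T)
    ultimately show ?thesis
      using dif_isometry_pow_zero[OF cl_module.additive_isometry_twist[OF c]] by (simp add: funpow_swap1)
  qed
  have "smooth_norm (twist T 0 j h) (\<delta> / \<bar>h\<bar>) M id_blinfun
    = (\<Sum>m\<in>{0}. (\<delta> / \<bar>h\<bar>) ^ m / fact m * norm ((dif (twist T 0 j h) ^^ m) id_blinfun))"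
    unfolding smooth_norm_def by (rule sum.mono_neutral_right) (auto simp: z)
  also have "\<dots> \<le> 1" by (simp add: norm_blinfun_id_le)
  finally show "smooth_norm (twist T 0 j h) (\<delta> / \<bar>h\<bar>) M id_blinfun \<le> 1" .
qed

section \<open>Envelopes for the Neumann terms of the inverse\<close>

primrec neumann_envelope :: "(int^'d \<Rightarrow> ennreal) \<Rightarrow> (int^'d \<Rightarrow> ennreal) \<Rightarrow> nat \<Rightarrow> int^'d \<Rightarrow> ennreal" where
  "neumann_envelope r e 0 = e"
| "neumann_envelope r e (Suc k) = lconv r (neumann_envelope r e k)"

lemma bnorm_neumann_envelope:
  fixes r e :: "int^'d::finite \<Rightarrow> ennreal"
  assumes "2 ^ Suc CARD('d) * bnorm r \<le> ennreal (1 / 2)"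
  shows "bnorm (neumann_envelope r e k) \<le> ennreal ((1 / 2) ^ k) * bnorm e"
proof (induction k)
  case (Suc k)
  have "bnorm (neumann_envelope r e (Suc k)) \<le> 2 ^ Suc CARD('d) * bnorm r * bnorm (neumann_envelope r e k)"
    by (simp only: neumann_envelope.simps bnorm_lconv)
  also have "\<dots> \<le> ennreal (1 / 2) * (ennreal ((1 / 2) ^ k) * bnorm e)"
    by (rule mult_mono[OF assms Suc]) auto
  also have "\<dots> = ennreal ((1 / 2) ^ Suc k) * bnorm e"
    unfolding power_Suc by (subst ennreal_mult') (auto simp only: mult.assoc)
  finally show ?case .
qed simp

lemma bnorm_suminf_neumann_envelope:
  fixes r e :: "int^'d::finite \<Rightarrow> ennreal"
  assumes "2 ^ Suc CARD('d) * bnorm r \<le> ennreal (1 / 2)" "bnorm e < \<infinity>"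
  shows "bnorm (\<lambda>n. \<Sum>k. neumann_envelope r e k n) < \<infinity>"
proof -
  have "bnorm (\<lambda>n. \<Sum>k. neumann_envelope r e k n) \<le> (\<Sum>k. bnorm (neumann_envelope r e k))"
    by (rule bnorm_suminf_le)
  also have "\<dots> \<le> (\<Sum>k. ennreal ((1 / 2) ^ k) * bnorm e)"
    by (intro suminf_le bnorm_neumann_envelope[OF assms(1)]) auto
  also have "\<dots> = (\<Sum>k. ennreal ((1 / 2) ^ k)) * bnorm e" by simp
  also have "(\<Sum>k. ennreal ((1 / 2) ^ k)) = ennreal (\<Sum>k. (1 / 2 :: real) ^ k)"
    by (rule suminf_ennreal2) (auto intro: summable_geometric)
  also have "ennreal (\<Sum>k. (1 / 2 :: real) ^ k) * bnorm e < \<infinity>"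
    using assms(2) by (simp add: ennreal_mult_less_top)
  finally show ?thesis .
qed

text \<open>The prefix \<open>Y\<close> holds the factors already split into frequencies. A step
  expands only the leftmost \<open>R0\<close> of the rest and moves \<open>B'\<close> and one
  \<open>R \<nu>\<close> into the prefix: its frequency grows by \<open>\<nu>\<close> and its bound
  by the factor \<open>K * \<rho> \<nu>\<close>. Decay is used once, when the prefix is the whole
  product, so the constants in \<open>E\<close> are not raised to a power.\<close>

lemma neumann_step_bound:
  fixes T1 :: "real^'d::finite \<Rightarrow> ('x \<Rightarrow>\<^sub>L 'x) \<Rightarrow> ('x::{complex_normed_vector,banach} \<Rightarrow>\<^sub>L 'x)"
    and T2 :: "real^'d \<Rightarrow> ('y \<Rightarrow>\<^sub>L 'x) \<Rightarrow> ('y::{complex_normed_vector,banach} \<Rightarrow>\<^sub>L 'x)"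
    and T3 :: "real^'d \<Rightarrow> ('x \<Rightarrow>\<^sub>L 'y) \<Rightarrow> ('x \<Rightarrow>\<^sub>L 'y)"
  assumes c1: "cl_module act1 T1" and c2: "cl_module act2 T2" and c3: "cl_module act3 T3"
    and m12: "\<And>t A B. A \<in> CL \<Longrightarrow> B \<in> CL \<Longrightarrow> T2 t (B o\<^sub>L A) = T1 t B o\<^sub>L T2 t A"
    and m23: "\<And>t A B. A \<in> CL \<Longrightarrow> B \<in> CL \<Longrightarrow> T1 t (B o\<^sub>L A) = T2 t B o\<^sub>L T3 t A"
    and B': "B' \<in> CL" "smooth_at T2 \<delta> M 0 B' K" and \<delta>: "0 < \<delta>"
    and R: "(R has_sum R0) UNIV" "\<And>\<nu>. R \<nu> \<in> CL" "\<And>\<nu>. smooth_at T3 \<delta> M \<nu> (R \<nu>) (\<rho> \<nu>)"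
    and e: "\<And>Z \<mu> w n. Z \<in> CL \<Longrightarrow> smooth_at T2 \<delta> M \<mu> Z w \<Longrightarrow> ennreal (norm (act2 (phik n) Z)) \<le> ennreal w * E (n - \<mu>)"
  shows "Y \<in> CL \<Longrightarrow> smooth_at T1 \<delta> M \<mu> Y w \<Longrightarrow>
    ennreal (norm (act2 (phik n) (Y o\<^sub>L ((\<lambda>Z. B' o\<^sub>L (R0 o\<^sub>L Z)) ^^ k) B')))
      \<le> ennreal w * neumann_envelope (\<lambda>\<nu>. ennreal (K * \<rho> \<nu>)) (\<lambda>n. ennreal K * E n) k (n - \<mu>)"
proof (induction k arbitrary: Y \<mu> w)
  case 0
  have w: "0 \<le> w" by (rule smooth_at_nonneg[OF \<delta> 0(2)])
  have "smooth_at T2 \<delta> M (\<mu> + 0) (Y o\<^sub>L B') (w * K)"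
    by (rule smooth_at_compose[OF c1 c2 c2 m12 B'(1) 0(1) \<delta> 0(2) B'(2)])
  then have "ennreal (norm (act2 (phik n) (Y o\<^sub>L B'))) \<le> ennreal (w * K) * E (n - (\<mu> + 0))"
    by (intro e) (use 0 B' in auto)
  then show ?case using w by (simp add: ennreal_mult' mult.assoc)
next
  case (Suc k)
  define P where "P = ((\<lambda>Z. B' o\<^sub>L (R0 o\<^sub>L Z)) ^^ k) B'"
  let ?env = "neumann_envelope (\<lambda>\<nu>. ennreal (K * \<rho> \<nu>)) (\<lambda>n. ennreal K * E n) k"
  have w: "0 \<le> w" by (rule smooth_at_nonneg[OF \<delta> Suc.prems(2)])
  have R0: "R0 \<in> CL" using R(1,2) by (rule has_sum_in_CL)
  have P: "P \<in> CL" unfolding P_def by (induction k) (auto simp: B' R0)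
  have p: "phik n \<in> L1" by (simp add: phi_in_L1)
  have "bounded_linear (\<lambda>Z. (Y o\<^sub>L B') o\<^sub>L (Z o\<^sub>L P))"
    by (intro bounded_linear_compose[OF bounded_bilinear.bounded_linear_right[OF bounded_bilinear_blinfun_compose]
        bounded_bilinear.bounded_linear_left[OF bounded_bilinear_blinfun_compose]])
  then have "((\<lambda>\<nu>. (Y o\<^sub>L B') o\<^sub>L (R \<nu> o\<^sub>L P)) has_sum (Y o\<^sub>L B') o\<^sub>L (R0 o\<^sub>L P)) UNIV"
    using R(1) by (rule has_sum_bounded_linear)
  then have "((\<lambda>\<nu>. act2 (phik n) ((Y o\<^sub>L B') o\<^sub>L (R \<nu> o\<^sub>L P))) has_sum act2 (phik n) ((Y o\<^sub>L B') o\<^sub>L (R0 o\<^sub>L P))) UNIV"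
    by (rule cl_module.act_has_sum[OF c2 _ _ p]) (simp add: Suc.prems B' R P)
  then have "ennreal (norm (act2 (phik n) ((Y o\<^sub>L B') o\<^sub>L (R0 o\<^sub>L P))))
    \<le> (\<integral>\<^sup>+\<nu>. ennreal (norm (act2 (phik n) ((Y o\<^sub>L B') o\<^sub>L (R \<nu> o\<^sub>L P)))) \<partial>count_space UNIV)"
    by (rule norm_has_sum_le_nn_integral)
  also have "\<dots> \<le> (\<integral>\<^sup>+\<nu>. ennreal w * (ennreal (K * \<rho> \<nu>) * ?env (n - \<mu> - \<nu>)) \<partial>count_space UNIV)"
  proof (rule nn_integral_mono)
    fix \<nu>
    have "smooth_at T2 \<delta> M (\<mu> + 0) (Y o\<^sub>L B') (w * K)"
      by (rule smooth_at_compose[OF c1 c2 c2 m12 B'(1) Suc.prems(1) \<delta> Suc.prems(2) B'(2)])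
    then have "smooth_at T1 \<delta> M (\<mu> + 0 + \<nu>) ((Y o\<^sub>L B') o\<^sub>L R \<nu>) (w * K * \<rho> \<nu>)"
      by (intro smooth_at_compose[OF c2 c3 c1 m23 _ _ \<delta>] R) (use Suc.prems B' in auto)
    then have "ennreal (norm (act2 (phik n) (((Y o\<^sub>L B') o\<^sub>L R \<nu>) o\<^sub>L P))) \<le> ennreal (w * K * \<rho> \<nu>) * ?env (n - (\<mu> + 0 + \<nu>))"
      unfolding P_def by (intro Suc.IH) (use Suc.prems B' R in auto)
    then show "ennreal (norm (act2 (phik n) ((Y o\<^sub>L B') o\<^sub>L (R \<nu> o\<^sub>L P)))) \<le> ennreal w * (ennreal (K * \<rho> \<nu>) * ?env (n - \<mu> - \<nu>))"
      using w by (simp add: blinfun_compose_assoc mult.assoc ennreal_mult'[of w] diff_diff_eq)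
  qed
  also have "\<dots> = ennreal w * neumann_envelope (\<lambda>\<nu>. ennreal (K * \<rho> \<nu>)) (\<lambda>n. ennreal K * E n) (Suc k) (n - \<mu>)"
    by (simp add: lconv_def nn_integral_cmult)
  finally show ?case by (simp add: P_def blinfun_compose_assoc)
qed

text \<open>A finite expansion with explicit remainder spares passing an infinite series through the
  action; only the norm of the remainder has to vanish in the limit.\<close>

lemma neumann_expansion:
  fixes B B' :: "'y::real_normed_vector \<Rightarrow>\<^sub>L 'x::real_normed_vector" and R :: "'x \<Rightarrow>\<^sub>L 'y"
  assumes rec: "B = B' - (B' o\<^sub>L (R o\<^sub>L B))"
  shows "B = (\<Sum>k<m. (- 1) ^ k *\<^sub>R ((\<lambda>Z. B' o\<^sub>L (R o\<^sub>L Z)) ^^ k) B') + (- 1) ^ m *\<^sub>R ((\<lambda>Z. B' o\<^sub>L (R o\<^sub>L Z)) ^^ m) B"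
proof -
  let ?F = "\<lambda>Z. B' o\<^sub>L (R o\<^sub>L Z)"
  have lin: "?F (X - Y) = ?F X - ?F Y" for X Y
    by (rule blinfun_eqI) (simp add: blinfun.bilinear_simps)
  have linp: "(?F ^^ k) (X - Y) = (?F ^^ k) X - (?F ^^ k) Y" for k X Y
  proof (induction k)
    case (Suc k)
    then show ?case using lin[of "(?F ^^ k) X" "(?F ^^ k) Y"] by simp
  qed simp
  have step: "(?F ^^ k) B = (?F ^^ k) B' - (?F ^^ Suc k) B" for k
  proof -
    have "(?F ^^ k) B = (?F ^^ k) (B' - ?F B)" using rec by simp
    also have "\<dots> = (?F ^^ k) B' - (?F ^^ k) (?F B)" by (rule linp)
    also have "(?F ^^ k) (?F B) = (?F ^^ Suc k) B" using funpow_swap1[of ?F k B] by simp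
    finally show ?thesis .
  qed
  show ?thesis
  proof (induction m)
    case (Suc m)
    have eq: "(- 1) ^ m *\<^sub>R (?F ^^ m) B = (- 1) ^ m *\<^sub>R (?F ^^ m) B' + (- 1) ^ Suc m *\<^sub>R (?F ^^ Suc m) B"
      by (subst step) (simp add: scaleR_diff_right)
    have "B = (\<Sum>k<m. (- 1) ^ k *\<^sub>R (?F ^^ k) B') + (- 1) ^ m *\<^sub>R (?F ^^ m) B" by (rule Suc)
    also have "\<dots> = (\<Sum>k<m. (- 1) ^ k *\<^sub>R (?F ^^ k) B') + ((- 1) ^ m *\<^sub>R (?F ^^ m) B' + (- 1) ^ Suc m *\<^sub>R (?F ^^ Suc m) B)"
      by (rule arg_cong[OF eq])
    also have "\<dots> = (\<Sum>k<Suc m. (- 1) ^ k *\<^sub>R (?F ^^ k) B') + (- 1) ^ Suc m *\<^sub>R (?F ^^ Suc m) B"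
      by (simp only: sum.lessThan_Suc add.assoc)
    finally show ?case .
  qed simp
qed

lemma smooth_at_mono: "smooth_at T \<delta> M \<mu> X w \<Longrightarrow> w \<le> w' \<Longrightarrow> smooth_at T \<delta> M \<mu> X w'"
  unfolding smooth_at_def by (meson order_trans)

lemma (in cl_module) smooth_at_zero: "smooth_at T \<delta> M \<mu> 0 0"
  unfolding smooth_at_def smooth_norm_def
  by (simp add: dif_isometry_pow_zero[OF additive_isometry_twist])

text \<open>The signs of the Neumann expansion are real scalars, whereas the axioms speak of
  \<open>csc\<close>; parity reduces them to negation.\<close>

lemma (in cl_module) norm_act_alternating:
  assumes "f \<in> L1" "X \<in> CL"
  shows "norm (act f ((- 1) ^ k *\<^sub>R X)) = norm (act f X)" "(- 1) ^ k *\<^sub>R X \<in> CL"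
  using act_diff[OF assms(1) zero_in_CL assms(2)] assms by (cases "even k"; simp add: act_zero)+

lemma (in cl_module) smooth_at_phik_decay:
  assumes "Z \<in> CL" "0 < \<delta>" "smooth_at T \<delta> (2 * CARD('d)) \<mu> Z w"
  defines "C \<equiv> shift_const TYPE('d)" and "M \<equiv> 2 * CARD('d)"
  shows "ennreal (norm (act (phik n) Z)) \<le> ennreal w * (ennreal (C * (fact M * (2 * pi / \<delta>) ^ M + (1 + 2 * pi + C * pi) ^ M))
    * ennreal (1 / (1 + real_of_int (supnorm (n - \<mu>))) ^ M))"
proof -
  let ?c = "C * (fact M * (2 * pi / \<delta>) ^ M + (1 + 2 * pi + C * pi) ^ M)"
  have C: "0 \<le> C" unfolding C_def by (rule shift_const_nonneg)
  have c: "0 \<le> ?c" using C assms(2) by simp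
  have "norm (act (phik n) Z) \<le> w * (?c / (1 + real_of_int (supnorm (n - \<mu>))) ^ M)"
    unfolding C_def M_def
    by (rule phik_decay[OF assms(1,2)]) (use assms(3) in \<open>auto simp: smooth_at_def\<close>)
  then have "ennreal (norm (act (phik n) Z)) \<le> ennreal (w * (?c * (1 / (1 + real_of_int (supnorm (n - \<mu>))) ^ M)))"
    by (intro ennreal_leI) simp
  also have "\<dots> = ennreal w * (ennreal ?c * ennreal (1 / (1 + real_of_int (supnorm (n - \<mu>))) ^ M))"
    by (simp only: ennreal_mult'[OF smooth_at_nonneg[OF assms(2,3)]] ennreal_mult'[OF c])
  finally show ?thesis .
qed

theorem mainTheorem15:
  fixes aXY :: "(real^'d::finite \<Rightarrow> complex) \<Rightarrow> ('x::{complex_normed_vector,banach} \<Rightarrow>\<^sub>L 'y::{complex_normed_vector,banach}) \<Rightarrow> ('x \<Rightarrow>\<^sub>L 'y)"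
    and TXY :: "real^'d \<Rightarrow> ('x \<Rightarrow>\<^sub>L 'y) \<Rightarrow> ('x \<Rightarrow>\<^sub>L 'y)"
    and aYX :: "(real^'d \<Rightarrow> complex) \<Rightarrow> ('y \<Rightarrow>\<^sub>L 'x) \<Rightarrow> ('y \<Rightarrow>\<^sub>L 'x)"
    and TYX :: "real^'d \<Rightarrow> ('y \<Rightarrow>\<^sub>L 'x) \<Rightarrow> ('y \<Rightarrow>\<^sub>L 'x)"
    and aXX :: "(real^'d \<Rightarrow> complex) \<Rightarrow> ('x \<Rightarrow>\<^sub>L 'x) \<Rightarrow> ('x \<Rightarrow>\<^sub>L 'x)"
    and TXX :: "real^'d \<Rightarrow> ('x \<Rightarrow>\<^sub>L 'x) \<Rightarrow> ('x \<Rightarrow>\<^sub>L 'x)"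
    and aYY :: "(real^'d \<Rightarrow> complex) \<Rightarrow> ('y \<Rightarrow>\<^sub>L 'y) \<Rightarrow> ('y \<Rightarrow>\<^sub>L 'y)"
    and TYY :: "real^'d \<Rightarrow> ('y \<Rightarrow>\<^sub>L 'y) \<Rightarrow> ('y \<Rightarrow>\<^sub>L 'y)"
    and A :: "'x \<Rightarrow>\<^sub>L 'y" and B :: "'y \<Rightarrow>\<^sub>L 'x"
  assumes "operator_setting aXY TXY aYX TYX aXX TXX aYY TYY"
    and "A \<in> beurling_class CL aXY"
    and "B \<in> CL"
    and "mutually_inverse A B"
  shows "B \<in> beurling_class CL aYX"
proof -
  note os = assms(1)[unfolded operator_setting_def]
  interpret XY: cl_module aXY TXY using os by unfold_locales blast
  interpret YX: cl_module aYX TYX using os by unfold_locales blast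
  interpret XX: cl_module aXX TXX using os by unfold_locales blast
  interpret YY: cl_module aYY TYY using os by unfold_locales blast
  note os2 = os[THEN conjunct2, THEN conjunct2, THEN conjunct2, THEN conjunct2]
  have mXX: "TXX t (Y o\<^sub>L Z) = TXX t Y o\<^sub>L TXX t Z" if "Z \<in> CL" "Y \<in> CL" for t Y Z using os2[THEN conjunct1] that by blast
  have mYXX: "TXX t (Y o\<^sub>L Z) = TYX t Y o\<^sub>L TXY t Z" if "Z \<in> CL" "Y \<in> CL" for t Y Z using os2[THEN conjunct2, THEN conjunct2, THEN conjunct1] that by blast
  have mYX: "TYX t (Y o\<^sub>L Z) = TXX t Y o\<^sub>L TYX t Z" if "Z \<in> CL" "Y \<in> CL" for t Y Z using os2[THEN conjunct2, THEN conjunct2, THEN conjunct2, THEN conjunct2, THEN conjunct1] that by blast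
  have mXYY: "TYY t (Y o\<^sub>L Z) = TXY t Y o\<^sub>L TYX t Z" if "Z \<in> CL" "Y \<in> CL" for t Y Z using os2[THEN conjunct2, THEN conjunct2, THEN conjunct2, THEN conjunct2, THEN conjunct2, THEN conjunct1] that by blast
  have mYY: "TYY t (Y o\<^sub>L Z) = TYY t Y o\<^sub>L TYY t Z" if "Z \<in> CL" "Y \<in> CL" for t Y Z using os2[THEN conjunct2, THEN conjunct2, THEN conjunct2, THEN conjunct2, THEN conjunct2, THEN conjunct2, THEN conjunct2, THEN conjunct1] that by blast
  have p: "phik n \<in> L1" for n :: "int^'d" by (simp add: phi_in_L1)
  define C where "C = shift_const TYPE('d)"
  define M where "M = 2 * CARD('d)"
  define C' where "C' = (\<Sum>m\<le>M. C ^ m / fact m)"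
  have C: "0 \<le> C" unfolding C_def by (rule shift_const_nonneg)
  have C': "0 \<le> C'" unfolding C'_def using C by (intro sum_nonneg) auto
  have A: "A \<in> CL" and bA: "bnorm (\<lambda>n. ennreal (norm (aXY (phik n) A))) < \<infinity>"
    using assms(2) unfolding beurling_class_def beurling_norm_eq_bnorm rvec_def by auto
  \<comment> \<open>The summands give, in turn, positivity,
    \<open>norm B * \<eta> \<le> 1 / 4\<close>, and convergence of the convolution series, with 2 ^
    (d + 4) being 2 ^ (d + 1) times 4 from \<open>K\<close> times 2. Only \<open>norm B\<close> and
    the dimension occur, so that \<open>\<eta>\<close> is fixed before the cutoff
    \<open>N\<close>.\<close>
  define D where "D = 1 + 4 * norm B + 2 ^ (CARD('d) + 4) * norm B * C'"
  define \<eta> where "\<eta> = 1 / D"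
  have D: "1 \<le> D" "4 * norm B \<le> D" "2 ^ (CARD('d) + 4) * norm B * C' \<le> D" using C' by (auto simp: D_def)
  have \<eta>: "0 < \<eta>" using D(1) by (simp add: \<eta>_def)
  have \<eta>1: "norm B * \<eta> \<le> 1 / 4" using D(1,2) by (simp add: \<eta>_def divide_simps)
  have \<eta>2: "2 ^ Suc CARD('d) * (4 * norm B * C' * \<eta>) \<le> 1 / 2"
    using D(1,3) by (simp add: \<eta>_def divide_simps power_add)
  obtain N :: nat where N: "bnorm (\<lambda>n. if supnorm n \<le> int N then 0 else ennreal (norm (aXY (phik n) A))) < ennreal \<eta>"
    using bnorm_truncate_small[OF bA, of "ennreal \<eta>"] \<eta> by auto
  define F where "F = {n :: int^'d. supnorm n \<le> int N}"
  have finF: "finite F" unfolding F_def by (rule finite_supnorm_le)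
  define A' where "A' = (\<Sum>n\<in>F. aXY (phik n) A)"
  define R where "R \<nu> = (if \<nu> \<in> F then 0 else aXY (phik \<nu>) A)" for \<nu>
  define R0 where "R0 = A - A'"
  have A': "A' \<in> CL" unfolding A'_def by (intro sum_in_CL XY.act_in_CL p A)
  have RC: "R \<nu> \<in> CL" for \<nu> by (simp add: R_def p A)
  have Rn: "bnorm (\<lambda>n. ennreal (norm (R n))) < ennreal \<eta>"
  proof -
    have "(\<lambda>n. ennreal (norm (R n))) = (\<lambda>n. if supnorm n \<le> int N then 0 else ennreal (norm (aXY (phik n) A)))"
      by (auto simp: R_def F_def)
    then show ?thesis using N by simp
  qed
  have Rsum: "(R has_sum R0) UNIV"
  proof -
    have 1: "((\<lambda>n. aXY (phik n) A) has_sum A) UNIV"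
      by (rule XY.phik_has_sum[OF A le_less_trans[OF nn_integral_le_bnorm bA]])
    have 2: "((\<lambda>n. if n \<in> F then aXY (phik n) A else 0) has_sum A') UNIV"
      by (rule has_sum_finite_neutralI[OF finF]) (auto simp: A'_def)
    have "((\<lambda>n. - (if n \<in> F then aXY (phik n) A else 0)) has_sum - A') UNIV"
      using 2 by (simp only: has_sum_uminus minus_minus)
    from has_sum_add[OF 1 this]
    have "((\<lambda>n. aXY (phik n) A - (if n \<in> F then aXY (phik n) A else 0)) has_sum A - A') UNIV"
      by (simp only: add_uminus_conv_diff)
    moreover have "(\<lambda>n. aXY (phik n) A - (if n \<in> F then aXY (phik n) A else 0)) = R" by (auto simp: R_def)
    ultimately show ?thesis by (simp add: R0_def)
  qed
  have R0n: "norm R0 \<le> \<eta>"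
  proof -
    have "ennreal (norm R0) \<le> bnorm (\<lambda>n. ennreal (norm (R n)))"
      by (rule order_trans[OF norm_has_sum_le_nn_integral[OF Rsum] nn_integral_le_bnorm])
    then have "ennreal (norm R0) \<le> ennreal \<eta>" using Rn by (meson le_less_trans less_imp_le)
    then show ?thesis using \<eta> by (simp add: ennreal_le_iff)
  qed
  \<comment> \<open>Invertibility of A - R0 would be content with 1/2; the remainder of the
    expansion contains \<open>B'\<close>, whose norm may be twice that of \<open>B\<close>.\<close>
  have BR: "norm B * norm R0 \<le> 1 / 4"
    by (rule order_trans[OF mult_left_mono[OF R0n] \<eta>1]) simp
  have "norm B * norm R0 \<le> 1 / 2" using BR by linarith
  then obtain B' where B': "(A - R0) o\<^sub>L B' = id_blinfun" "B' o\<^sub>L (A - R0) = id_blinfun" "norm B' \<le> 2 * norm B"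
    using perturbed_inverse[OF assms(4)] by blast
  have AR: "A - R0 = A'" by (simp add: R0_def)
  have B'C: "B' \<in> CL" using inverse_in_CL[OF A'] B'(1,2) unfolding AR by blast
  define Q where "Q = (\<Sum>m\<in>{1..M}. \<Sum>n\<in>F. (C + real N) ^ m * norm (aXY (phik n) A))"
  have Q: "0 \<le> Q" unfolding Q_def using C by (intro sum_nonneg) auto
  \<comment> \<open>The scale makes \<open>norm B' * \<delta> * Q\<close> at most 1/2, the smallness
    asked for by \<open>smooth_norm_inverse\<close>. Through \<open>Q\<close> it depends on the
    cutoff; this affects only the decay constant \<open>c\<close> below.\<close>
  define \<delta> where "\<delta> = 1 / (1 + 2 * norm B' * Q)"
  have den: "1 \<le> 1 + 2 * norm B' * Q" using Q by simp
  have den0: "0 < 1 + 2 * norm B' * Q" by (rule less_le_trans[OF zero_less_one den])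
  have \<delta>: "0 < \<delta>" "\<delta> \<le> 1"
    unfolding \<delta>_def divide_le_eq_1_pos[OF den0] by (rule divide_pos_pos[OF zero_less_one den0], rule den)
  have \<delta>Q: "norm B' * (\<delta> * Q) \<le> 1 / 2"
  proof -
    have "norm B' * (\<delta> * Q) = norm B' * Q / (1 + 2 * norm B' * Q)" by (simp add: \<delta>_def)
    also have "\<dots> \<le> 1 / 2" unfolding pos_divide_le_eq[OF den0] by simp
    finally show ?thesis .
  qed
  have B's: "smooth_at TYX \<delta> M 0 B' (2 * norm B')"
    unfolding smooth_at_def
  proof (intro allI impI)
    fix j and h :: real assume h: "h \<noteq> 0" "\<bar>h\<bar> \<le> 1 / 2"
    show "smooth_norm (twist TYX 0 j h) (\<delta> / \<bar>h\<bar>) M B' \<le> 2 * norm B'"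
    proof (rule smooth_norm_inverse[OF XY.additive_isometry_twist YX.additive_isometry_twist YY.additive_isometry_twist])
      show "twist TYY 0 j h (Y o\<^sub>L Z) = twist TXY 0 j h Y o\<^sub>L twist TYX 0 j h Z" if "Z \<in> CL" "Y \<in> CL" for Y Z
        using twist_compose[of TYY Y Z TXY TYX 0 0 j h, OF mXYY[OF that] XY.T_in_CL[OF that(2)]] by simp
      show "twist TYY 0 j h id_blinfun = id_blinfun"
        by (rule twist_zero_id) (rule representation_id[OF YY.cl_module_axioms mYY])
      show "A' o\<^sub>L B' = id_blinfun" "B' o\<^sub>L A' = id_blinfun" using B' unfolding AR by auto
      have "(\<Sum>m\<in>{1..M}. (\<delta> / \<bar>h\<bar>) ^ m / fact m * norm ((dif (twist TXY 0 j h) ^^ m) A')) \<le> \<delta> * Q"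
        unfolding A'_def Q_def F_def C_def by (rule XY.band_limited_differences[OF A \<delta> h])
      then have "norm B' * (\<Sum>m\<in>{1..M}. (\<delta> / \<bar>h\<bar>) ^ m / fact m * norm ((dif (twist TXY 0 j h) ^^ m) A')) \<le> norm B' * (\<delta> * Q)"
        by (rule mult_left_mono) simp
      then show "norm B' * (\<Sum>m\<in>{1..M}. (\<delta> / \<bar>h\<bar>) ^ m / fact m * norm ((dif (twist TXY 0 j h) ^^ m) A')) \<le> 1 / 2"
        using \<delta>Q by linarith
    qed (use A' B'C \<delta> in auto)
  qed
  \<comment> \<open>One factor 2 comes from the smoothness of the inverse and one from
    \<open>norm B' \<le> 2 * norm B\<close>; expressed through \<open>B\<close>, the bound is
    independent of the cutoff.\<close>
  define K where "K = 4 * norm B"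
  have B'K: "smooth_at TYX \<delta> M 0 B' K"
    by (rule smooth_at_mono[OF B's]) (use B'(3) in \<open>simp add: K_def\<close>)
  have Rs: "smooth_at TXY \<delta> M \<nu> (R \<nu>) (C' * norm (R \<nu>))" for \<nu>
  proof (cases "\<nu> \<in> F")
    case True
    then show ?thesis using XY.smooth_at_zero by (simp add: R_def)
  next
    case False
    then show ?thesis using XY.smooth_at_phik[OF A \<delta>, of M \<nu>] by (simp add: R_def C'_def C_def)
  qed
  define c where "c = C * (fact M * (2 * pi / \<delta>) ^ M + (1 + 2 * pi + C * pi) ^ M)"
  define E where "E n = ennreal c * ennreal (1 / (1 + real_of_int (supnorm n)) ^ M)" for n :: "int^'d"
  have decay: "ennreal (norm (aYX (phik n) Z)) \<le> ennreal w * E (n - \<mu>)"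
    if "Z \<in> CL" "smooth_at TYX \<delta> M \<mu> Z w" for Z \<mu> w n
    using YX.smooth_at_phik_decay[OF that(1) \<delta>(1), of \<mu> w n] that(2)
    unfolding E_def c_def C_def M_def by blast
  define r where "r \<nu> = ennreal (K * (C' * norm (R \<nu>)))" for \<nu>
  define env where "env = neumann_envelope r (\<lambda>n. ennreal K * E n)"
  let ?G = "\<lambda>Z. B' o\<^sub>L (R0 o\<^sub>L Z)"
  have R0C: "R0 \<in> CL" using A A' by (simp add: R0_def)
  have GC: "(?G ^^ k) Z \<in> CL" if "Z \<in> CL" for k Z by (induction k) (auto simp: that B'C R0C)
  have term_bound: "ennreal (norm (aYX (phik n) ((?G ^^ k) B'))) \<le> env k n" for k n
  proof -
    \<comment> \<open>The empty prefix is the identity, of frequency 0 and bound 1.\<close>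
    have "ennreal (norm (aYX (phik n) (id_blinfun o\<^sub>L (?G ^^ k) B')))
      \<le> ennreal 1 * neumann_envelope (\<lambda>\<nu>. ennreal (K * (C' * norm (R \<nu>)))) (\<lambda>n. ennreal K * E n) k (n - 0)"
      by (rule neumann_step_bound[OF XX.cl_module_axioms YX.cl_module_axioms XY.cl_module_axioms
            mYX mYXX B'C B'K \<delta>(1) Rsum RC Rs decay id_in_CL
            smooth_at_id[OF XX.cl_module_axioms representation_id[OF XX.cl_module_axioms mXX]]])
    then show ?thesis by (simp add: env_def r_def[abs_def])
  qed
  have rec: "B = B' - (B' o\<^sub>L (R0 o\<^sub>L B))"
  proof -
    have "B' = B' o\<^sub>L (A o\<^sub>L B)" using assms(4) by (simp add: mutually_inverse_def)
    also have "\<dots> = ((B' o\<^sub>L (A - R0)) o\<^sub>L B) + (B' o\<^sub>L (R0 o\<^sub>L B))"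
      by (rule blinfun_eqI) (simp add: blinfun.bilinear_simps)
    also have "\<dots> = B + (B' o\<^sub>L (R0 o\<^sub>L B))" unfolding B'(2) by simp
    finally show ?thesis by (simp add: algebra_simps)
  qed
  have rem: "norm ((?G ^^ m) B) \<le> (1 / 2) ^ m * norm B" for m
  proof (induction m)
    case (Suc m)
    have "norm ((?G ^^ Suc m) B) \<le> norm B' * norm (R0 o\<^sub>L (?G ^^ m) B)"
      by (simp add: norm_blinfun_compose)
    also have "\<dots> \<le> norm B' * (norm R0 * norm ((?G ^^ m) B))"
      by (intro mult_left_mono norm_blinfun_compose) auto
    also have "\<dots> = (norm B' * norm R0) * norm ((?G ^^ m) B)" by simp
    also have "\<dots> \<le> (1 / 2) * ((1 / 2) ^ m * norm B)"
    proof (intro mult_mono Suc)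
      have "norm B' * norm R0 \<le> 2 * norm B * norm R0" using B'(3) by (intro mult_right_mono) auto
      then show "norm B' * norm R0 \<le> 1 / 2" using BR by simp
    qed auto
    finally show ?case by simp
  qed simp
  have main: "ennreal (norm (aYX (phik n) B)) \<le> (\<Sum>k. env k n)" for n
  proof (rule ennreal_le_epsilon)
    fix \<epsilon> :: real assume "0 < \<epsilon>"
    \<comment> \<open>The remainder is estimated in norm alone, without frequency decay; for each
      \<open>n\<close> the expansion is stopped once its component is below
      \<open>\<epsilon>\<close>.\<close>
    have "(\<lambda>m. C * ((1 / 2) ^ m * norm B)) \<longlonglongrightarrow> C * (0 * norm B)"
      by (intro tendsto_intros LIMSEQ_realpow_zero) auto
    then have "eventually (\<lambda>m. C * ((1 / 2) ^ m * norm B) < \<epsilon>) sequentially"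
      using \<open>0 < \<epsilon>\<close> by (intro order_tendstoD(2)) auto
    then obtain m where m: "C * ((1 / 2) ^ m * norm B) < \<epsilon>" by (auto simp: eventually_sequentially)
    let ?t = "\<lambda>k. (- 1) ^ k *\<^sub>R (?G ^^ k) B'" and ?r = "(- 1) ^ m *\<^sub>R (?G ^^ m) B"
    have tC: "?t k \<in> CL" for k using YX.norm_act_alternating(2)[OF p GC[OF B'C]] .
    have rC: "?r \<in> CL" using YX.norm_act_alternating(2)[OF p GC[OF assms(3)]] .
    have expand: "aYX (phik n) B = (\<Sum>k<m. aYX (phik n) (?t k)) + aYX (phik n) ?r"
    proof -
      have "aYX (phik n) B = aYX (phik n) ((\<Sum>k<m. ?t k) + ?r)"
        by (rule arg_cong[OF neumann_expansion[OF rec, of m]])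
      also have "\<dots> = aYX (phik n) (\<Sum>k<m. ?t k) + aYX (phik n) ?r"
        by (rule YX.act_add[OF p _ rC]) (rule sum_in_CL, rule tC)
      also have "aYX (phik n) (\<Sum>k<m. ?t k) = (\<Sum>k<m. aYX (phik n) (?t k))"
        by (rule YX.act_sum[OF p]) (rule tC)
      finally show ?thesis .
    qed
    have "norm (aYX (phik n) B) \<le> norm (\<Sum>k<m. aYX (phik n) (?t k)) + norm (aYX (phik n) ?r)"
      by (subst expand) (rule norm_triangle_ineq)
    also have "\<dots> \<le> (\<Sum>k<m. norm (aYX (phik n) (?t k))) + norm (aYX (phik n) ?r)"
      by (intro add_right_mono norm_sum)
    also have "\<dots> = (\<Sum>k<m. norm (aYX (phik n) ((?G ^^ k) B'))) + norm (aYX (phik n) ((?G ^^ m) B))"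
      by (simp only: YX.norm_act_alternating(1)[OF p GC[OF B'C]] YX.norm_act_alternating(1)[OF p GC[OF assms(3)]])
    also have "\<dots> \<le> (\<Sum>k<m. norm (aYX (phik n) ((?G ^^ k) B'))) + \<epsilon>"
    proof (rule add_left_mono)
      have "norm (aYX (phik n) ((?G ^^ m) B)) \<le> C * norm ((?G ^^ m) B)"
        unfolding C_def by (rule YX.norm_act_phik_le[OF GC[OF assms(3)]])
      also have "\<dots> \<le> C * ((1 / 2) ^ m * norm B)" by (intro mult_left_mono rem C)
      finally show "norm (aYX (phik n) ((?G ^^ m) B)) \<le> \<epsilon>" using m by linarith
    qed
    finally have "ennreal (norm (aYX (phik n) B)) \<le> ennreal ((\<Sum>k<m. norm (aYX (phik n) ((?G ^^ k) B'))) + \<epsilon>)"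
      by (rule ennreal_leI)
    also have "\<dots> = (\<Sum>k<m. ennreal (norm (aYX (phik n) ((?G ^^ k) B')))) + ennreal \<epsilon>"
      using \<open>0 < \<epsilon>\<close> by (subst ennreal_plus) (auto intro!: sum_nonneg simp: sum_ennreal)
    also have "\<dots> \<le> (\<Sum>k<m. env k n) + ennreal \<epsilon>"
      by (intro add_right_mono sum_mono term_bound)
    also have "\<dots> \<le> (\<Sum>k. env k n) + ennreal \<epsilon>"
      by (intro add_right_mono sum_le_suminf) auto
    finally show "ennreal (norm (aYX (phik n) B)) \<le> (\<Sum>k. env k n) + ennreal \<epsilon>" .
  qed
  have K: "0 \<le> K" by (simp add: K_def)
  have "bnorm r = ennreal (K * C') * bnorm (\<lambda>n. ennreal (norm (R n)))"
    unfolding bnorm_cmult[symmetric] r_def[abs_def] using K C'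
    by (simp add: ennreal_mult'[symmetric] mult.assoc)
  also have "\<dots> \<le> ennreal (K * C') * ennreal \<eta>"
    by (rule mult_left_mono[OF less_imp_le[OF Rn]]) simp
  finally have "2 ^ Suc CARD('d) * bnorm r \<le> 2 ^ Suc CARD('d) * (ennreal (K * C') * ennreal \<eta>)"
    by (rule mult_left_mono) simp
  also have "\<dots> = ennreal (2 ^ Suc CARD('d) * (K * C' * \<eta>))"
  proof -
    have "(2 :: ennreal) ^ Suc CARD('d) = ennreal (2 ^ Suc CARD('d))"
      using ennreal_power[of 2 "Suc CARD('d)"] by simp
    then show ?thesis using K C' \<eta> by (simp only: ennreal_mult'[symmetric] mult_nonneg_nonneg zero_le_power)
  qed
  also have "\<dots> \<le> ennreal (1 / 2)"
    using \<eta>2 unfolding K_def by (rule ennreal_leI)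
  finally have small: "2 ^ Suc CARD('d) * bnorm r \<le> ennreal (1 / 2)" .
  \<comment> \<open>However large the scale chosen for the cutoff makes \<open>c\<close>, the
    envelope contains it once as a factor, so finiteness is all that is needed.\<close>
  have Efin: "bnorm (\<lambda>n. ennreal K * E n) < \<infinity>"
    unfolding bnorm_cmult E_def M_def using bnorm_polynomial_decay[where 'd='d]
    by (simp add: ennreal_mult_less_top)
  have "bnorm (\<lambda>n. ennreal (norm (aYX (phik n) B))) \<le> bnorm (\<lambda>n. \<Sum>k. env k n)"
    by (rule bnorm_mono[OF main])
  also have "\<dots> < \<infinity>"
    unfolding env_def by (rule bnorm_suminf_neumann_envelope[OF small Efin])
  finally show ?thesis
    using assms(3) unfolding beurling_class_def beurling_norm_eq_bnorm rvec_def by simp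
qed

end
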